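(* Let $K\subset\mathbb C$ be a subfield, let $L\ge 2$, let $\mathbf n=(n_0,\ldots,n_L)$ be a width vector of positive integers and let $\mathbf d=(d_1,\ldots,d_{L-1})$ be activation degrees. Assume that $$n_i\ge 2\quad\text{for } i=0,\ldots,L-1,\qquad d_i\ge 2n_i-1\quad\text{for } i=1,\ldots,L-1.$$ Then the neurovariety $\mathcal V_{\mathbf n,\mathbf d}$ is non defective and $$\dim\mathcal V_{\mathbf n,\mathbf d}=\sum_{i=1}^L n_i(n_{i-1}-1).$$
   Context: Let $K\subset\mathbb C$ be a subfield. For weight matrices $W_i\in K^{n_i\times n_{i-1}}$, $i=1,\dots,L$, and integers $d_i\ge2$, let $\sigma_i:K^{n_i}\to K^{n_i}$ be the element-wise power map $\sigma_i(y_0,\dots,y_{n_i-1})=(y_0^{d_i},\dots,y_{n_i-1}^{d_i})$ for $i=1,\dots,L-1$. Set $$F=W_L\circ\sigma_{L-1}\circ W_{L-1}\circ\cdots\circ W_2\circ\sigma_1\circ W_1:K^{n_0}\to K^{n_L}.$$ The coordinate functions $F_1,\dots,F_{n_L}$ are homogeneous polynomials of degree $d=\prod_{i=1}^{L-1}d_i$ in the $n_0$ input variables. Write $\operatorname{Sym}_dK^{n_0}$ for the space of homogeneous polynomials of degree $d$ in $n_0$ variables. The parameterization is the (rational) map $$\phi: K^{n_1\times n_0}\times\cdots\times K^{n_L\times n_{L-1}}\dashrightarrow\bigl(\mathbb P(\operatorname{Sym}_dK^{n_0})\bigr)^{n_L},\qquad (W_1,\dots,W_L)\mapsto (F_1,\dots,F_{n_L}),$$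 defined where all $F_\ell\neq0$; each output is projectivized separately. The neurovariety $\mathcal V_{\mathbf n,\mathbf d}$ is the Zariski closure of the image of $\phi$. Set $N=n_L\binom{n_0-1+d}{n_0-1}-n_L$. If $n_L\ge2$, the expected dimension is $$\min\Bigl\{\sum_{i=1}^L n_i(n_{i-1}-1),\ N\Bigr\}.$$ If $n_L=1$, the (refined) expected dimension, used in place of the previous one, is $$\min\Bigl\{\sum_{i=1}^L n_i(n_{i-1}-1),\ \sum_{i=1}^{L-2} n_i(n_{i-1}-1)+\binom{n_{L-2}-1+d_{L-1}}{n_{L-2}-1}-1,\ N\Bigr\}.$$ The neurovariety is called defective if its dimension is strictly smaller than its expected dimension (the refined one when $n_L=1$), and non defective otherwise. *)

theory Defs
  imports
    "HOL-Analysis.Abstract_Topology"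
    "HOL-Library.Poly_Mapping"
    "HOL-Library.Extended_Nat"
    "HOL-Algebra.Algebraic_Closure_Type"
    "Jordan_Normal_Form.Matrix"
begin

(* clashes with the notation of vec_index *)
no_notation fps_nth (infixl \<open>$\<close> 75)

section \<open>Polynomials in indeterminates from a type\<close>

text \<open>A monomial is a finitely supported exponent function; the ring structure (convolution
  product) is the one of \<^theory>\<open>HOL-Library.Poly_Mapping\<close>.\<close>

type_synonym 'v monomial = "'v \<Rightarrow>\<^sub>0 nat"
type_synonym 'v cpoly = "'v monomial \<Rightarrow>\<^sub>0 complex"

definition poly_const :: "complex \<Rightarrow> 'v cpoly" where
  "poly_const c = Poly_Mapping.single 0 c"

definition poly_var :: "'v \<Rightarrow> 'v cpoly" where
  "poly_var v = Poly_Mapping.single (Poly_Mapping.single v 1) 1"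

definition monomial_eval :: "('v \<Rightarrow> complex) \<Rightarrow> 'v monomial \<Rightarrow> complex" where
  "monomial_eval x m = (\<Prod>v\<in>Poly_Mapping.keys m. x v ^ Poly_Mapping.lookup m v)"

definition poly_eval :: "('v \<Rightarrow> complex) \<Rightarrow> 'v cpoly \<Rightarrow> complex" where
  "poly_eval x p = (\<Sum>m\<in>Poly_Mapping.keys p. Poly_Mapping.lookup p m * monomial_eval x m)"

lemma poly_mapping_eq_sum_single:
  "p = (\<Sum>m\<in>Poly_Mapping.keys p. Poly_Mapping.single m (Poly_Mapping.lookup p m))"
  by (rule poly_mapping_eqI) (auto simp: lookup_sum lookup_single when_def in_keys_iff)

lemma poly_mult_eq_sum_single:
  "p * q = (\<Sum>a\<in>Poly_Mapping.keys p. \<Sum>b\<in>Poly_Mapping.keys q.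
     Poly_Mapping.single (a + b) (Poly_Mapping.lookup p a * Poly_Mapping.lookup q b))"
  using arg_cong2[OF poly_mapping_eq_sum_single[of p] poly_mapping_eq_sum_single[of q], of "(*)"]
  by (simp add: sum_product mult_single)

lemma lookup_poly_const_mult:
  "Poly_Mapping.lookup (poly_const c * p) t = c * Poly_Mapping.lookup p t"
  unfolding poly_const_def mult_map_scale_conv_mult[symmetric]
  by (simp add: Poly_Mapping.map.rep_eq when_def)

lemma monomial_eval_superset:
  assumes "finite A" "Poly_Mapping.keys m \<subseteq> A"
  shows "monomial_eval x m = (\<Prod>v\<in>A. x v ^ Poly_Mapping.lookup m v)"
  unfolding monomial_eval_def
  by (rule prod.mono_neutral_left) (use assms in \<open>auto simp: in_keys_iff\<close>)

lemma monomial_eval_add: "monomial_eval x (a + b) = monomial_eval x a * monomial_eval x b"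
proof -
  let ?A = "Poly_Mapping.keys a \<union> Poly_Mapping.keys b"
  have "finite ?A" "Poly_Mapping.keys (a + b) \<subseteq> ?A"
    by (auto simp: keys_add)
  then show ?thesis
    by (simp add: monomial_eval_superset[of ?A] lookup_add power_add prod.distrib)
qed

lemma poly_eval_add: "poly_eval x (p + q) = poly_eval x p + poly_eval x q"
  unfolding poly_eval_def
  by (rule setsum_keys_plus_distrib) (auto simp: distrib_right)

lemma poly_eval_0 [simp]: "poly_eval x 0 = 0"
  by (simp add: poly_eval_def)

lemma poly_eval_1 [simp]: "poly_eval x 1 = 1"
  by (simp add: poly_eval_def monomial_eval_def)

lemma poly_eval_sum: "poly_eval x (\<Sum>i\<in>A. f i) = (\<Sum>i\<in>A. poly_eval x (f i))"
  by (induction A rule: infinite_finite_induct) (auto simp: poly_eval_add)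

lemma poly_eval_single: "poly_eval x (Poly_Mapping.single m c) = c * monomial_eval x m"
  by (simp add: poly_eval_def)

lemma poly_eval_mult: "poly_eval x (p * q) = poly_eval x p * poly_eval x q"
proof -
  have "poly_eval x (p * q) = (\<Sum>a\<in>Poly_Mapping.keys p. \<Sum>b\<in>Poly_Mapping.keys q.
      Poly_Mapping.lookup p a * Poly_Mapping.lookup q b * (monomial_eval x a * monomial_eval x b))"
    by (subst poly_mult_eq_sum_single)
       (simp add: poly_eval_sum poly_eval_single monomial_eval_add)
  also have "\<dots> = poly_eval x p * poly_eval x q"
    by (simp add: poly_eval_def sum_product ac_simps)
  finally show ?thesis .
qed

lemma subfield_complexD:
  assumes "subfield K (ring_of_type_algebra :: complex ring)"
  shows "0 \<in> K" "1 \<in> K" "x \<in> K \<Longrightarrow> y \<in> K \<Longrightarrow> x + y \<in> K" "x \<in> K \<Longrightarrow> y \<in> K \<Longrightarrow> x * y \<in> K"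
    "x \<in> K \<Longrightarrow> x \<noteq> 0 \<Longrightarrow> inverse x \<in> K"
proof -
  interpret subfield K "ring_of_type_algebra :: complex ring"
    by (fact assms)
  note [simp] = ring_of_type_algebra_def
  show "0 \<in> K" "1 \<in> K" "x \<in> K \<Longrightarrow> y \<in> K \<Longrightarrow> x + y \<in> K" "x \<in> K \<Longrightarrow> y \<in> K \<Longrightarrow> x * y \<in> K"
    using subringE[OF subring_axioms] by auto
  show "inverse x \<in> K" if "x \<in> K" "x \<noteq> 0"
  proof -
    have "x \<in> Units ((ring_of_type_algebra :: complex ring) \<lparr>carrier := K\<rparr>)"
      using subfield_Units that by simp
    then obtain y where "y \<in> K" "x * y = 1"
      by (auto simp: Units_def)
    then show ?thesis
      using inverse_unique by blast
  qed
qed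

lemma sum_in_subfield:
  assumes "subfield K (ring_of_type_algebra :: complex ring)" "\<And>i. i \<in> A \<Longrightarrow> f i \<in> K"
  shows "(\<Sum>i\<in>A. f i) \<in> K"
  using assms(2)
  by (induction A rule: infinite_finite_induct) (auto intro: subfield_complexD[OF assms(1)])

lemma lookup_mult_in_subfield:
  assumes K: "subfield K (ring_of_type_algebra :: complex ring)"
    and "\<And>m. Poly_Mapping.lookup p m \<in> K" "\<And>m. Poly_Mapping.lookup q m \<in> K"
  shows "Poly_Mapping.lookup (p * q) m \<in> K"
  by (subst poly_mult_eq_sum_single)
     (auto simp: lookup_sum lookup_single when_def
        intro!: sum_in_subfield[OF K] subfield_complexD[OF K] assms)

section \<open>Forms and the product of projective spaces\<close>

definition monomials_of_degree :: "nat \<Rightarrow> nat \<Rightarrow> nat monomial set" where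
  "monomials_of_degree m D =
     {t. Poly_Mapping.keys t \<subseteq> {..<m} \<and> (\<Sum>i\<in>Poly_Mapping.keys t. Poly_Mapping.lookup t i) = D}"

definition forms :: "complex set \<Rightarrow> nat \<Rightarrow> nat \<Rightarrow> nat cpoly set" where
  "forms K m D =
     {p. Poly_Mapping.keys p \<subseteq> monomials_of_degree m D \<and> (\<forall>t. Poly_Mapping.lookup p t \<in> K)}"

text \<open>A point of \<open>\<P>(Sym\<^sub>D K\<^sup>m)\<close> is the set of all its representatives, i.e. the
  \<open>K\<^sup>\<times>\<close>-orbit of a nonzero form.\<close>

definition proj_class :: "complex set \<Rightarrow> nat cpoly \<Rightarrow> nat cpoly set" where
  "proj_class K p = {poly_const c * p | c. c \<in> K - {0}}"

definition proj_forms :: "complex set \<Rightarrow> nat \<Rightarrow> nat \<Rightarrow> nat cpoly set set" where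
  "proj_forms K m D = proj_class K ` (forms K m D - {0})"

definition proj_forms_prod ::
  "complex set \<Rightarrow> nat \<Rightarrow> nat \<Rightarrow> nat \<Rightarrow> (nat \<Rightarrow> nat cpoly set) set" where
  "proj_forms_prod K m D k = (\<Pi>\<^sub>E l\<in>{..<k}. proj_forms K m D)"

section \<open>The Zariski topology\<close>

text \<open>The homogeneous coordinates on the product of \<open>k\<close> copies are indexed by pairs \<open>(l, t)\<close>: the
  coefficient of the monomial \<open>t\<close> in the \<open>l\<close>-th form. A multihomogeneous polynomial is homogeneous,
  of some degree \<open>e l\<close>, in each group \<open>(l, _)\<close> of coordinates.\<close>

definition multihom_polys ::
  "complex set \<Rightarrow> nat \<Rightarrow> nat \<Rightarrow> nat \<Rightarrow> (nat \<times> nat monomial) cpoly set" where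
  "multihom_polys K m D k =
     {g. (\<forall>M. Poly_Mapping.lookup g M \<in> K) \<and>
         (\<exists>e. \<forall>M\<in>Poly_Mapping.keys g.
            Poly_Mapping.keys M \<subseteq> {..<k} \<times> monomials_of_degree m D \<and>
            (\<forall>l<k. (\<Sum>v\<in>{v\<in>Poly_Mapping.keys M. fst v = l}. Poly_Mapping.lookup M v) = e l))}"

definition form_coords :: "(nat \<Rightarrow> nat cpoly) \<Rightarrow> nat \<times> nat monomial \<Rightarrow> complex" where
  "form_coords G = (\<lambda>(l, t). Poly_Mapping.lookup (G l) t)"

definition zero_locus ::
  "complex set \<Rightarrow> nat \<Rightarrow> nat \<Rightarrow> nat \<Rightarrow> (nat \<times> nat monomial) cpoly set
     \<Rightarrow> (nat \<Rightarrow> nat cpoly set) set" where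
  "zero_locus K m D k S =
     {P \<in> proj_forms_prod K m D k.
        \<forall>g\<in>S. \<forall>G. (\<forall>l<k. G l \<in> P l) \<longrightarrow> poly_eval (form_coords G) g = 0}"

text \<open>That the following predicate is a topology is \<open>istopology_zariski\<close> below.\<close>

definition zariski ::
  "complex set \<Rightarrow> nat \<Rightarrow> nat \<Rightarrow> nat \<Rightarrow> (nat \<Rightarrow> nat cpoly set) topology" where
  "zariski K m D k =
     topology (\<lambda>U. \<exists>S \<subseteq> multihom_polys K m D k. U = proj_forms_prod K m D k - zero_locus K m D k S)"

lemma poly_eval_rescale:
  assumes e: "\<And>M. M \<in> Poly_Mapping.keys g \<Longrightarrow> Poly_Mapping.keys M \<subseteq> {..<k} \<times> B \<and>
      (\<forall>l<k. (\<Sum>v\<in>{v\<in>Poly_Mapping.keys M. fst v = l}. Poly_Mapping.lookup M v) = e l)"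
    and G': "\<And>l. l < k \<Longrightarrow> G' l = poly_const (c l) * G l"
  shows "poly_eval (form_coords G') g = (\<Prod>l<k. c l ^ e l) * poly_eval (form_coords G) g"
proof -
  have "monomial_eval (form_coords G') M = (\<Prod>l<k. c l ^ e l) * monomial_eval (form_coords G) M"
    if M: "M \<in> Poly_Mapping.keys g" for M
  proof -
    let ?A = "Poly_Mapping.keys M" and ?l = "Poly_Mapping.lookup M"
    have A: "?A \<subseteq> {..<k} \<times> B" using e[OF M] by simp
    have "monomial_eval (form_coords G') M =
        (\<Prod>v\<in>?A. c (fst v) ^ ?l v * form_coords G v ^ ?l v)"
      unfolding monomial_eval_def
      by (rule prod.cong)
         (use A in \<open>auto simp: form_coords_def G' lookup_poly_const_mult power_mult_distrib\<close>)
    also have "\<dots> = (\<Prod>v\<in>?A. c (fst v) ^ ?l v) * monomial_eval (form_coords G) M"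
      by (simp add: prod.distrib monomial_eval_def)
    also have "(\<Prod>v\<in>?A. c (fst v) ^ ?l v) = (\<Prod>l<k. \<Prod>v\<in>{v\<in>?A. fst v = l}. c (fst v) ^ ?l v)"
      by (rule prod.group[symmetric]) (use A in auto)
    also have "\<dots> = (\<Prod>l<k. c l ^ e l)"
      using e[OF M] by (intro prod.cong) (auto simp: power_sum[symmetric])
    finally show ?thesis .
  qed
  then show ?thesis
    by (simp add: poly_eval_def sum_distrib_left mult.left_commute)
qed

lemma proj_forms_rescale:
  assumes "P \<in> proj_forms K m D" "p \<in> P" "q \<in> P"
  shows "\<exists>c. c \<noteq> 0 \<and> q = poly_const c * p"
proof -
  obtain r a b where ab: "a \<noteq> 0" "b \<noteq> 0" "p = poly_const a * r" "q = poly_const b * r"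
    using assms by (auto simp: proj_forms_def proj_class_def)
  then have "q = poly_const (b / a) * p"
    by (intro poly_mapping_eqI) (simp add: lookup_poly_const_mult)
  with ab show ?thesis by (intro exI[of _ "b / a"]) auto
qed

lemma proj_forms_nonempty:
  assumes "subfield K (ring_of_type_algebra :: complex ring)" "P \<in> proj_forms K m D"
  shows "P \<noteq> {}"
  using assms subfield_complexD(2)[OF assms(1)] by (force simp: proj_forms_def proj_class_def)

lemma multihom_eval_representative:
  assumes "g \<in> multihom_polys K m D k" "P \<in> proj_forms_prod K m D k"
    and "\<forall>l<k. G l \<in> P l" "\<forall>l<k. G' l \<in> P l"
  shows "poly_eval (form_coords G') g = 0 \<longleftrightarrow> poly_eval (form_coords G) g = 0"
proof -
  have "\<forall>l<k. \<exists>c. c \<noteq> 0 \<and> G' l = poly_const c * G l"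
    using assms(2-4) by (auto simp: proj_forms_prod_def intro!: proj_forms_rescale)
  then obtain c where c: "\<And>l. l < k \<Longrightarrow> c l \<noteq> 0 \<and> G' l = poly_const (c l) * G l"
    by metis
  obtain e where e: "\<forall>M\<in>Poly_Mapping.keys g.
            Poly_Mapping.keys M \<subseteq> {..<k} \<times> monomials_of_degree m D \<and>
            (\<forall>l<k. (\<Sum>v\<in>{v\<in>Poly_Mapping.keys M. fst v = l}. Poly_Mapping.lookup M v) = e l)"
    using assms(1) by (auto simp: multihom_polys_def)
  have "poly_eval (form_coords G') g = (\<Prod>l<k. c l ^ e l) * poly_eval (form_coords G) g"
    by (rule poly_eval_rescale) (use e c in auto)
  then show ?thesis using c by auto
qed

lemma multihom_polys_mult:
  assumes K: "subfield K (ring_of_type_algebra :: complex ring)"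
    and g: "g \<in> multihom_polys K m D k" and h: "h \<in> multihom_polys K m D k"
  shows "g * h \<in> multihom_polys K m D k"
proof -
  let ?B = "{..<k} \<times> monomials_of_degree m D"
  let ?s = "\<lambda>M l. \<Sum>v\<in>{v\<in>Poly_Mapping.keys M. fst v = l}. Poly_Mapping.lookup M v"
  obtain e where e: "\<And>M. M \<in> Poly_Mapping.keys g \<Longrightarrow>
      Poly_Mapping.keys M \<subseteq> ?B \<and> (\<forall>l<k. ?s M l = e l)"
    using g unfolding multihom_polys_def by blast
  obtain f where f: "\<And>M. M \<in> Poly_Mapping.keys h \<Longrightarrow>
      Poly_Mapping.keys M \<subseteq> ?B \<and> (\<forall>l<k. ?s M l = f l)"
    using h unfolding multihom_polys_def by blast
  have s_add: "?s (a + b) l = ?s a l + ?s b l" for a b :: "(nat \<times> nat monomial) monomial" and l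
    using setsum_keys_plus_distrib[of "\<lambda>v x. if fst v = l then x else 0" a b]
    by (simp add: sum.inter_filter)
  have "Poly_Mapping.keys M \<subseteq> ?B \<and> (\<forall>l<k. ?s M l = e l + f l)"
    if "M \<in> Poly_Mapping.keys (g * h)" for M
  proof -
    obtain a b where M: "M = a + b" and ab: "a \<in> Poly_Mapping.keys g" "b \<in> Poly_Mapping.keys h"
      using keys_mult[of g h] \<open>M \<in> Poly_Mapping.keys (g * h)\<close> by blast
    have "Poly_Mapping.keys M \<subseteq> ?B"
      using keys_add[of a b] e[OF ab(1)] f[OF ab(2)] unfolding M by blast
    moreover have "?s M l = e l + f l" if "l < k" for l
      using e[OF ab(1)] f[OF ab(2)] that unfolding M s_add by simp
    ultimately show ?thesis by blast
  qed
  then have "\<exists>e. \<forall>M\<in>Poly_Mapping.keys (g * h). Poly_Mapping.keys M \<subseteq> ?B \<and> (\<forall>l<k. ?s M l = e l)"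
    by (intro exI[of _ "\<lambda>l. e l + f l"]) blast
  moreover have "Poly_Mapping.lookup (g * h) M \<in> K" for M
    using g h by (intro lookup_mult_in_subfield[OF K]) (auto simp: multihom_polys_def)
  ultimately show ?thesis
    by (simp add: multihom_polys_def)
qed

lemma zero_locus_Un:
  assumes K: "subfield K (ring_of_type_algebra :: complex ring)"
    and S: "S \<subseteq> multihom_polys K m D k" and S': "S' \<subseteq> multihom_polys K m D k"
  shows "zero_locus K m D k S \<union> zero_locus K m D k S' =
    zero_locus K m D k {g * h | g h. g \<in> S \<and> h \<in> S'}"
proof (intro equalityI subsetI)
  fix P assume "P \<in> zero_locus K m D k S \<union> zero_locus K m D k S'"
  then show "P \<in> zero_locus K m D k {g * h | g h. g \<in> S \<and> h \<in> S'}"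
    by (force simp: zero_locus_def poly_eval_mult)
next
  fix P assume P: "P \<in> zero_locus K m D k {g * h | g h. g \<in> S \<and> h \<in> S'}"
  show "P \<in> zero_locus K m D k S \<union> zero_locus K m D k S'"
  proof (rule ccontr)
    assume "\<not> ?thesis"
    with P obtain g G h H where *: "g \<in> S" "\<forall>l<k. G l \<in> P l" "poly_eval (form_coords G) g \<noteq> 0"
      "h \<in> S'" "\<forall>l<k. H l \<in> P l" "poly_eval (form_coords H) h \<noteq> 0"
      unfolding zero_locus_def by blast
    have "poly_eval (form_coords G) h \<noteq> 0"
      using multihom_eval_representative[of h K m D k P G H] * P S'
      by (auto simp: zero_locus_def)
    with * have "poly_eval (form_coords G) (g * h) \<noteq> 0"
      by (simp add: poly_eval_mult)
    moreover have "g * h \<in> {g * h | g h. g \<in> S \<and> h \<in> S'}"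
      using * by blast
    ultimately show False
      using * P unfolding zero_locus_def by blast
  qed
qed

lemma istopology_zariski:
  assumes K: "subfield K (ring_of_type_algebra :: complex ring)"
  shows "istopology (\<lambda>U. \<exists>S \<subseteq> multihom_polys K m D k.
    U = proj_forms_prod K m D k - zero_locus K m D k S)"
  unfolding istopology_def
proof (intro conjI allI impI)
  fix U V
  assume "\<exists>S \<subseteq> multihom_polys K m D k. U = proj_forms_prod K m D k - zero_locus K m D k S"
    "\<exists>S \<subseteq> multihom_polys K m D k. V = proj_forms_prod K m D k - zero_locus K m D k S"
  then obtain S S' where S: "S \<subseteq> multihom_polys K m D k" "S' \<subseteq> multihom_polys K m D k"
    and "U = proj_forms_prod K m D k - zero_locus K m D k S"
      "V = proj_forms_prod K m D k - zero_locus K m D k S'"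
    by blast
  then have "U \<inter> V = proj_forms_prod K m D k - zero_locus K m D k {g * h | g h. g \<in> S \<and> h \<in> S'}"
    unfolding zero_locus_Un[OF K S, symmetric] by blast
  then show "\<exists>S \<subseteq> multihom_polys K m D k. U \<inter> V = proj_forms_prod K m D k - zero_locus K m D k S"
    using S multihom_polys_mult[OF K]
    by (intro exI[of _ "{g * h | g h. g \<in> S \<and> h \<in> S'}"]) blast
next
  fix \<U>
  assume "\<forall>U\<in>\<U>. \<exists>S \<subseteq> multihom_polys K m D k. U = proj_forms_prod K m D k - zero_locus K m D k S"
  then obtain S where S: "\<And>U. U \<in> \<U> \<Longrightarrow> S U \<subseteq> multihom_polys K m D k \<and>
      U = proj_forms_prod K m D k - zero_locus K m D k (S U)"
    by metis
  have "\<Union>\<U> = (\<Union>U\<in>\<U>. proj_forms_prod K m D k - zero_locus K m D k (S U))"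
    using S by blast
  also have "\<dots> = proj_forms_prod K m D k - zero_locus K m D k (\<Union>U\<in>\<U>. S U)"
    by (auto simp: zero_locus_def)
  finally show "\<exists>S \<subseteq> multihom_polys K m D k. \<Union>\<U> = proj_forms_prod K m D k - zero_locus K m D k S"
    using S by (intro exI[of _ "\<Union>U\<in>\<U>. S U"]) blast
qed

lemma topspace_zariski:
  assumes K: "subfield K (ring_of_type_algebra :: complex ring)"
  shows "topspace (zariski K m D k) = proj_forms_prod K m D k"
proof -
  have 1: "(1 :: (nat \<times> nat monomial) cpoly) \<in> multihom_polys K m D k"
    using subfield_complexD(1,2)[OF K]
    by (auto simp: multihom_polys_def lookup_one when_def intro!: exI[of _ "\<lambda>_. 0"])
  have "P \<notin> zero_locus K m D k {1}" for P
  proof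
    assume P: "P \<in> zero_locus K m D k {1}"
    then have "\<forall>l<k. \<exists>p. p \<in> P l"
      using proj_forms_nonempty[OF K] by (fastforce simp: zero_locus_def proj_forms_prod_def)
    then obtain G where "\<forall>l<k. G l \<in> P l" by metis
    with P show False by (auto simp: zero_locus_def)
  qed
  then have "proj_forms_prod K m D k = proj_forms_prod K m D k - zero_locus K m D k {1}"
    by blast
  with 1 have "openin (zariski K m D k) (proj_forms_prod K m D k)"
    unfolding zariski_def topology_inverse'[OF istopology_zariski[OF K]]
    by (intro exI[of _ "{1}"]) auto
  moreover have "U \<subseteq> proj_forms_prod K m D k" if "openin (zariski K m D k) U" for U
    using that unfolding zariski_def topology_inverse'[OF istopology_zariski[OF K]] by auto
  ultimately show ?thesis
    by (metis openin_subset openin_topspace subset_antisym)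
qed

lemma closedin_zariski:
  assumes K: "subfield K (ring_of_type_algebra :: complex ring)"
  shows "closedin (zariski K m D k) A \<longleftrightarrow> (\<exists>S \<subseteq> multihom_polys K m D k. A = zero_locus K m D k S)"
proof -
  have "zero_locus K m D k S \<subseteq> proj_forms_prod K m D k" for S
    by (auto simp: zero_locus_def)
  then show ?thesis
    unfolding closedin_def topspace_zariski[OF K]
    unfolding zariski_def topology_inverse'[OF istopology_zariski[OF K]]
    by (metis (no_types, lifting) Diff_Diff_Int Diff_subset inf.absorb_iff2)
qed

section \<open>Krull dimension of a topological space\<close>

definition irreducible_space :: "'a topology \<Rightarrow> bool" where
  "irreducible_space T \<longleftrightarrow> topspace T \<noteq> {} \<and>
     (\<forall>A B. closedin T A \<and> closedin T B \<and> A \<union> B = topspace T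
        \<longrightarrow> A = topspace T \<or> B = topspace T)"

text \<open>Supremum of the lengths \<open>r\<close> of chains \<open>Z 0 \<subset> \<dots> \<subset> Z r\<close> of irreducible closed subsets
  (\<open>0\<close> for the empty space).\<close>

definition krull_dim :: "'a topology \<Rightarrow> enat" where
  "krull_dim T = Sup {enat r | r. \<exists>Z :: nat \<Rightarrow> 'a set.
     (\<forall>i\<le>r. closedin T (Z i) \<and> irreducible_space (subtopology T (Z i))) \<and>
     (\<forall>i<r. Z i \<subset> Z (Suc i))}"

section \<open>Networks and neurovarieties\<close>

definition weights :: "complex set \<Rightarrow> nat \<Rightarrow> (nat \<Rightarrow> nat) \<Rightarrow> (nat \<Rightarrow> complex mat) set" where
  "weights K L n =
     {W. \<forall>i\<in>{1..L}. W i \<in> carrier_mat (n i) (n (i - 1)) \<and> elements_mat (W i) \<subseteq> K}"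

text \<open>The network is evaluated at the vector of indeterminates, so that its outputs are polynomials;
  \<open>hidden n d W i\<close> is \<open>\<sigma>\<^sub>i \<circ> W\<^sub>i \<circ> \<dots> \<circ> \<sigma>\<^sub>1 \<circ> W\<^sub>1\<close>.\<close>

primrec hidden ::
  "(nat \<Rightarrow> nat) \<Rightarrow> (nat \<Rightarrow> nat) \<Rightarrow> (nat \<Rightarrow> complex mat) \<Rightarrow> nat \<Rightarrow> nat cpoly vec" where
  "hidden n d W 0 = vec (n 0) poly_var"
| "hidden n d W (Suc i) =
     map_vec (\<lambda>y. y ^ d (Suc i)) (map_mat poly_const (W (Suc i)) *\<^sub>v hidden n d W i)"

definition network ::
  "nat \<Rightarrow> (nat \<Rightarrow> nat) \<Rightarrow> (nat \<Rightarrow> nat) \<Rightarrow> (nat \<Rightarrow> complex mat) \<Rightarrow> nat cpoly vec" where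
  "network L n d W = map_mat poly_const (W L) *\<^sub>v hidden n d W (L - 1)"

definition total_degree :: "nat \<Rightarrow> (nat \<Rightarrow> nat) \<Rightarrow> nat" where
  "total_degree L d = (\<Prod>i=1..L-1. d i)"

definition param_domain ::
  "complex set \<Rightarrow> nat \<Rightarrow> (nat \<Rightarrow> nat) \<Rightarrow> (nat \<Rightarrow> nat) \<Rightarrow> (nat \<Rightarrow> complex mat) set" where
  "param_domain K L n d = {W \<in> weights K L n. \<forall>l<n L. network L n d W $ l \<noteq> 0}"

definition param_map ::
  "complex set \<Rightarrow> nat \<Rightarrow> (nat \<Rightarrow> nat) \<Rightarrow> (nat \<Rightarrow> nat) \<Rightarrow> (nat \<Rightarrow> complex mat)
     \<Rightarrow> nat \<Rightarrow> nat cpoly set" where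
  "param_map K L n d W = (\<lambda>l\<in>{..<n L}. proj_class K (network L n d W $ l))"

definition neurovariety ::
  "complex set \<Rightarrow> nat \<Rightarrow> (nat \<Rightarrow> nat) \<Rightarrow> (nat \<Rightarrow> nat) \<Rightarrow> (nat \<Rightarrow> nat cpoly set) set" where
  "neurovariety K L n d =
     Abstract_Topology.closure_of (zariski K (n 0) (total_degree L d) (n L))
       (param_map K L n d ` param_domain K L n d)"

definition neurovariety_dim ::
  "complex set \<Rightarrow> nat \<Rightarrow> (nat \<Rightarrow> nat) \<Rightarrow> (nat \<Rightarrow> nat) \<Rightarrow> enat" where
  "neurovariety_dim K L n d =
     krull_dim (subtopology (zariski K (n 0) (total_degree L d) (n L)) (neurovariety K L n d))"

lemma monomials_of_degree_add:
  assumes "a \<in> monomials_of_degree m D" "b \<in> monomials_of_degree m E"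
  shows "a + b \<in> monomials_of_degree m (D + E)"
  using assms keys_add[of a b] setsum_keys_plus_distrib[of "\<lambda>_ x. x" a b]
  by (auto simp: monomials_of_degree_def)

lemma forms_mult:
  assumes K: "subfield K (ring_of_type_algebra :: complex ring)"
    and "p \<in> forms K m D" "q \<in> forms K m E"
  shows "p * q \<in> forms K m (D + E)"
proof -
  have "Poly_Mapping.keys (p * q) \<subseteq> monomials_of_degree m (D + E)"
    using assms(2,3) keys_mult[of p q] by (force simp: forms_def intro: monomials_of_degree_add)
  then show ?thesis
    using assms by (auto simp: forms_def intro: lookup_mult_in_subfield[OF K])
qed

lemma forms_const: "subfield K (ring_of_type_algebra :: complex ring) \<Longrightarrow> c \<in> K \<Longrightarrow>
    poly_const c \<in> forms K m 0"
  by (auto simp: forms_def poly_const_def lookup_single when_def monomials_of_degree_def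
      subfield_complexD)

lemma forms_var: "subfield K (ring_of_type_algebra :: complex ring) \<Longrightarrow> i < m \<Longrightarrow>
    poly_var i \<in> forms K m 1"
  by (auto simp: forms_def poly_var_def lookup_single when_def monomials_of_degree_def
      subfield_complexD)

lemma forms_power:
  assumes K: "subfield K (ring_of_type_algebra :: complex ring)" and p: "p \<in> forms K m D"
  shows "p ^ e \<in> forms K m (e * D)"
proof (induction e)
  case 0
  then show ?case
    using forms_const[OF K subfield_complexD(2)[OF K]] by (simp add: poly_const_def)
next
  case (Suc e)
  then show ?case
    using forms_mult[OF K p] by simp
qed

lemma forms_sum:
  assumes K: "subfield K (ring_of_type_algebra :: complex ring)"
    and "\<And>i. i \<in> A \<Longrightarrow> f i \<in> forms K m D"
  shows "(\<Sum>i\<in>A. f i) \<in> forms K m D"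
  using assms(2)
proof (induction A rule: infinite_finite_induct)
  case (insert x A)
  then have "f x \<in> forms K m D" "(\<Sum>i\<in>A. f i) \<in> forms K m D"
    by blast+
  then have "f x + (\<Sum>i\<in>A. f i) \<in> forms K m D"
    using keys_add[of "f x" "\<Sum>i\<in>A. f i"] unfolding forms_def mem_Collect_eq lookup_add
    by (blast intro: subfield_complexD[OF K])
  with insert show ?case
    by simp
qed (auto simp: forms_def subfield_complexD[OF K])

lemma layer_forms:
  fixes v :: "nat cpoly vec"
  assumes K: "subfield K (ring_of_type_algebra :: complex ring)"
    and "A \<in> carrier_mat r s" "elements_mat A \<subseteq> K" "dim_vec v = s"
    and v: "\<And>j. j < s \<Longrightarrow> v $ j \<in> forms K m D" and "l < r"
  shows "(map_mat poly_const A *\<^sub>v v) $ l \<in> forms K m D"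
proof -
  have "poly_const (A $$ (l, j)) * v $ j \<in> forms K m D" if "j < s" for j
    using forms_mult[OF K forms_const[OF K, of "A $$ (l, j)"] v[OF that]] assms that by auto
  then show ?thesis
    using assms by (auto simp: scalar_prod_def intro!: forms_sum[OF K])
qed

text \<open>The coordinate functions are forms of degree \<open>\<Prod> d\<^sub>i\<close>, so that \<open>param_map\<close> takes values in
  the product of projective spaces.\<close>

lemma hidden_forms:
  assumes K: "subfield K (ring_of_type_algebra :: complex ring)" and W: "W \<in> weights K L n"
  shows "i \<le> L \<Longrightarrow> dim_vec (hidden n d W i) = n i \<and>
    (\<forall>j<n i. hidden n d W i $ j \<in> forms K (n 0) (\<Prod>r=1..i. d r))"
proof (induction i)
  case 0
  then show ?case using forms_var[OF K] by simp
next
  case (Suc i)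
  have A: "W (Suc i) \<in> carrier_mat (n (Suc i)) (n i)" "elements_mat (W (Suc i)) \<subseteq> K"
    using W Suc.prems by (auto simp: weights_def dest: bspec[of _ _ "Suc i"])
  then have "(map_mat poly_const (W (Suc i)) *\<^sub>v hidden n d W i) $ j
      \<in> forms K (n 0) (\<Prod>r=1..i. d r)" if "j < n (Suc i)" for j
    using layer_forms[OF K A] Suc that by simp
  from forms_power[OF K this]
  have "(map_mat poly_const (W (Suc i)) *\<^sub>v hidden n d W i) $ j ^ d (Suc i)
      \<in> forms K (n 0) (\<Prod>r=1..Suc i. d r)" if "j < n (Suc i)" for j
    using that by (simp add: mult.commute)
  with A show ?case
    by auto
qed

lemma network_forms:
  assumes K: "subfield K (ring_of_type_algebra :: complex ring)" and W: "W \<in> weights K L n"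
    and L: "1 \<le> L" and l: "l < n L"
  shows "network L n d W $ l \<in> forms K (n 0) (total_degree L d)"
  unfolding network_def total_degree_def
  by (rule layer_forms[OF K, of _ "n L" "n (L - 1)"])
     (use hidden_forms[OF K W, of "L - 1" d] W L l in \<open>auto simp: weights_def\<close>)

lemma param_map_image_subset:
  assumes K: "subfield K (ring_of_type_algebra :: complex ring)" and L: "1 \<le> L"
  shows "param_map K L n d ` param_domain K L n d
    \<subseteq> topspace (zariski K (n 0) (total_degree L d) (n L))"
  using network_forms[OF K _ L]
  by (auto simp: topspace_zariski[OF K] param_domain_def param_map_def proj_forms_prod_def
      proj_forms_def)

text \<open>No subtraction below truncates when \<open>L \<ge> 2\<close> and all widths are positive.\<close>

definition expected_dim :: "nat \<Rightarrow> (nat \<Rightarrow> nat) \<Rightarrow> (nat \<Rightarrow> nat) \<Rightarrow> nat" where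
  "expected_dim L n d =
     (let N = n L * ((n 0 - 1 + total_degree L d) choose (n 0 - 1)) - n L;
          p = (\<Sum>i=1..L. n i * (n (i - 1) - 1))
      in if n L = 1
         then Min {p,
                (\<Sum>i=1..L-2. n i * (n (i - 1) - 1))
                  + ((n (L - 2) - 1 + d (L - 1)) choose (n (L - 2) - 1)) - 1,
                N}
         else min p N)"

definition defective :: "complex set \<Rightarrow> nat \<Rightarrow> (nat \<Rightarrow> nat) \<Rightarrow> (nat \<Rightarrow> nat) \<Rightarrow> bool" where
  "defective K L n d \<longleftrightarrow> neurovariety_dim K L n d < enat (expected_dim L n d)"

end

theory Submission
  imports Defs
begin

text \<open>The proof compares two counts, both phrased in terms of homogeneous relations between
  multihomogeneous forms \<open>g\<^sub>0, \<dots>, g\<^sub>r\<close> of one common multidegree. Let \<open>s\<close> be the sum in the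
  theorem, which is the number of weights outside the first columns of the weight matrices.

  Upper bound. For a chain \<open>Z\<^sub>0 \<subset> \<dots> \<subset> Z\<^sub>r\<close> of irreducible closed sets choose \<open>g\<^sub>0\<close> not vanishing
  at a point of \<open>Z\<^sub>0\<close> and \<open>g\<^sub>i\<^sub>+\<^sub>1\<close> vanishing on \<open>Z\<^sub>i\<close> but not on \<open>Z\<^sub>i\<^sub>+\<^sub>1\<close>. Then no homogeneous relation
  between the \<open>g\<^sub>i\<close> holds on \<open>Z\<^sub>r\<close> (\<open>chain_without_relation\<close>). On the other hand, rescaling neurons
  turns almost all weights into weights with first columns equal to \<open>1\<close> without moving the point of
  the neurovariety (\<open>normalized_weights\<close>), so the neurovariety is parameterized by \<open>s\<close>
  parameters; and any \<open>s + 2\<close> polynomial functions of \<open>s\<close> parameters satisfy a homogeneous relation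
  because there are more monomials in the functions than monomials in the parameters
  (\<open>homogeneous_relation\<close>). Hence \<open>r \<le> s\<close>.

  Lower bound. Fix weights \<open>p\<close> and free the \<open>s\<close> weights outside the first columns one after the
  other. The closures of the images form an increasing chain of irreducible closed sets. If the
  differential at \<open>p\<close> in these \<open>s\<close> directions is injective modulo rescaling of the outputs, there
  are forms whose first order terms at \<open>p\<close> are the coordinates of the direction
  (\<open>dual_forms\<close>), and the lowest order term of a homogeneous relation between them would be a
  relation between independent coordinates (\<open>first_order_independence\<close>). So the chain is strict.

  The differential. A neuron \<open>z\<close> of a hidden layer enters the next layer as \<open>z ^ d\<close>, whose
  differential is a multiple of \<open>z ^ (d - 1)\<close>. If the powers \<open>z ^ (d - 1)\<close> of the neurons of every
  hidden layer are linearly independent over the forms of degree \<open>deg z\<close>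
  (\<open>layer_independent\<close>), a tangent vector that only rescales the outputs only rescales the
  neurons below, and so on down to the input (\<open>tangent_injective\<close>). The independence is an open
  condition on the weights, so it suffices to find, for each layer separately, weights that satisfy
  it; they are chosen such that the neurons of the layer are \<open>x ^ e + r * y ^ e\<close> with
  \<open>r = 0, 1, \<dots>\<close>. Comparing coefficients leaves a confluent Vandermonde system in \<open>2 n\<^sub>i\<close>
  unknowns, which has only the trivial solution because \<open>d\<^sub>i \<ge> 2 n\<^sub>i - 1\<close>
  (\<open>confluent_vandermonde\<close>).\<close>

abbreviation (input) "lookup \<equiv> Poly_Mapping.lookup"
abbreviation (input) "keys \<equiv> Poly_Mapping.keys"
abbreviation (input) "single \<equiv> Poly_Mapping.single"

section \<open>Subfields of the complex numbers\<close>

locale complex_subfield =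
  fixes K :: "complex set"
  assumes subfield: "subfield K (ring_of_type_algebra :: complex ring)"
begin

lemmas zero_in [simp, intro] = subfield_complexD(1)[OF subfield]
lemmas one_in [simp, intro] = subfield_complexD(2)[OF subfield]
lemmas add_in [intro!] = subfield_complexD(3)[OF subfield]
lemmas mult_in [intro!] = subfield_complexD(4)[OF subfield]
lemmas sum_in [intro!] = sum_in_subfield[OF subfield]

lemma uminus_in [intro!]:
  assumes "x \<in> K" shows "- x \<in> K"
proof -
  let ?R = "ring_of_type_algebra :: complex ring"
  have ring: "ring ?R" by (rule ring_from_type_algebra)
  have carr: "x \<in> carrier ?R" unfolding ring_of_type_algebra_def by simp
  have add: "a \<oplus>\<^bsub>?R\<^esub> b = a + b" and zero: "\<zero>\<^bsub>?R\<^esub> = 0" for a b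
    unfolding ring_of_type_algebra_def by simp_all
  have "subring K ?R"
    using subfield by (intro subcring.axioms(1) subdomain.axioms(1) subfield.axioms(1))
  then have "\<ominus>\<^bsub>?R\<^esub> x \<in> K" using assms by (rule subringE(5))
  moreover have "x + \<ominus>\<^bsub>?R\<^esub> x = 0"
    using abelian_group.r_neg[OF ring.is_abelian_group[OF ring] carr] unfolding add zero .
  then have "\<ominus>\<^bsub>?R\<^esub> x = - x" by (simp add: eq_neg_iff_add_eq_0 add.commute)
  ultimately show ?thesis by simp
qed

lemma diff_in [intro!]: "x \<in> K \<Longrightarrow> y \<in> K \<Longrightarrow> x - y \<in> K"
  using add_in[of x "- y"] uminus_in by simp

lemma divide_in [intro!]: "x \<in> K \<Longrightarrow> y \<in> K \<Longrightarrow> x / y \<in> K"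
  using mult_in[of x "inverse y"] subfield_complexD(5)[OF subfield, of y]
  by (cases "y = 0") (auto simp: divide_inverse)

lemma prod_in [intro!]: "(\<And>i. i \<in> A \<Longrightarrow> f i \<in> K) \<Longrightarrow> prod f A \<in> K"
  by (induction A rule: infinite_finite_induct) auto

lemma power_in [intro!]: "x \<in> K \<Longrightarrow> x ^ e \<in> K"
  by (induction e) auto

lemma of_nat_in [simp, intro!]: "of_nat e \<in> K"
  by (induction e) auto

lemma infinite_subfield: "infinite K"
proof -
  have "range (of_nat :: nat \<Rightarrow> complex) \<subseteq> K" by auto
  moreover have "infinite (range (of_nat :: nat \<Rightarrow> complex))"
    by (rule range_inj_infinite) (simp add: inj_on_def)
  ultimately show ?thesis using finite_subset by blast
qed

lemma poly_nonzero_in_subfield: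
  assumes "p \<noteq> (0 :: complex poly)"
  shows "\<exists>t\<in>K. poly p t \<noteq> 0"
proof -
  have "finite {t. poly p t = 0}" using poly_roots_finite[OF assms] .
  then have "\<not> K \<subseteq> {t. poly p t = 0}" using infinite_subfield finite_subset by blast
  then show ?thesis by blast
qed

end

section \<open>Polynomial functions\<close>

text \<open>Polynomials enter as functions: over an infinite field nothing is lost, and each closure or
  restriction property is a rule induction.\<close>

inductive_set polyfun :: "complex set \<Rightarrow> 'i set \<Rightarrow> (('i \<Rightarrow> complex) \<Rightarrow> complex) set"
  for K :: "complex set" and I :: "'i set" where
  const: "c \<in> K \<Longrightarrow> (\<lambda>_. c) \<in> polyfun K I"
| var: "i \<in> I \<Longrightarrow> (\<lambda>x. x i) \<in> polyfun K I"
| add: "f \<in> polyfun K I \<Longrightarrow> g \<in> polyfun K I \<Longrightarrow> (\<lambda>x. f x + g x) \<in> polyfun K I"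
| mult: "f \<in> polyfun K I \<Longrightarrow> g \<in> polyfun K I \<Longrightarrow> (\<lambda>x. f x * g x) \<in> polyfun K I"

lemma polyfun_subst:
  assumes "f \<in> polyfun K I" and "\<And>i. i \<in> I \<Longrightarrow> (\<lambda>x. s x i) \<in> polyfun K J"
  shows "(\<lambda>x. f (s x)) \<in> polyfun K J"
  using assms(1)
proof (induction rule: polyfun.induct)
  case (var i)
  then show ?case using assms(2) by simp
qed (auto intro: polyfun.intros)

context complex_subfield
begin

lemma polyfun_sum:
  "(\<And>a. a \<in> A \<Longrightarrow> f a \<in> polyfun K I) \<Longrightarrow> (\<lambda>x. \<Sum>a\<in>A. f a x) \<in> polyfun K I"
  by (induction A rule: infinite_finite_induct) (auto intro: polyfun.intros)

lemma polyfun_prod: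
  "(\<And>a. a \<in> A \<Longrightarrow> f a \<in> polyfun K I) \<Longrightarrow> (\<lambda>x. \<Prod>a\<in>A. f a x) \<in> polyfun K I"
  by (induction A rule: infinite_finite_induct) (auto intro: polyfun.intros)

lemma polyfun_power: "f \<in> polyfun K I \<Longrightarrow> (\<lambda>x. f x ^ e) \<in> polyfun K I"
  by (induction e) (auto intro: polyfun.intros)

lemma polyfun_diff:
  assumes "f \<in> polyfun K I" "g \<in> polyfun K I"
  shows "(\<lambda>x. f x - g x) \<in> polyfun K I"
proof -
  have "(\<lambda>x. f x + (- 1) * g x) \<in> polyfun K I"
    by (intro polyfun.intros assms) auto
  then show ?thesis by simp
qed

lemma polyfun_in:
  "f \<in> polyfun K I \<Longrightarrow> range x \<subseteq> K \<Longrightarrow> f x \<in> K"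
  by (induction rule: polyfun.induct) auto

lemma polyfun_on_line:
  assumes "f \<in> polyfun K I"
  shows "\<exists>p. \<forall>\<tau>. f (\<lambda>i. a i + \<tau> * b i) = poly p \<tau>"
  using assms
proof (induction rule: polyfun.induct)
  case (const c)
  show ?case by (rule exI[of _ "[:c:]"]) simp
next
  case (var i)
  show ?case by (rule exI[of _ "[:a i, b i:]"]) simp
next
  case (add f g)
  then obtain p q where "\<forall>\<tau>. f (\<lambda>i. a i + \<tau> * b i) = poly p \<tau>" "\<forall>\<tau>. g (\<lambda>i. a i + \<tau> * b i) = poly q \<tau>"
    by blast
  then show ?case by (intro exI[of _ "p + q"]) simp
next
  case (mult f g)
  then obtain p q where "\<forall>\<tau>. f (\<lambda>i. a i + \<tau> * b i) = poly p \<tau>" "\<forall>\<tau>. g (\<lambda>i. a i + \<tau> * b i) = poly q \<tau>"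
    by blast
  then show ?case by (intro exI[of _ "p * q"]) simp
qed

text \<open>Affine space over \<open>K\<close> is irreducible: on the line through \<open>x\<close> and \<open>y\<close> both functions become
  nonzero polynomials in one variable, and \<open>K\<close> is infinite.\<close>

lemma polyfun_common_nonzero:
  assumes f: "f \<in> polyfun K I" and g: "g \<in> polyfun K I"
    and x: "range x \<subseteq> K" "f x \<noteq> 0" and y: "range y \<subseteq> K" "g y \<noteq> 0"
  shows "\<exists>z. range z \<subseteq> K \<and> f z \<noteq> 0 \<and> g z \<noteq> 0"
proof -
  define l where "l = (\<lambda>\<tau> i. x i + \<tau> * (y i - x i))"
  obtain p where p: "\<And>\<tau>. f (l \<tau>) = poly p \<tau>"
    unfolding l_def using polyfun_on_line[OF f, of x "\<lambda>i. y i - x i"] by blast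
  obtain q where q: "\<And>\<tau>. g (l \<tau>) = poly q \<tau>"
    unfolding l_def using polyfun_on_line[OF g, of x "\<lambda>i. y i - x i"] by blast
  have "l 0 = x" "l 1 = y" by (auto simp: l_def)
  then have "p \<noteq> 0" "q \<noteq> 0" using x y p[of 0] q[of 1] by auto
  then have "p * q \<noteq> 0" by simp
  then obtain t where t: "t \<in> K" "poly (p * q) t \<noteq> 0" using poly_nonzero_in_subfield by blast
  have "range (l t) \<subseteq> K" using x y t by (auto simp: l_def image_subset_iff)
  then show ?thesis using t p q by (intro exI[of _ "l t"]) simp
qed

lemma polyfun_common_nonzero_finite:
  assumes "finite S" "\<And>s. s \<in> S \<Longrightarrow> f s \<in> polyfun K I"
    and "\<And>s. s \<in> S \<Longrightarrow> \<exists>x. range x \<subseteq> K \<and> f s x \<noteq> 0"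
  shows "\<exists>z. range z \<subseteq> K \<and> (\<forall>s\<in>S. f s z \<noteq> 0)"
  using assms
proof (induction S rule: finite_induct)
  case empty
  show ?case by (rule exI[of _ "\<lambda>_. 0"]) auto
next
  case (insert s S)
  obtain x where x: "range x \<subseteq> K" "\<forall>s\<in>S. f s x \<noteq> 0"
    using insert.IH[OF insert.prems(1) insert.prems(2)] by auto
  obtain y where y: "range y \<subseteq> K" "f s y \<noteq> 0"
    using insert.prems(2)[of s] by auto
  have g: "(\<lambda>x. \<Prod>s\<in>S. f s x) \<in> polyfun K I" using insert.prems by (intro polyfun_prod) auto
  have "(\<Prod>s\<in>S. f s x) \<noteq> 0" using x insert.hyps by simp
  then obtain z where "range z \<subseteq> K" "(\<Prod>s\<in>S. f s z) \<noteq> 0" "f s z \<noteq> 0"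
    using polyfun_common_nonzero[OF g insert.prems(1)[of s] x(1) _ y] by auto
  then show ?case using insert.hyps by (intro exI[of _ z]) auto
qed

text \<open>The derivative at \<open>0\<close> along lines through a \<open>K\<close>-point is a \<open>K\<close>-linear form in the direction; this is
  what makes linear algebra over \<open>K\<close> applicable to differentials.\<close>

lemma polyfun_gradient:
  assumes "f \<in> polyfun K I" and I: "finite I" and p: "range p \<subseteq> K"
  shows "\<exists>g. (\<forall>i. g i \<in> K) \<and> (\<forall>v. ((\<lambda>\<tau>. f (\<lambda>i. p i + \<tau> * v i)) has_field_derivative
           (\<Sum>i\<in>I. g i * v i)) (at 0))"
  using assms(1)
proof (induction rule: polyfun.induct)
  case (const c)
  show ?case by (rule exI[of _ "\<lambda>_. 0"]) auto
next
  case (var j)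
  have "(\<Sum>i\<in>I. (if i = j then 1 else 0) * v i) = v j" for v :: "_ \<Rightarrow> complex"
    using var I by (simp add: if_distrib[of "\<lambda>x. x * _"] cong: if_cong)
  then show ?case
    by (intro exI[of _ "\<lambda>i. if i = j then 1 else 0"]) (auto intro!: derivative_eq_intros)
next
  case (add f1 f2)
  then obtain g1 g2 where g: "\<forall>i. g1 i \<in> K" "\<forall>i. g2 i \<in> K"
    "\<forall>v. ((\<lambda>\<tau>. f1 (\<lambda>i. p i + \<tau> * v i)) has_field_derivative (\<Sum>i\<in>I. g1 i * v i)) (at 0)"
    "\<forall>v. ((\<lambda>\<tau>. f2 (\<lambda>i. p i + \<tau> * v i)) has_field_derivative (\<Sum>i\<in>I. g2 i * v i)) (at 0)"
    by blast
  show ?case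
  proof (intro exI[of _ "\<lambda>i. g1 i + g2 i"] conjI allI)
    fix v
    show "((\<lambda>\<tau>. f1 (\<lambda>i. p i + \<tau> * v i) + f2 (\<lambda>i. p i + \<tau> * v i)) has_field_derivative
        (\<Sum>i\<in>I. (g1 i + g2 i) * v i)) (at 0)"
      using DERIV_add[OF g(3)[rule_format, of v] g(4)[rule_format, of v]]
      by (simp add: distrib_right sum.distrib)
  qed (use g in auto)
next
  case (mult f1 f2)
  then obtain g1 g2 where g: "\<forall>i. g1 i \<in> K" "\<forall>i. g2 i \<in> K"
    "\<forall>v. ((\<lambda>\<tau>. f1 (\<lambda>i. p i + \<tau> * v i)) has_field_derivative (\<Sum>i\<in>I. g1 i * v i)) (at 0)"
    "\<forall>v. ((\<lambda>\<tau>. f2 (\<lambda>i. p i + \<tau> * v i)) has_field_derivative (\<Sum>i\<in>I. g2 i * v i)) (at 0)"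
    by blast
  have "f1 p \<in> K" "f2 p \<in> K" using polyfun_in p mult by auto
  show ?case
  proof (intro exI[of _ "\<lambda>i. g1 i * f2 p + g2 i * f1 p"] conjI allI)
    fix v
    show "((\<lambda>\<tau>. f1 (\<lambda>i. p i + \<tau> * v i) * f2 (\<lambda>i. p i + \<tau> * v i)) has_field_derivative
        (\<Sum>i\<in>I. (g1 i * f2 p + g2 i * f1 p) * v i)) (at 0)"
      using DERIV_mult[OF g(3)[rule_format, of v] g(4)[rule_format, of v]]
      by (simp add: algebra_simps sum.distrib sum_distrib_left)
  qed (use g \<open>f1 p \<in> K\<close> \<open>f2 p \<in> K\<close> in auto)
qed

section \<open>Linear algebra over the subfield\<close>

text \<open>Only vectors over \<open>K\<close> are tested, because the polynomials that cut out closed sets must have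
  coefficients in \<open>K\<close>.\<close>

definition trivial_kernel :: "'r set \<Rightarrow> 'j set \<Rightarrow> ('r \<Rightarrow> 'j \<Rightarrow> complex) \<Rightarrow> bool" where
  "trivial_kernel R J A \<longleftrightarrow> (\<forall>v. (\<forall>j. v j \<in> K) \<longrightarrow> (\<forall>r\<in>R. (\<Sum>j\<in>J. A r j * v j) = 0) \<longrightarrow> (\<forall>j\<in>J. v j = 0))"

lemma trivial_kernelD:
  "trivial_kernel R J A \<Longrightarrow> (\<And>j. v j \<in> K) \<Longrightarrow> (\<And>r. r \<in> R \<Longrightarrow> (\<Sum>j\<in>J. A r j * v j) = 0) \<Longrightarrow> j \<in> J \<Longrightarrow> v j = 0"
  unfolding trivial_kernel_def by blast

text \<open>Elimination of one equation together with one unknown.\<close>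

lemma underdetermined_system:
  assumes "finite E" "finite U" "card E < card U" "\<And>e u. A e u \<in> K"
  shows "\<exists>c. (\<forall>u. c u \<in> K) \<and> (\<exists>u\<in>U. c u \<noteq> 0) \<and> (\<forall>e\<in>E. (\<Sum>u\<in>U. A e u * c u) = 0)"
  using assms
proof (induction E arbitrary: U A rule: finite_induct)
  case empty
  then obtain u where "u \<in> U" by fastforce
  then show ?case by (intro exI[of _ "\<lambda>_. 1"]) auto
next
  case (insert e E)
  show ?case
  proof (cases "\<forall>u\<in>U. A e u = 0")
    case True
    have "card E < card U" using insert by simp
    then obtain c where "\<forall>u. c u \<in> K" "\<exists>u\<in>U. c u \<noteq> 0" "\<forall>e\<in>E. (\<Sum>u\<in>U. A e u * c u) = 0"
      using insert.IH[of U A] insert.prems by auto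
    with True show ?thesis by (intro exI[of _ c]) auto
  next
    case False
    then obtain w where w: "w \<in> U" "A e w \<noteq> 0" by blast
    define B where "B = (\<lambda>e' u. A e' u - A e' w * A e u / A e w)"
    have "card E < card (U - {w})" using insert w by simp
    moreover have "B e' u \<in> K" for e' u using insert.prems(3) by (auto simp: B_def)
    ultimately obtain c where c: "\<forall>u. c u \<in> K" "\<exists>u\<in>U - {w}. c u \<noteq> 0"
      "\<forall>e\<in>E. (\<Sum>u\<in>U - {w}. B e u * c u) = 0"
      using insert.IH[of "U - {w}" B] insert.prems by auto
    define s where "s = (\<Sum>u\<in>U - {w}. A e u * c u)"
    define c' where "c' = c(w := - s / A e w)"
    have sK: "s \<in> K" using c insert.prems by (auto simp: s_def)
    have *: "(\<Sum>u\<in>U. A e' u * c' u) = (\<Sum>u\<in>U - {w}. A e' u * c u) - A e' w * s / A e w" for e'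
    proof -
      have "(\<Sum>u\<in>U. A e' u * c' u) = A e' w * c' w + (\<Sum>u\<in>U - {w}. A e' u * c' u)"
        using w insert.prems by (intro sum.remove) auto
      also have "(\<Sum>u\<in>U - {w}. A e' u * c' u) = (\<Sum>u\<in>U - {w}. A e' u * c u)"
        by (rule sum.cong) (auto simp: c'_def)
      finally show ?thesis by (simp add: c'_def)
    qed
    have "(\<Sum>u\<in>U. A e' u * c' u) = 0" if "e' \<in> E" for e'
    proof -
      have "0 = (\<Sum>u\<in>U - {w}. A e' u * c u - A e' w / A e w * (A e u * c u))"
        using c(3) that by (simp add: B_def algebra_simps)
      also have "\<dots> = (\<Sum>u\<in>U - {w}. A e' u * c u) - A e' w / A e w * s"
        by (simp add: sum_subtractf sum_distrib_left s_def)
      finally show ?thesis unfolding * by simp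
    qed
    moreover have "(\<Sum>u\<in>U. A e u * c' u) = 0" unfolding * using w by (simp add: s_def)
    moreover have "\<forall>u. c' u \<in> K"
      using c(1) sK insert.prems(3) by (auto simp: c'_def)
    moreover have "\<exists>u\<in>U. c' u \<noteq> 0" using c(2) by (auto simp: c'_def)
    ultimately show ?thesis by (intro exI[of _ c']) auto
  qed
qed

text \<open>Induction on the columns. A left inverse \<open>B\<close> of the old columns expresses the new column through
  them up to a residual \<open>\<rho>\<close>. The residual is nonzero, since otherwise it would give a kernel vector,
  and a nonzero entry of it yields a functional that is \<open>0\<close> on the old columns and \<open>1\<close> on the new one.\<close>

lemma left_inverse_of_trivial_kernel:
  assumes "finite J" "finite R" "\<And>r j. A r j \<in> K" "trivial_kernel R J A"
  shows "\<exists>B. (\<forall>i r. B i r \<in> K) \<and> (\<forall>i\<in>J. \<forall>j\<in>J. (\<Sum>r\<in>R. B i r * A r j) = (if i = j then 1 else 0))"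
  using assms(1,4)
proof (induction J rule: finite_induct)
  case empty
  show ?case by (rule exI[of _ "\<lambda>_ _. 0"]) auto
next
  case (insert j J)
  have "trivial_kernel R J A"
    unfolding trivial_kernel_def
  proof (intro allI impI)
    fix v assume v: "\<forall>i. v i \<in> K" "\<forall>r\<in>R. (\<Sum>i\<in>J. A r i * v i) = 0"
    have "(\<Sum>i\<in>J. A r i * (v(j := 0)) i) = (\<Sum>i\<in>J. A r i * v i)" for r
      by (rule sum.cong) (use insert in auto)
    then have "\<forall>r\<in>R. (\<Sum>i\<in>insert j J. A r i * (v(j := 0)) i) = 0"
      using insert.hyps v by simp
    then have "\<forall>i\<in>insert j J. (v(j := 0)) i = 0"
      using insert.prems v by (intro ballI trivial_kernelD[OF insert.prems, of "v(j := 0)"]) auto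
    then show "\<forall>i\<in>J. v i = 0" using insert.hyps by (metis fun_upd_other insertCI)
  qed
  with insert obtain B where B: "\<forall>i r. B i r \<in> K"
    "\<forall>i\<in>J. \<forall>j\<in>J. (\<Sum>r\<in>R. B i r * A r j) = (if i = j then 1 else 0)"
    by blast
  define b where "b = (\<lambda>i. \<Sum>r\<in>R. B i r * A r j)"
  define \<rho> where "\<rho> = (\<lambda>r. A r j - (\<Sum>i\<in>J. b i * A r i))"
  have bK: "b i \<in> K" for i using B assms(3) by (auto simp: b_def)
  have \<rho>K: "\<rho> r \<in> K" for r using bK assms(3) by (auto simp: \<rho>_def)
  have "\<exists>r0\<in>R. \<rho> r0 \<noteq> 0"
  proof (rule ccontr)
    assume no: "\<not> ?thesis"
    define v where "v = (\<lambda>i. if i = j then 1 else - b i)"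
    have "(\<Sum>i\<in>insert j J. A r i * v i) = \<rho> r" for r
    proof -
      have "(\<Sum>i\<in>J. A r i * v i) = (\<Sum>i\<in>J. - (b i * A r i))"
        by (rule sum.cong) (use insert.hyps in \<open>auto simp: v_def\<close>)
      then show ?thesis using insert.hyps by (simp add: v_def \<rho>_def sum_negf)
    qed
    with no have "v j = 0"
      using bK by (intro trivial_kernelD[OF insert.prems, of v j]) (auto simp: v_def)
    then show False by (simp add: v_def)
  qed
  then obtain r0 where r0: "r0 \<in> R" "\<rho> r0 \<noteq> 0" by blast
  define \<beta> where "\<beta> = (\<lambda>r. ((if r = r0 then 1 else 0) - (\<Sum>i\<in>J. A r0 i * B i r)) / \<rho> r0)"
  have \<beta>K: "\<beta> r \<in> K" for r using B assms(3) \<rho>K by (auto simp: \<beta>_def)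
  have \<beta>: "(\<Sum>r\<in>R. \<beta> r * w r) = (w r0 - (\<Sum>i\<in>J. A r0 i * (\<Sum>r\<in>R. B i r * w r))) / \<rho> r0" for w
  proof -
    have "(\<Sum>r\<in>R. \<beta> r * w r) = (\<Sum>r\<in>R. ((if r = r0 then w r else 0) - (\<Sum>i\<in>J. A r0 i * B i r) * w r)) / \<rho> r0"
      unfolding sum_divide_distrib by (rule sum.cong) (auto simp: \<beta>_def algebra_simps)
    also have "\<dots> = (w r0 - (\<Sum>r\<in>R. \<Sum>i\<in>J. A r0 i * B i r * w r)) / \<rho> r0"
      using r0 assms(2) by (simp add: sum_subtractf sum_distrib_right)
    also have "(\<Sum>r\<in>R. \<Sum>i\<in>J. A r0 i * B i r * w r) = (\<Sum>i\<in>J. A r0 i * (\<Sum>r\<in>R. B i r * w r))"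
      by (subst sum.swap) (simp add: sum_distrib_left mult.assoc)
    finally show ?thesis .
  qed
  have \<beta>J: "(\<Sum>r\<in>R. \<beta> r * A r i) = 0" if "i \<in> J" for i
  proof -
    have "(\<Sum>i'\<in>J. A r0 i' * (\<Sum>r\<in>R. B i' r * A r i)) = (\<Sum>i'\<in>J. if i' = i then A r0 i' else 0)"
      by (rule sum.cong) (use B that in auto)
    then show ?thesis unfolding \<beta> using that insert.hyps by simp
  qed
  have \<beta>j: "(\<Sum>r\<in>R. \<beta> r * A r j) = 1"
    unfolding \<beta> using r0 by (simp add: \<rho>_def b_def mult.commute)
  define C where "C = (\<lambda>i r. if i = j then \<beta> r else B i r - b i * \<beta> r)"
  have C: "(\<Sum>r\<in>R. C i r * A r i') = (if i = i' then 1 else 0)" if "i \<in> insert j J" "i' \<in> insert j J" for i i'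
  proof (cases "i = j")
    case True
    then show ?thesis using \<beta>J \<beta>j that by (auto simp: C_def)
  next
    case False
    then have "(\<Sum>r\<in>R. C i r * A r i') = (\<Sum>r\<in>R. B i r * A r i') - b i * (\<Sum>r\<in>R. \<beta> r * A r i')"
      by (simp add: C_def algebra_simps sum_subtractf sum_distrib_left)
    then show ?thesis using False that \<beta>J \<beta>j B insert.hyps
      by (cases "i' = j") (auto simp: b_def)
  qed
  show ?case
    by (rule exI[of _ C]) (use C B bK \<beta>K in \<open>auto simp: C_def\<close>)
qed

text \<open>Fraction-free elimination: as long as the pivot does not vanish, the kernel is trivial if and only if
  the kernel of the matrix \<open>B\<close> with one column less is trivial. The function \<open>h\<close> is the product of the
  pivots and plays the role of a maximal minor.\<close>

lemma trivial_kernel_open: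
  assumes "finite J" "\<And>r j. r \<in> R \<Longrightarrow> j \<in> J \<Longrightarrow> A r j \<in> polyfun K I"
    and "range x0 \<subseteq> K" "trivial_kernel R J (\<lambda>r j. A r j x0)"
  shows "\<exists>h\<in>polyfun K I. h x0 \<noteq> 0 \<and>
    (\<forall>x. range x \<subseteq> K \<longrightarrow> h x \<noteq> 0 \<longrightarrow> trivial_kernel R J (\<lambda>r j. A r j x))"
  using assms(1,2,4)
proof (induction J arbitrary: A rule: finite_induct)
  case empty
  show ?case by (rule bexI[of _ "\<lambda>_. 1"]) (auto simp: trivial_kernel_def intro: polyfun.intros)
next
  case (insert j J)
  have "\<exists>r0\<in>R. A r0 j x0 \<noteq> 0"
  proof (rule ccontr)
    assume no: "\<not> ?thesis"
    define v :: "_ \<Rightarrow> complex" where "v = (\<lambda>i. if i = j then 1 else 0)"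
    have "(\<Sum>i\<in>insert j J. A r i x0 * v i) = A r j x0" for r
    proof -
      have "(\<Sum>i\<in>J. A r i x0 * v i) = 0"
        by (rule sum.neutral) (use insert.hyps in \<open>auto simp: v_def\<close>)
      then show ?thesis using insert.hyps by (simp add: v_def)
    qed
    with no have "v j = 0"
      by (intro trivial_kernelD[OF insert.prems(2), of v j]) (auto simp: v_def)
    then show False by (simp add: v_def)
  qed
  then obtain r0 where r0: "r0 \<in> R" "A r0 j x0 \<noteq> 0" by blast
  define B where "B = (\<lambda>r i x. A r0 j x * A r i x - A r j x * A r0 i x)"
  have Bpoly: "B r i \<in> polyfun K I" if "r \<in> R" "i \<in> J" for r i
    unfolding B_def using insert.prems(1) r0 that by (intro polyfun_diff polyfun.mult) auto
  have Bsum: "(\<Sum>i\<in>J. B r i x * v i) = A r0 j x * (\<Sum>i\<in>J. A r i x * v i) - A r j x * (\<Sum>i\<in>J. A r0 i x * v i)"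
    for r x v
    by (simp add: B_def algebra_simps sum_subtractf sum_distrib_left)
  have "trivial_kernel R J (\<lambda>r i. B r i x0)"
    unfolding trivial_kernel_def
  proof (intro allI impI)
    fix v assume v: "\<forall>i. v i \<in> K" "\<forall>r\<in>R. (\<Sum>i\<in>J. B r i x0 * v i) = 0"
    define s where "s = (\<Sum>i\<in>J. A r0 i x0 * v i)"
    define w where "w = v(j := - s / A r0 j x0)"
    have AK: "A r i x0 \<in> K" if "r \<in> R" "i \<in> insert j J" for r i
      using insert.prems(1) that assms(3) polyfun_in by blast
    have wJ: "(\<Sum>i\<in>J. A r i x0 * w i) = (\<Sum>i\<in>J. A r i x0 * v i)" for r
      by (rule sum.cong) (use insert.hyps in \<open>auto simp: w_def\<close>)
    have "(\<Sum>i\<in>insert j J. A r i x0 * w i) = 0" if "r \<in> R" for r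
    proof -
      have "A r0 j x0 * (\<Sum>i\<in>J. A r i x0 * v i) = A r j x0 * s"
        using v(2) that Bsum[of r x0 v] by (auto simp: s_def)
      then have "(\<Sum>i\<in>J. A r i x0 * v i) = A r j x0 * s / A r0 j x0"
        using r0 by (simp add: field_simps)
      then show ?thesis using insert.hyps wJ by (simp add: w_def)
    qed
    moreover have "s \<in> K" using AK r0 v by (auto simp: s_def)
    then have "w i \<in> K" for i using v(1) AK r0 by (auto simp: w_def)
    ultimately have "\<forall>i\<in>insert j J. w i = 0"
      using trivial_kernelD[OF insert.prems(2), of w] by blast
    then show "\<forall>i\<in>J. v i = 0" using insert.hyps by (auto simp: w_def split: if_splits)
  qed
  from insert.IH[OF Bpoly this] obtain h where h: "h \<in> polyfun K I" "h x0 \<noteq> 0"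
    "\<And>x. range x \<subseteq> K \<Longrightarrow> h x \<noteq> 0 \<Longrightarrow> trivial_kernel R J (\<lambda>r j. B r j x)"
    by blast
  have "trivial_kernel R (insert j J) (\<lambda>r j. A r j x)" if x: "range x \<subseteq> K" "h x * A r0 j x \<noteq> 0" for x
    unfolding trivial_kernel_def
  proof (intro allI impI)
    fix v assume v: "\<forall>i. v i \<in> K" "\<forall>r\<in>R. (\<Sum>i\<in>insert j J. A r i x * v i) = 0"
    have eq: "(\<Sum>i\<in>J. A r i x * v i) = - (A r j x * v j)" if "r \<in> R" for r
      using v(2) that insert.hyps by (simp add: eq_neg_iff_add_eq_0 add.commute)
    have "(\<Sum>i\<in>J. B r i x * v i) = 0" if "r \<in> R" for r
      unfolding Bsum eq[OF that] eq[OF r0(1)] by simp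
    then have J: "v i = 0" if "i \<in> J" for i
      using trivial_kernelD[OF h(3)[of x], of v i] x v(1) that by auto
    then have "A r0 j x * v j = 0" using eq[OF r0(1)] by simp
    with J x show "\<forall>i\<in>insert j J. v i = 0" by auto
  qed
  note kernel = this
  have "(\<lambda>x. h x * A r0 j x) \<in> polyfun K I"
    by (rule polyfun.mult[OF h(1) insert.prems(1)[OF r0(1)]]) simp
  moreover have "h x0 * A r0 j x0 \<noteq> 0" using h(2) r0(2) by simp
  ultimately show ?case
    using kernel by (intro bexI[of _ "\<lambda>x. h x * A r0 j x"] conjI allI impI)
qed

end

section \<open>Homogeneous relations\<close>

text \<open>The exponent vectors of the monomials of degree \<open>m\<close> in \<open>g 0, \<dots>, g r\<close>, and the values of the
  homogeneous polynomials of degree \<open>m\<close> with coefficients \<open>c\<close>.\<close>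

definition hom_exps :: "nat \<Rightarrow> nat \<Rightarrow> (nat \<Rightarrow> nat) set" where
  "hom_exps r m = {a. (\<forall>j>r. a j = 0) \<and> (\<Sum>j\<le>r. a j) = m}"

definition hom_comb :: "((nat \<Rightarrow> nat) \<Rightarrow> 'a) \<Rightarrow> nat \<Rightarrow> nat \<Rightarrow> (nat \<Rightarrow> 'a) \<Rightarrow> 'a :: comm_semiring_1" where
  "hom_comb c r m g = (\<Sum>a\<in>hom_exps r m. c a * (\<Prod>j\<le>r. g j ^ a j))"

lemma hom_exps_le: "a \<in> hom_exps r m \<Longrightarrow> j \<le> r \<Longrightarrow> a j \<le> m"
  by (auto simp: hom_exps_def intro: member_le_sum)

lemma finite_hom_exps [simp]: "finite (hom_exps r m)"
proof (rule finite_subset)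
  show "hom_exps r m \<subseteq> {a. \<forall>j. (j \<in> {..r} \<longrightarrow> a j \<in> {..m}) \<and> (j \<notin> {..r} \<longrightarrow> a j = 0)}"
    using hom_exps_le by (auto simp: hom_exps_def)
  show "finite {a. \<forall>j. (j \<in> {..r} \<longrightarrow> a j \<in> {..m}) \<and> (j \<notin> {..r} \<longrightarrow> a j = (0 :: nat))}"
    by (rule finite_set_of_finite_funs) auto
qed

lemma hom_comb_cong:
  "(\<And>a. a \<in> hom_exps r m \<Longrightarrow> c a = c' a) \<Longrightarrow> (\<And>j. j \<le> r \<Longrightarrow> g j = g' j) \<Longrightarrow>
     hom_comb c r m g = hom_comb c' r m g'"
  unfolding hom_comb_def by (intro sum.cong arg_cong2[of _ _ _ _ "(*)"] prod.cong) auto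

lemma hom_exps_0: "hom_exps 0 m = {(\<lambda>_. 0)(0 := m)}"
  by (auto simp: hom_exps_def fun_eq_iff)

lemma hom_exps_deg_0: "hom_exps r 0 = {\<lambda>_. 0}"
proof -
  have "a = (\<lambda>_. 0)" if a: "a \<in> hom_exps r 0" for a
  proof
    fix j show "a j = 0"
      using hom_exps_le[OF a, of j] a by (cases "j \<le> r") (simp_all add: hom_exps_def)
  qed
  moreover have "(\<lambda>_. 0) \<in> hom_exps r 0" by (simp add: hom_exps_def)
  ultimately show ?thesis by blast
qed

lemma hom_exps_Suc:
  "hom_exps (Suc r) (Suc m) =
     hom_exps r (Suc m) \<union> (\<lambda>a. a(Suc r := Suc (a (Suc r)))) ` hom_exps (Suc r) m"
  (is "?L = ?A \<union> ?f ` ?B")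
proof (intro equalityI subsetI)
  fix a assume a: "a \<in> ?L"
  show "a \<in> ?A \<union> ?f ` ?B"
  proof (cases "a (Suc r)")
    case 0
    then have "a j = 0" if "j > r" for j using a that by (cases "j = Suc r") (auto simp: hom_exps_def)
    then show ?thesis using a 0 by (auto simp: hom_exps_def)
  next
    case (Suc k)
    define b where "b = a(Suc r := k)"
    have "a = ?f b" using Suc by (auto simp: b_def)
    moreover have "(\<Sum>j\<le>r. b j) = (\<Sum>j\<le>r. a j)" by (rule sum.cong) (auto simp: b_def)
    then have "b \<in> ?B" using a Suc by (auto simp: b_def hom_exps_def)
    ultimately show ?thesis by blast
  qed
next
  fix a assume "a \<in> ?A \<union> ?f ` ?B"
  then show "a \<in> ?L"
  proof
    assume "a \<in> ?A" then show ?thesis by (auto simp: hom_exps_def)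
  next
    assume "a \<in> ?f ` ?B"
    then obtain b where b: "b \<in> ?B" "a = ?f b" by blast
    have "(\<Sum>j\<le>r. a j) = (\<Sum>j\<le>r. b j)" by (rule sum.cong) (auto simp: b)
    then show ?thesis using b by (auto simp: hom_exps_def)
  qed
qed

lemma hom_comb_deg_0: "hom_comb c r 0 g = c (\<lambda>_. 0)"
  by (simp add: hom_comb_def hom_exps_deg_0)

text \<open>The second summand collects the monomials divisible by the last variable. This splitting drives the
  double induction on the number of variables and the degree below.\<close>

lemma hom_comb_Suc:
  "hom_comb c (Suc r) (Suc m) g = hom_comb c r (Suc m) g +
     g (Suc r) * hom_comb (\<lambda>a. c (a(Suc r := Suc (a (Suc r))))) (Suc r) m g"
proof -
  let ?f = "\<lambda>a :: nat \<Rightarrow> nat. a(Suc r := Suc (a (Suc r)))"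
  let ?t = "\<lambda>a. c a * (\<Prod>j\<le>Suc r. g j ^ a j)"
  have inj: "inj_on ?f S" for S
  proof (rule inj_onI)
    fix a b assume eq: "?f a = ?f b"
    have "a j = b j" for j using fun_cong[OF eq, of j] by (cases "j = Suc r") auto
    then show "a = b" by auto
  qed
  have disj: "hom_exps r (Suc m) \<inter> ?f ` hom_exps (Suc r) m = {}"
    by (auto simp: hom_exps_def)
  have "hom_comb c (Suc r) (Suc m) g =
      (\<Sum>a\<in>hom_exps r (Suc m). ?t a) + (\<Sum>a\<in>?f ` hom_exps (Suc r) m. ?t a)"
    unfolding hom_comb_def hom_exps_Suc[of r m] by (rule sum.union_disjoint) (use disj in auto)
  also have "(\<Sum>a\<in>hom_exps r (Suc m). ?t a) = hom_comb c r (Suc m) g"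
    unfolding hom_comb_def by (rule sum.cong) (auto simp: hom_exps_def)
  also have "(\<Sum>a\<in>?f ` hom_exps (Suc r) m. ?t a) = (\<Sum>a\<in>hom_exps (Suc r) m. ?t (?f a))"
    by (rule sum.reindex[OF inj, unfolded comp_def])
  also have "\<dots> = (\<Sum>a\<in>hom_exps (Suc r) m. g (Suc r) * (c (?f a) * (\<Prod>j\<le>Suc r. g j ^ a j)))"
  proof (rule sum.cong)
    fix a
    have "(\<Prod>j\<le>r. g j ^ ?f a j) = (\<Prod>j\<le>r. g j ^ a j)" by (rule prod.cong) auto
    then show "?t (?f a) = g (Suc r) * (c (?f a) * (\<Prod>j\<le>Suc r. g j ^ a j))"
      by (simp add: mult_ac)
  qed simp
  finally show ?thesis by (simp add: hom_comb_def sum_distrib_left)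
qed

context complex_subfield
begin

lemma polyfun_hom_comb:
  assumes "\<And>a. c a \<in> K" "\<And>j. j \<le> r \<Longrightarrow> (\<lambda>x. g x j) \<in> polyfun K I"
  shows "(\<lambda>x. hom_comb c r m (g x)) \<in> polyfun K I"
  unfolding hom_comb_def
  by (intro polyfun_sum polyfun.mult polyfun_prod polyfun_power polyfun.const assms) auto

text \<open>On \<open>Z i\<close> every monomial containing \<open>G (Suc i)\<close> vanishes, so the induction hypothesis for \<open>i\<close> removes
  the monomials without it. The remaining sum is divisible by \<open>G (Suc i)\<close>; by primality the quotient
  vanishes on \<open>Z (Suc i)\<close>, and its degree is smaller.\<close>

lemma chain_independence:
  fixes Z :: "nat \<Rightarrow> 'p set" and G :: "nat \<Rightarrow> 'p \<Rightarrow> complex"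
  assumes start: "P0 \<in> Z 0" "G 0 P0 \<noteq> 0"
    and sub: "\<And>i. i < r \<Longrightarrow> Z i \<subseteq> Z (Suc i)"
    and van: "\<And>i P. i < r \<Longrightarrow> P \<in> Z i \<Longrightarrow> G (Suc i) P = 0"
    and prime: "\<And>i m c. i < r \<Longrightarrow> \<forall>a. c a \<in> K \<Longrightarrow>
       \<forall>P\<in>Z (Suc i). G (Suc i) P * hom_comb c (Suc i) m (\<lambda>j. G j P) = 0 \<Longrightarrow>
       \<forall>P\<in>Z (Suc i). hom_comb c (Suc i) m (\<lambda>j. G j P) = 0"
  shows "i \<le> r \<Longrightarrow> \<forall>a. c a \<in> K \<Longrightarrow> \<forall>P\<in>Z i. hom_comb c i m (\<lambda>j. G j P) = 0 \<Longrightarrow>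
    a \<in> hom_exps i m \<Longrightarrow> c a = 0"
proof (induction i arbitrary: c m a)
  case 0
  have "c a * G 0 P0 ^ m = 0"
    using bspec[OF 0(3) start(1)] 0(4) by (simp add: hom_comb_def hom_exps_0)
  then show ?case using start by simp
next
  case (Suc i)
  note IH = Suc.IH
  have i: "i < r" "i \<le> r" using Suc.prems by auto
  show ?case using Suc.prems(2-)
  proof (induction m arbitrary: c a)
    case 0
    have "\<forall>P\<in>Z i. hom_comb c i 0 (\<lambda>j. G j P) = 0"
      using 0(2) sub[OF i(1)] by (auto simp: hom_comb_deg_0)
    then show ?case using IH[OF i(2) 0(1)] 0(3) by (auto simp: hom_exps_deg_0)
  next
    case (Suc m)
    let ?f = "\<lambda>a :: nat \<Rightarrow> nat. a(Suc i := Suc (a (Suc i)))"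
    have "\<forall>P\<in>Z i. hom_comb c i (Suc m) (\<lambda>j. G j P) = 0"
    proof
      fix P assume P: "P \<in> Z i"
      then have "hom_comb c (Suc i) (Suc m) (\<lambda>j. G j P) = 0" using Suc.prems(2) sub[OF i(1)] by blast
      then show "hom_comb c i (Suc m) (\<lambda>j. G j P) = 0" using van[OF i(1) P] by (simp add: hom_comb_Suc)
    qed
    then have c0: "c b = 0" if "b \<in> hom_exps i (Suc m)" for b
      using IH[OF i(2) Suc.prems(1)] that by blast
    then have "hom_comb c i (Suc m) g = 0" for g by (simp add: hom_comb_def)
    then have "\<forall>P\<in>Z (Suc i). G (Suc i) P * hom_comb (\<lambda>a. c (?f a)) (Suc i) m (\<lambda>j. G j P) = 0"
      using Suc.prems(2) by (simp add: hom_comb_Suc)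
    then have "\<forall>P\<in>Z (Suc i). hom_comb (\<lambda>a. c (?f a)) (Suc i) m (\<lambda>j. G j P) = 0"
      using prime[OF i(1), of "\<lambda>a. c (?f a)"] Suc.prems(1) by blast
    then have "c (?f b) = 0" if "b \<in> hom_exps (Suc i) m" for b
      using Suc.IH[of "\<lambda>a. c (?f a)"] Suc.prems(1) that by blast
    with c0 show ?case using Suc.prems(3) unfolding hom_exps_Suc by blast
  qed
qed

text \<open>A homogeneous polynomial that vanishes at all \<open>K\<close>-points is zero: the coordinates along the flag of
  coordinate subspaces are an instance of \<open>chain_independence\<close>.\<close>

lemma hom_comb_eq_0_imp:
  assumes c: "\<forall>a. c a \<in> K" and van: "\<And>v. range v \<subseteq> K \<Longrightarrow> hom_comb c r m v = 0"
    and a: "a \<in> hom_exps r m"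
  shows "c a = 0"
proof (rule chain_independence[where Z = "\<lambda>i. {v. range v \<subseteq> K \<and> (\<forall>j>i. v j = 0)}" and G = "\<lambda>i v. v i"
      and ?P0.0 = "\<lambda>j. if j = 0 then 1 else 0" and r = r and i = r and m = m and c = c and a = a])
  fix i m and c :: "(nat \<Rightarrow> nat) \<Rightarrow> complex"
  let ?Z = "{v. range v \<subseteq> K \<and> (\<forall>j>Suc i. v j = 0)}"
  assume c: "\<forall>a. c a \<in> K" and prod: "\<forall>v\<in>?Z. v (Suc i) * hom_comb c (Suc i) m (\<lambda>j. v j) = 0"
  show "\<forall>v\<in>?Z. hom_comb c (Suc i) m (\<lambda>j. v j) = 0"
  proof (rule ccontr)
    assume "\<not> ?thesis"
    then obtain w where w: "range w \<subseteq> K" "hom_comb c (Suc i) m w \<noteq> 0" by auto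
    have "(\<lambda>v. v (Suc i)) \<in> polyfun K {..Suc i}" by (rule polyfun.var) simp
    moreover have "(\<lambda>v. hom_comb c (Suc i) m v) \<in> polyfun K {..Suc i}"
      by (rule polyfun_hom_comb) (use c in \<open>auto intro: polyfun.var\<close>)
    ultimately obtain z where z: "range z \<subseteq> K" "z (Suc i) \<noteq> 0" "hom_comb c (Suc i) m z \<noteq> 0"
      using polyfun_common_nonzero[of "\<lambda>v. v (Suc i)" "{..Suc i}" "\<lambda>v. hom_comb c (Suc i) m v" "\<lambda>_. 1" w] w
      by auto
    define z' where "z' = (\<lambda>j. if j \<le> Suc i then z j else 0)"
    have "hom_comb c (Suc i) m z' = hom_comb c (Suc i) m z" by (rule hom_comb_cong) (auto simp: z'_def)
    moreover have z': "z' \<in> ?Z" using z by (auto simp: z'_def image_subset_iff)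
    have "z' (Suc i) * hom_comb c (Suc i) m z' = 0" using bspec[OF prod z'] by simp
    moreover have "z' (Suc i) = z (Suc i)" by (simp add: z'_def)
    ultimately show False using z by simp
  qed
qed (use assms in \<open>auto simp: image_subset_iff\<close>)

text \<open>Let \<open>a 0\<close> be maximal with \<open>c a \<noteq> 0\<close>. As \<open>P i\<close> has order at least one in the variable for
  \<open>i \<ge> 1\<close> and \<open>P 0\<close> has order zero, the relation has order \<open>m - a 0\<close>, and its lowest
  coefficient is, up to a power of \<open>b\<close>, a homogeneous polynomial in the values \<open>v i\<close>, which are
  arbitrary.\<close>

lemma first_order_independence:
  assumes c: "\<forall>a. c a \<in> K" and b: "b \<noteq> 0"
    and expansion: "\<And>v. range v \<subseteq> K \<Longrightarrow> \<exists>P :: nat \<Rightarrow> complex poly. poly (P 0) 0 = b \<and>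
      (\<forall>i\<in>{1..r}. poly (P i) 0 = 0 \<and> poly.coeff (P i) 1 = v i) \<and> hom_comb (\<lambda>a. [:c a:]) r m P = 0"
    and a: "a \<in> hom_exps r m"
  shows "c a = 0"
proof -
  have split0: "(\<Prod>j\<le>r. f j) = f 0 * (\<Prod>j\<in>{1..r}. f j)" for f :: "nat \<Rightarrow> 'b :: comm_monoid_mult"
  proof -
    have "{..r} = insert 0 {1..r}" by auto
    then show ?thesis by simp
  qed
  have deg: "(\<Sum>j\<in>{1..r}. a j) = m - a 0" "a 0 \<le> m" if "a \<in> hom_exps r m" for a
  proof -
    have "{..r} = insert 0 {1..r}" by auto
    then have "a 0 + (\<Sum>j\<in>{1..r}. a j) = m" using that by (simp add: hom_exps_def)
    then show "(\<Sum>j\<in>{1..r}. a j) = m - a 0" "a 0 \<le> m" by auto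
  qed
  have "c a = 0" if "a \<in> hom_exps r m" "m - a 0 = k" for a k
    using that
  proof (induction k arbitrary: a rule: less_induct)
    case (less k)
    \<comment> \<open>the part of lowest order\<close>
    define c' where "c' = (\<lambda>a. if m - a 0 = k then c a else 0)"
    have "hom_comb c' r m v = 0" if v: "range v \<subseteq> K" for v
    proof -
      obtain P :: "nat \<Rightarrow> complex poly" where P0: "poly (P 0) 0 = b"
        and P: "\<And>i. i \<in> {1..r} \<Longrightarrow> poly (P i) 0 = 0 \<and> poly.coeff (P i) 1 = v i"
        and rel: "hom_comb (\<lambda>a. [:c a:]) r m P = 0"
        using expansion[OF v] by blast
      have "\<exists>Q. P i = [:0, 1:] * Q \<and> poly Q 0 = v i" if i: "i \<in> {1..r}" for i
      proof -
        have "[:0, 1:] dvd P i" using P[OF i] poly_eq_0_iff_dvd[of "P i" 0] by simp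
        then obtain Q where Q: "P i = [:0, 1:] * Q" by (auto elim: dvdE)
        then have "poly Q 0 = poly.coeff (P i) 1" by (simp add: poly_0_coeff_0)
        then show ?thesis using Q P[OF i] by auto
      qed
      then obtain Q where Q: "\<And>i. i \<in> {1..r} \<Longrightarrow> P i = [:0, 1:] * Q i \<and> poly (Q i) 0 = v i"
        by metis
      define T where "T = (\<lambda>a. [:0, 1:] ^ (m - a 0 - k) * P 0 ^ a 0 * (\<Prod>j\<in>{1..r}. Q j ^ a j))"
      have "[:c a:] * (\<Prod>j\<le>r. P j ^ a j) = [:0, 1:] ^ k * ([:c a:] * T a)" if a: "a \<in> hom_exps r m" for a
      proof (cases "m - a 0 < k")
        case True
        then have "c a = 0" using less.IH a by blast
        then show ?thesis by simp
      next
        case False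
        have "(\<Prod>j\<in>{1..r}. P j ^ a j) = (\<Prod>j\<in>{1..r}. [:0, 1:] ^ a j * Q j ^ a j)"
          by (rule prod.cong) (use Q in \<open>auto simp: power_mult_distrib[symmetric]\<close>)
        also have "\<dots> = [:0, 1:] ^ (m - a 0) * (\<Prod>j\<in>{1..r}. Q j ^ a j)"
          by (simp only: prod.distrib power_sum[symmetric] deg(1)[OF a])
        also have "([:0, 1:] :: complex poly) ^ (m - a 0) = [:0, 1:] ^ k * [:0, 1:] ^ (m - a 0 - k)"
          unfolding power_add[symmetric] using False by (intro arg_cong[of _ _ "\<lambda>e. _ ^ e"]) linarith
        finally show ?thesis unfolding split0 T_def by (simp only: mult_ac)
      qed
      then have "[:0, 1:] ^ k * (\<Sum>a\<in>hom_exps r m. [:c a:] * T a) = 0"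
        using rel by (simp add: hom_comb_def sum_distrib_left)
      then have "(\<Sum>a\<in>hom_exps r m. [:c a:] * T a) = 0" by simp
      then have "0 = poly (\<Sum>a\<in>hom_exps r m. [:c a:] * T a) 0" by simp
      also have "\<dots> = (\<Sum>a\<in>hom_exps r m. c a * poly (T a) 0)" by (simp add: poly_sum)
      also have "\<dots> = (\<Sum>a\<in>hom_exps r m. b ^ (m - k) * (c' a * (\<Prod>j\<in>{1..r}. v j ^ a j)))"
      proof (rule sum.cong)
        fix a assume a: "a \<in> hom_exps r m"
        have pT: "poly (T a) 0 = 0 ^ (m - a 0 - k) * b ^ a 0 * (\<Prod>j\<in>{1..r}. v j ^ a j)"
          using Q P0 by (simp add: T_def poly_prod)
        consider "m - a 0 < k" | "m - a 0 = k" | "m - a 0 > k" by linarith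
        then show "c a * poly (T a) 0 = b ^ (m - k) * (c' a * (\<Prod>j\<in>{1..r}. v j ^ a j))"
        proof cases
          case 1
          then show ?thesis using less.IH a by (simp add: c'_def)
        next
          case 2
          then have "a 0 = m - k" using deg(2)[OF a] by simp
          then show ?thesis using 2 pT by (simp add: c'_def)
        next
          case 3
          then have "0 < m - a 0 - k" by linarith
          then have "poly (T a) 0 = 0" unfolding pT by (simp only: zero_power mult_zero_left)
          then show ?thesis using 3 by (simp add: c'_def)
        qed
      qed simp
      finally have z: "(\<Sum>a\<in>hom_exps r m. c' a * (\<Prod>j\<in>{1..r}. v j ^ a j)) = 0"
        using b by (simp add: sum_distrib_left[symmetric])
      have "hom_comb c' r m v = (\<Sum>a\<in>hom_exps r m. v 0 ^ (m - k) * (c' a * (\<Prod>j\<in>{1..r}. v j ^ a j)))"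
        unfolding hom_comb_def
      proof (rule sum.cong)
        fix a assume "a \<in> hom_exps r m"
        then show "c' a * (\<Prod>j\<le>r. v j ^ a j) = v 0 ^ (m - k) * (c' a * (\<Prod>j\<in>{1..r}. v j ^ a j))"
          using deg(2)[of a] unfolding split0 by (auto simp: c'_def)
      qed simp
      then show ?thesis using z by (simp add: sum_distrib_left[symmetric])
    qed
    then have "c' a = 0" using c less.prems by (intro hom_comb_eq_0_imp[of c' r m]) (auto simp: c'_def)
    then show ?case using less.prems by (simp add: c'_def)
  qed
  then show ?thesis using a by blast
qed

end

definition mono_fun :: "'i set \<Rightarrow> ('i \<Rightarrow> nat) \<Rightarrow> ('i \<Rightarrow> complex) \<Rightarrow> complex" where
  "mono_fun I a x = (\<Prod>i\<in>I. x i ^ a i)"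

context complex_subfield
begin

text \<open>Bounding each exponent separately, instead of the total degree, makes the dimension bound
  \<open>(N + 1) ^ card I\<close> immediate.\<close>

definition mono_span :: "'i set \<Rightarrow> nat \<Rightarrow> (('i \<Rightarrow> complex) \<Rightarrow> complex) set" where
  "mono_span I N = {f. \<exists>c. (\<forall>a. c a \<in> K) \<and> (\<forall>x. f x = (\<Sum>a\<in>Pi\<^sub>E I (\<lambda>_. {..N}). c a * mono_fun I a x))}"

lemma mono_spanI:
  "(\<And>a. c a \<in> K) \<Longrightarrow> (\<And>x. f x = (\<Sum>a\<in>Pi\<^sub>E I (\<lambda>_. {..N}). c a * mono_fun I a x)) \<Longrightarrow> f \<in> mono_span I N"
  unfolding mono_span_def by blast

lemma mono_span_mono_fun:
  assumes I: "finite I" and a: "\<And>i. i \<in> I \<Longrightarrow> a i \<le> N"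
  shows "mono_fun I a \<in> mono_span I N"
proof (rule mono_spanI[of "\<lambda>b. if b = restrict a I then 1 else 0"])
  fix x
  have "restrict a I \<in> Pi\<^sub>E I (\<lambda>_. {..N})" using a by auto
  moreover have "mono_fun I (restrict a I) x = mono_fun I a x"
    unfolding mono_fun_def by (rule prod.cong) auto
  moreover have "finite (Pi\<^sub>E I (\<lambda>_. {..N}))" using I by (intro finite_PiE) auto
  ultimately show "mono_fun I a x = (\<Sum>b\<in>Pi\<^sub>E I (\<lambda>_. {..N}). (if b = restrict a I then 1 else 0) * mono_fun I b x)"
    by (simp add: if_distrib[of "\<lambda>y. y * _"] cong: if_cong)
qed auto

lemma mono_span_add:
  assumes "f \<in> mono_span I N" "g \<in> mono_span I N"
  shows "(\<lambda>x. f x + g x) \<in> mono_span I N"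
proof -
  obtain c d where "\<And>a. c a \<in> K" "\<And>a. d a \<in> K"
    "\<And>x. f x = (\<Sum>a\<in>Pi\<^sub>E I (\<lambda>_. {..N}). c a * mono_fun I a x)"
    "\<And>x. g x = (\<Sum>a\<in>Pi\<^sub>E I (\<lambda>_. {..N}). d a * mono_fun I a x)"
    using assms unfolding mono_span_def by blast
  then show ?thesis
    by (intro mono_spanI[of "\<lambda>a. c a + d a"]) (auto simp: distrib_right sum.distrib)
qed

lemma mono_span_scale:
  assumes "f \<in> mono_span I N" "k \<in> K"
  shows "(\<lambda>x. k * f x) \<in> mono_span I N"
proof -
  obtain c where "\<And>a. c a \<in> K"
    "\<And>x. f x = (\<Sum>a\<in>Pi\<^sub>E I (\<lambda>_. {..N}). c a * mono_fun I a x)"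
    using assms unfolding mono_span_def by blast
  then show ?thesis using assms(2)
    by (intro mono_spanI[of "\<lambda>a. k * c a"]) (auto simp: sum_distrib_left mult.assoc)
qed

lemma mono_span_sum:
  "(\<And>s. s \<in> S \<Longrightarrow> f s \<in> mono_span I N) \<Longrightarrow> (\<lambda>x. \<Sum>s\<in>S. f s x) \<in> mono_span I N"
proof (induction S rule: infinite_finite_induct)
  case (insert s S)
  then show ?case using mono_span_add[of "f s" I N "\<lambda>x. \<Sum>s\<in>S. f s x"] by simp
qed (auto intro!: mono_spanI[of "\<lambda>_. 0"])

lemma mono_span_mult:
  assumes I: "finite I" and f: "f \<in> mono_span I N" and g: "g \<in> mono_span I M"
  shows "(\<lambda>x. f x * g x) \<in> mono_span I (N + M)"
proof -
  obtain c where c: "\<And>a. c a \<in> K"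
    "\<And>x. f x = (\<Sum>a\<in>Pi\<^sub>E I (\<lambda>_. {..N}). c a * mono_fun I a x)"
    using f unfolding mono_span_def by blast
  obtain d where d: "\<And>a. d a \<in> K"
    "\<And>x. g x = (\<Sum>a\<in>Pi\<^sub>E I (\<lambda>_. {..M}). d a * mono_fun I a x)"
    using g unfolding mono_span_def by blast
  have "(\<lambda>x. c a * d b * mono_fun I (\<lambda>i. a i + b i) x) \<in> mono_span I (N + M)"
    if "a \<in> Pi\<^sub>E I (\<lambda>_. {..N})" "b \<in> Pi\<^sub>E I (\<lambda>_. {..M})" for a b
  proof (rule mono_span_scale[OF mono_span_mono_fun[OF I]])
    fix i assume "i \<in> I"
    then have "a i \<le> N" "b i \<le> M" using that by auto
    then show "a i + b i \<le> N + M" by simp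
  qed (use c d in auto)
  then have "(\<lambda>x. \<Sum>a\<in>Pi\<^sub>E I (\<lambda>_. {..N}). \<Sum>b\<in>Pi\<^sub>E I (\<lambda>_. {..M}).
      c a * d b * mono_fun I (\<lambda>i. a i + b i) x) \<in> mono_span I (N + M)"
    by (intro mono_span_sum)
  also have "(\<lambda>x. \<Sum>a\<in>Pi\<^sub>E I (\<lambda>_. {..N}). \<Sum>b\<in>Pi\<^sub>E I (\<lambda>_. {..M}).
      c a * d b * mono_fun I (\<lambda>i. a i + b i) x) = (\<lambda>x. f x * g x)"
    by (rule ext) (simp add: c d sum_product mono_fun_def power_add prod.distrib mult_ac)
  finally show ?thesis .
qed

lemma mono_span_mono:
  assumes I: "finite I" and f: "f \<in> mono_span I N" and "N \<le> M"
  shows "f \<in> mono_span I M"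
proof -
  obtain c where c: "\<And>a. c a \<in> K"
    "\<And>x. f x = (\<Sum>a\<in>Pi\<^sub>E I (\<lambda>_. {..N}). c a * mono_fun I a x)"
    using f unfolding mono_span_def by blast
  have "(\<lambda>x. \<Sum>a\<in>Pi\<^sub>E I (\<lambda>_. {..N}). c a * mono_fun I a x) \<in> mono_span I M"
  proof (intro mono_span_sum mono_span_scale mono_span_mono_fun I c)
    fix a i assume "a \<in> Pi\<^sub>E I (\<lambda>_. {..N})" "i \<in> I"
    then have "a i \<le> N" by auto
    then show "a i \<le> M" using \<open>N \<le> M\<close> by simp
  qed
  moreover have "f = (\<lambda>x. \<Sum>a\<in>Pi\<^sub>E I (\<lambda>_. {..N}). c a * mono_fun I a x)" using c by auto
  ultimately show ?thesis by simp
qed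

lemma mono_span_one: "finite I \<Longrightarrow> (\<lambda>_. 1) \<in> mono_span I N"
  using mono_span_mono_fun[of I "\<lambda>_. 0" N] by (simp add: mono_fun_def[abs_def])

lemma mono_span_power:
  assumes "finite I" "f \<in> mono_span I N"
  shows "(\<lambda>x. f x ^ e) \<in> mono_span I (e * N)"
proof (induction e)
  case 0
  then show ?case using mono_span_one[OF assms(1)] by simp
next
  case (Suc e)
  then show ?case using mono_span_mult[OF assms(1,2) Suc] by simp
qed

lemma mono_span_prod:
  assumes "finite I" "\<And>s. s \<in> S \<Longrightarrow> f s \<in> mono_span I (N s)"
  shows "(\<lambda>x. \<Prod>s\<in>S. f s x) \<in> mono_span I (\<Sum>s\<in>S. N s)"
  using assms(2)
proof (induction S rule: infinite_finite_induct)
  case (insert s S)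
  then show ?case using mono_span_mult[OF assms(1), of "f s" "N s" "\<lambda>x. \<Prod>s\<in>S. f s x" "\<Sum>s\<in>S. N s"]
    by simp
qed (use mono_span_one[OF assms(1)] in auto)

lemma polyfun_imp_mono_span:
  assumes I: "finite I" and "f \<in> polyfun K I"
  shows "\<exists>N. f \<in> mono_span I N"
  using assms(2)
proof (induction rule: polyfun.induct)
  case (const c)
  then show ?case using mono_span_scale[OF mono_span_one[OF I], of c] by auto
next
  case (var i)
  have "mono_fun I (\<lambda>j. if j = i then 1 else 0) \<in> mono_span I 1"
    by (rule mono_span_mono_fun[OF I]) simp
  also have "mono_fun I (\<lambda>j. if j = i then 1 else 0) = (\<lambda>x :: 'a \<Rightarrow> complex. x i)"
    using var I by (intro ext) (simp add: mono_fun_def if_distrib[of "\<lambda>e. _ ^ e"] cong: if_cong)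
  finally show ?case by blast
next
  case (add f g)
  then obtain N M where "f \<in> mono_span I N" "g \<in> mono_span I M" by blast
  then have "f \<in> mono_span I (max N M)" "g \<in> mono_span I (max N M)"
    using mono_span_mono[OF I] by (meson max.cobounded1 max.cobounded2)+
  then show ?case using mono_span_add by blast
next
  case (mult f g)
  then show ?case using mono_span_mult[OF I] by blast
qed

text \<open>The first \<open>s + 1\<close> exponents are free in \<open>{..q}\<close>; the last one compensates the degree.\<close>

lemma card_hom_exps_ge: "(q + 1) ^ (s + 1) \<le> card (hom_exps (s + 1) ((s + 1) * q))"
proof -
  let ?D = "Pi\<^sub>E {..<s + 1} (\<lambda>_. {..q})"
  define \<phi> where "\<phi> = (\<lambda>a j. if j < s + 1 then a j else if j = s + 1 then (s + 1) * q - (\<Sum>j<s + 1. a j) else (0 :: nat))"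
  have "card ?D = (q + 1) ^ (s + 1)" by (simp add: card_PiE)
  moreover have "inj_on \<phi> ?D"
  proof (rule inj_onI)
    fix a b assume ab: "a \<in> ?D" "b \<in> ?D" and eq: "\<phi> a = \<phi> b"
    show "a = b"
    proof (rule PiE_ext[OF ab])
      fix j assume "j \<in> {..<s + 1}"
      then show "a j = b j" using fun_cong[OF eq, of j] by (simp add: \<phi>_def)
    qed
  qed
  moreover have "\<phi> ` ?D \<subseteq> hom_exps (s + 1) ((s + 1) * q)"
  proof
    fix b assume "b \<in> \<phi> ` ?D"
    then obtain a where a: "a \<in> ?D" "b = \<phi> a" by blast
    have "a j \<le> q" if "j < s + 1" for j using a(1) that by (auto simp: PiE_iff)
    then have "(\<Sum>j<s + 1. a j) \<le> (\<Sum>j<s + 1. q)" by (intro sum_mono) auto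
    then have le: "(\<Sum>j<s + 1. a j) \<le> (s + 1) * q" by simp
    have "{..s + 1} = insert (s + 1) {..<s + 1}" by auto
    then have "(\<Sum>j\<le>s + 1. b j) = b (s + 1) + (\<Sum>j<s + 1. b j)" by simp
    also have "(\<Sum>j<s + 1. b j) = (\<Sum>j<s + 1. a j)"
      by (rule sum.cong) (auto simp: a \<phi>_def)
    also have "b (s + 1) = (s + 1) * q - (\<Sum>j<s + 1. a j)" by (simp add: a \<phi>_def)
    finally have "(\<Sum>j\<le>s + 1. b j) = (s + 1) * q" using le by simp
    then show "b \<in> hom_exps (s + 1) ((s + 1) * q)" by (auto simp: hom_exps_def a \<phi>_def)
  qed
  ultimately show ?thesis using card_inj_on_le[of \<phi> ?D] by (metis finite_hom_exps)
qed

text \<open>The products of degree \<open>m\<close> of the \<open>s + 2\<close> functions lie in the span of \<open>(m N + 1) ^ s\<close> monomials,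
  whereas for \<open>m = (s + 1) q\<close> there are at least \<open>(q + 1) ^ (s + 1)\<close> of them. For large \<open>q\<close> this is an
  underdetermined linear system.\<close>

lemma homogeneous_relation:
  fixes f :: "nat \<Rightarrow> ('i \<Rightarrow> complex) \<Rightarrow> complex"
  assumes I: "finite I" and f: "\<And>j. j \<le> card I + 1 \<Longrightarrow> f j \<in> polyfun K I"
  shows "\<exists>m c. (\<forall>a. c a \<in> K) \<and> (\<exists>a\<in>hom_exps (card I + 1) m. c a \<noteq> 0) \<and>
    (\<forall>x. hom_comb c (card I + 1) m (\<lambda>j. f j x) = 0)"
proof -
  define s where "s = card I"
  have "\<forall>j\<in>{..s + 1}. \<exists>N. f j \<in> mono_span I N"
    using polyfun_imp_mono_span[OF I] f by (simp add: s_def)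
  then obtain N' where N': "\<And>j. j \<le> s + 1 \<Longrightarrow> f j \<in> mono_span I (N' j)" by (auto simp: bchoice_iff)
  define N where "N = Max (N' ` {..s + 1}) + 1"
  have N: "f j \<in> mono_span I N" if "j \<le> s + 1" for j
  proof (rule mono_span_mono[OF I N'[OF that]])
    have "N' j \<le> Max (N' ` {..s + 1})" using that by (intro Max_ge) auto
    then show "N' j \<le> N" by (simp add: N_def)
  qed
  \<comment> \<open>bounds the number of monomials in the parameters by \<open>q * (q + 1) ^ s\<close>\<close>
  define q where "q = (N * (s + 1)) ^ s"
  define m where "m = (s + 1) * q"
  define E where "E = Pi\<^sub>E I (\<lambda>_. {..m * N})"
  have "finite E" unfolding E_def using I by (intro finite_PiE) auto
  have "card E = (m * N + 1) ^ s" by (simp add: E_def card_PiE[OF I] s_def)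
  also have "\<dots> \<le> (N * (s + 1) * (q + 1)) ^ s"
    by (intro power_mono) (auto simp: m_def N_def algebra_simps)
  also have "\<dots> = q * (q + 1) ^ s" by (simp only: q_def power_mult_distrib)
  also have "\<dots> < (q + 1) ^ (s + 1)" by simp
  also have "\<dots> \<le> card (hom_exps (s + 1) m)" unfolding m_def by (rule card_hom_exps_ge)
  finally have card: "card E < card (hom_exps (s + 1) m)" .
  have "(\<lambda>x. \<Prod>j\<le>s + 1. f j x ^ a j) \<in> mono_span I (m * N)" if a: "a \<in> hom_exps (s + 1) m" for a
  proof -
    have "(\<lambda>x. \<Prod>j\<le>s + 1. f j x ^ a j) \<in> mono_span I (\<Sum>j\<le>s + 1. a j * N)"
      by (intro mono_span_prod[OF I] mono_span_power[OF I] N) simp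
    also have "(\<Sum>j\<le>s + 1. a j * N) = m * N"
      using a by (simp only: sum_distrib_right[symmetric]) (simp add: hom_exps_def)
    finally show ?thesis .
  qed
  then have "\<forall>a\<in>hom_exps (s + 1) m. \<exists>A. (\<forall>e. A e \<in> K) \<and>
      (\<forall>x. (\<Prod>j\<le>s + 1. f j x ^ a j) = (\<Sum>e\<in>E. A e * mono_fun I e x))"
    unfolding mono_span_def E_def by blast
  then obtain A' where A': "\<And>a e. a \<in> hom_exps (s + 1) m \<Longrightarrow> A' a e \<in> K"
    "\<And>a x. a \<in> hom_exps (s + 1) m \<Longrightarrow> (\<Prod>j\<le>s + 1. f j x ^ a j) = (\<Sum>e\<in>E. A' a e * mono_fun I e x)"
    unfolding bchoice_iff by blast
  define A where "A = (\<lambda>e a. if a \<in> hom_exps (s + 1) m then A' a e else 0)"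
  have AK: "A e a \<in> K" for e a using A' by (auto simp: A_def)
  obtain c where c: "\<forall>a. c a \<in> K" "\<exists>a\<in>hom_exps (s + 1) m. c a \<noteq> 0"
    "\<forall>e\<in>E. (\<Sum>a\<in>hom_exps (s + 1) m. A e a * c a) = 0"
    using underdetermined_system[of E "hom_exps (s + 1) m" A, OF \<open>finite E\<close> finite_hom_exps card AK]
    by (elim exE conjE)
  have "hom_comb c (s + 1) m (\<lambda>j. f j x) = 0" for x
  proof -
    have "hom_comb c (s + 1) m (\<lambda>j. f j x) =
        (\<Sum>a\<in>hom_exps (s + 1) m. \<Sum>e\<in>E. c a * (A e a * mono_fun I e x))"
      unfolding hom_comb_def
      by (rule sum.cong) (use A' in \<open>auto simp: A_def sum_distrib_left simp del: prod.atMost_Suc\<close>)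
    also have "\<dots> = (\<Sum>e\<in>E. (\<Sum>a\<in>hom_exps (s + 1) m. A e a * c a) * mono_fun I e x)"
      by (subst sum.swap) (simp add: sum_distrib_left sum_distrib_right mult_ac)
    also have "\<dots> = 0" using c(3) by simp
    finally show ?thesis .
  qed
  with c show ?thesis unfolding s_def by blast
qed

end

section \<open>Closed sets and multihomogeneous polynomials\<close>

lemma poly_eval_poly_const [simp]: "poly_eval x (poly_const c) = c"
  by (simp add: poly_const_def poly_eval_single monomial_eval_def)

lemma poly_eval_poly_var [simp]: "poly_eval x (poly_var v) = x v"
  by (simp add: poly_var_def poly_eval_single monomial_eval_def)

lemma poly_eval_prod: "poly_eval x (\<Prod>i\<in>A. f i) = (\<Prod>i\<in>A. poly_eval x (f i))"
  by (induction A rule: infinite_finite_induct) (auto simp: poly_eval_mult)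

lemma poly_eval_power: "poly_eval x (p ^ e) = poly_eval x p ^ e"
  by (induction e) (auto simp: poly_eval_mult)

lemma poly_eval_hom_comb:
  "poly_eval x (hom_comb (\<lambda>a. poly_const (c a)) r m g) = hom_comb c r m (\<lambda>j. poly_eval x (g j))"
  by (simp add: hom_comb_def poly_eval_sum poly_eval_mult poly_eval_prod poly_eval_power)

locale multiproj = complex_subfield +
  fixes m D k :: nat
begin

abbreviation "pts \<equiv> proj_forms_prod K m D k"
abbreviation "zar \<equiv> zariski K m D k"
abbreviation "mh_polys \<equiv> multihom_polys K m D k"

text \<open>Multihomogeneous polynomials of a prescribed multidegree: unlike the union over all multidegrees, these
  are closed under addition.\<close>

definition mh :: "(nat \<Rightarrow> nat) \<Rightarrow> (nat \<times> nat monomial) cpoly set" where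
  "mh e = {g. (\<forall>M. lookup g M \<in> K) \<and>
     (\<forall>M\<in>keys g. keys M \<subseteq> {..<k} \<times> monomials_of_degree m D \<and>
       (\<forall>l<k. (\<Sum>v\<in>{v\<in>keys M. fst v = l}. lookup M v) = e l))}"

lemma mh_subset: "g \<in> mh e \<Longrightarrow> g \<in> mh_polys"
  unfolding mh_def multihom_polys_def by blast

lemma mh_polysE:
  assumes "g \<in> mh_polys" obtains e where "g \<in> mh e"
  using assms unfolding mh_def multihom_polys_def by blast

lemma mh_cong: "(\<And>l. l < k \<Longrightarrow> e l = e' l) \<Longrightarrow> mh e = mh e'"
  unfolding mh_def by auto

lemma mh_add: "g \<in> mh e \<Longrightarrow> h \<in> mh e \<Longrightarrow> g + h \<in> mh e"
  unfolding mh_def mem_Collect_eq lookup_add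
  using keys_add[of g h] by (intro conjI allI ballI add_in) blast+

lemma mh_0: "0 \<in> mh e"
  by (simp add: mh_def)

lemma mh_sum: "(\<And>s. s \<in> S \<Longrightarrow> f s \<in> mh e) \<Longrightarrow> (\<Sum>s\<in>S. f s) \<in> mh e"
  by (induction S rule: infinite_finite_induct) (auto simp: mh_0 mh_add)

lemma mh_mult:
  assumes g: "g \<in> mh e" and h: "h \<in> mh f"
  shows "g * h \<in> mh (\<lambda>l. e l + f l)"
proof -
  let ?B = "{..<k} \<times> monomials_of_degree m D"
  let ?s = "\<lambda>M l. \<Sum>v\<in>{v\<in>keys M. fst v = l}. lookup M v"
  have s_add: "?s (a + b) l = ?s a l + ?s b l" for a b :: "(nat \<times> nat monomial) monomial" and l
    using setsum_keys_plus_distrib[of "\<lambda>v x. if fst v = l then x else 0" a b]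
    by (simp add: sum.inter_filter)
  have "keys M \<subseteq> ?B \<and> (\<forall>l<k. ?s M l = e l + f l)"
    if "M \<in> keys (g * h)" for M
  proof -
    obtain a b where M: "M = a + b" and ab: "a \<in> keys g" "b \<in> keys h"
      using keys_mult[of g h] \<open>M \<in> keys (g * h)\<close> by blast
    have "keys M \<subseteq> ?B"
      using keys_add[of a b] g h ab unfolding M mh_def by blast
    moreover have "?s M l = e l + f l" if "l < k" for l
      using g h ab that unfolding M s_add mh_def by simp
    ultimately show ?thesis by blast
  qed
  moreover have "lookup (g * h) M \<in> K" for M
    using g h by (intro lookup_mult_in_subfield[OF subfield]) (auto simp: mh_def)
  ultimately show ?thesis
    by (simp add: mh_def)
qed

lemma mh_const: "c \<in> K \<Longrightarrow> poly_const c \<in> mh (\<lambda>_. 0)"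
  by (auto simp: mh_def poly_const_def lookup_single when_def)

lemma mh_scale: "c \<in> K \<Longrightarrow> g \<in> mh e \<Longrightarrow> poly_const c * g \<in> mh e"
  using mh_mult[OF mh_const, of c g e] by simp

lemma mh_var:
  assumes "l < k" "t \<in> monomials_of_degree m D"
  shows "poly_var (l, t) \<in> mh (\<lambda>l'. if l' = l then 1 else 0)"
proof -
  have "{v. v = (l, t) \<and> fst v = l'} = (if l' = l then {(l, t)} else {})" for l' by auto
  then show ?thesis
    using assms by (auto simp: mh_def poly_var_def lookup_single when_def)
qed

lemma mh_prod:
  "finite S \<Longrightarrow> (\<And>s. s \<in> S \<Longrightarrow> f s \<in> mh (e s)) \<Longrightarrow> (\<Prod>s\<in>S. f s) \<in> mh (\<lambda>l. \<Sum>s\<in>S. e s l)"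
proof (induction S rule: finite_induct)
  case empty
  then show ?case using mh_const[of 1] by (simp add: poly_const_def)
next
  case (insert s S)
  then show ?case using mh_mult[of "f s" "e s" "\<Prod>s\<in>S. f s" "\<lambda>l. \<Sum>s\<in>S. e s l"] by simp
qed

lemma mh_power: "g \<in> mh e \<Longrightarrow> g ^ n \<in> mh (\<lambda>l. n * e l)"
  using mh_prod[of "{..<n}" "\<lambda>_. g" "\<lambda>_. e"] by simp

lemma mh_hom_comb:
  assumes c: "\<And>a. c a \<in> K" and g: "\<And>j. j \<le> r \<Longrightarrow> g j \<in> mh e"
  shows "hom_comb (\<lambda>a. poly_const (c a)) r n g \<in> mh (\<lambda>l. n * e l)"
  unfolding hom_comb_def
proof (intro mh_sum mh_scale c)
  fix a assume a: "a \<in> hom_exps r n"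
  have "(\<Prod>j\<le>r. g j ^ a j) \<in> mh (\<lambda>l. \<Sum>j\<le>r. a j * e l)"
    by (intro mh_prod mh_power g) auto
  also have "(\<lambda>l. \<Sum>j\<le>r. a j * e l) = (\<lambda>l. n * e l)"
    using a by (simp add: sum_distrib_right[symmetric] hom_exps_def)
  finally show "(\<Prod>j\<le>r. g j ^ a j) \<in> mh (\<lambda>l. n * e l)" .
qed

text \<open>The value at an arbitrary representative of the point. Only its vanishing is independent of the
  choice, but with a fixed choice it is multiplicative.\<close>

definition pev :: "(nat \<Rightarrow> nat cpoly set) \<Rightarrow> (nat \<times> nat monomial) cpoly \<Rightarrow> complex" where
  "pev P g = poly_eval (form_coords (\<lambda>l. SOME q. q \<in> P l)) g"

lemma pev_mult: "pev P (g * h) = pev P g * pev P h"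
  by (simp add: pev_def poly_eval_mult)

lemma some_representative:
  assumes "P \<in> pts" "l < k"
  shows "(SOME q. q \<in> P l) \<in> P l"
proof -
  have "P l \<in> proj_forms K m D" using assms by (auto simp: proj_forms_prod_def)
  then have "P l \<noteq> {}" by (rule proj_forms_nonempty[OF subfield])
  then show ?thesis by (simp add: some_in_eq)
qed

lemma pev_eq_0_iff:
  assumes "P \<in> pts" "g \<in> mh_polys" "\<forall>l<k. G l \<in> P l"
  shows "pev P g = 0 \<longleftrightarrow> poly_eval (form_coords G) g = 0"
  unfolding pev_def
  using multihom_eval_representative[OF assms(2,1,3), of "\<lambda>l. SOME q. q \<in> P l"] some_representative[OF assms(1)]
  by blast

lemma zero_locus_iff:
  assumes "S \<subseteq> mh_polys"
  shows "P \<in> zero_locus K m D k S \<longleftrightarrow> P \<in> pts \<and> (\<forall>g\<in>S. pev P g = 0)"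
proof
  assume P: "P \<in> zero_locus K m D k S"
  then have pts: "P \<in> pts" by (simp add: zero_locus_def)
  have "pev P g = 0" if "g \<in> S" for g
  proof -
    have all: "\<forall>G. (\<forall>l<k. G l \<in> P l) \<longrightarrow> poly_eval (form_coords G) g = 0"
      using P that by (simp add: zero_locus_def)
    show ?thesis
      unfolding pev_def by (rule all[rule_format]) (rule some_representative[OF pts])
  qed
  with pts show "P \<in> pts \<and> (\<forall>g\<in>S. pev P g = 0)" by blast
next
  assume P: "P \<in> pts \<and> (\<forall>g\<in>S. pev P g = 0)"
  then show "P \<in> zero_locus K m D k S"
    using assms pev_eq_0_iff unfolding zero_locus_def by blast
qed

lemma closedin_zarD:
  assumes "closedin zar Z"
  obtains S where "S \<subseteq> mh_polys" "\<And>P. P \<in> Z \<longleftrightarrow> P \<in> pts \<and> (\<forall>g\<in>S. pev P g = 0)"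
proof -
  obtain S where "S \<subseteq> mh_polys" "Z = zero_locus K m D k S"
    using assms closedin_zariski[OF subfield] by blast
  then show ?thesis using that[of S] zero_locus_iff by blast
qed

lemma closedin_zero_set: "g \<in> mh_polys \<Longrightarrow> closedin zar {P \<in> pts. pev P g = 0}"
  unfolding closedin_zariski[OF subfield]
  by (rule exI[of _ "{g}"]) (auto simp: zero_locus_iff)

text \<open>The homogeneous ideal of a nonempty set \<open>Z\<close> is prime.\<close>

definition prime_on :: "(nat \<Rightarrow> nat cpoly set) set \<Rightarrow> bool" where
  "prime_on Z \<longleftrightarrow> (\<forall>g\<in>mh_polys. \<forall>h\<in>mh_polys. (\<forall>P\<in>Z. pev P g * pev P h = 0) \<longrightarrow>
     (\<forall>P\<in>Z. pev P g = 0) \<or> (\<forall>P\<in>Z. pev P h = 0))"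

lemma prime_onD:
  "prime_on Z \<Longrightarrow> g \<in> mh_polys \<Longrightarrow> h \<in> mh_polys \<Longrightarrow> (\<And>P. P \<in> Z \<Longrightarrow> pev P g * pev P h = 0) \<Longrightarrow>
     (\<forall>P\<in>Z. pev P g = 0) \<or> (\<forall>P\<in>Z. pev P h = 0)"
  unfolding prime_on_def by blast

lemma closedin_sub_iff:
  assumes "closedin zar Z"
  shows "closedin (subtopology zar Z) A \<longleftrightarrow> closedin zar A \<and> A \<subseteq> Z"
  using assms by (auto simp: closedin_closed_subtopology)

lemma topspace_sub: "closedin zar Z \<Longrightarrow> topspace (subtopology zar Z) = Z"
  using closedin_subset by (auto simp: topspace_subtopology)

lemma irreducible_iff:
  assumes Z: "closedin zar Z"
  shows "irreducible_space (subtopology zar Z) \<longleftrightarrow> Z \<noteq> {} \<and> prime_on Z"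
proof
  assume irr: "irreducible_space (subtopology zar Z)"
  have Zpts: "Z \<subseteq> pts" using closedin_subset[OF Z] by (simp add: topspace_zariski[OF subfield])
  have "prime_on Z"
    unfolding prime_on_def
  proof (intro ballI impI)
    fix g h assume gh: "g \<in> mh_polys" "h \<in> mh_polys" and z: "\<forall>P\<in>Z. pev P g * pev P h = 0"
    let ?A = "Z \<inter> {P \<in> pts. pev P g = 0}" and ?B = "Z \<inter> {P \<in> pts. pev P h = 0}"
    have "closedin zar ?A" "closedin zar ?B"
      using closedin_zero_set gh Z by blast+
    moreover have "?A \<union> ?B = Z" using z Zpts by auto
    ultimately have "?A = Z \<or> ?B = Z"
      using irr unfolding irreducible_space_def topspace_sub[OF Z] closedin_sub_iff[OF Z] by blast
    then show "(\<forall>P\<in>Z. pev P g = 0) \<or> (\<forall>P\<in>Z. pev P h = 0)" by blast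
  qed
  then show "Z \<noteq> {} \<and> prime_on Z"
    using irr unfolding irreducible_space_def topspace_sub[OF Z] by blast
next
  assume prime: "Z \<noteq> {} \<and> prime_on Z"
  show "irreducible_space (subtopology zar Z)"
    unfolding irreducible_space_def topspace_sub[OF Z] closedin_sub_iff[OF Z]
  proof (intro conjI allI impI)
    fix A B assume AB: "(closedin zar A \<and> A \<subseteq> Z) \<and> (closedin zar B \<and> B \<subseteq> Z) \<and> A \<union> B = Z"
    show "A = Z \<or> B = Z"
    proof (rule ccontr)
      assume "\<not> ?thesis"
      then obtain P Q where PQ: "P \<in> Z" "P \<notin> A" "Q \<in> Z" "Q \<notin> B" using AB by blast
      have pts: "Z \<subseteq> pts" using closedin_subset[OF Z] by (simp add: topspace_zariski[OF subfield])
      obtain S where S: "S \<subseteq> mh_polys" "\<And>P. P \<in> A \<longleftrightarrow> P \<in> pts \<and> (\<forall>g\<in>S. pev P g = 0)"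
        using AB closedin_zarD by metis
      obtain S' where S': "S' \<subseteq> mh_polys" "\<And>P. P \<in> B \<longleftrightarrow> P \<in> pts \<and> (\<forall>g\<in>S'. pev P g = 0)"
        using AB closedin_zarD by metis
      obtain g where g: "g \<in> S" "pev P g \<noteq> 0" using S PQ pts by blast
      obtain h where h: "h \<in> S'" "pev Q h \<noteq> 0" using S' PQ pts by blast
      have "pev R g * pev R h = 0" if "R \<in> Z" for R
      proof -
        have "R \<in> A \<or> R \<in> B" using AB that by blast
        then show ?thesis using S(2) S'(2) g(1) h(1) by auto
      qed
      then have "(\<forall>P\<in>Z. pev P g = 0) \<or> (\<forall>P\<in>Z. pev P h = 0)"
        using prime g h S(1) S'(1) by (intro prime_onD) auto
      then show False using PQ g h by blast
    qed
  qed (use prime in blast)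
qed

lemma vanish_on_closure:
  assumes "S \<subseteq> pts" "g \<in> mh_polys" "\<forall>P\<in>S. pev P g = 0" "P \<in> zar closure_of S"
  shows "pev P g = 0"
proof -
  have "zar closure_of S \<subseteq> {P \<in> pts. pev P g = 0}"
    using assms by (intro closure_of_minimal closedin_zero_set) auto
  then show ?thesis using assms by blast
qed

lemma subset_closure: "S \<subseteq> pts \<Longrightarrow> S \<subseteq> zar closure_of S"
  by (rule closure_of_subset) (simp add: topspace_zariski[OF subfield])

lemma prime_on_closure:
  assumes S: "S \<subseteq> pts" and "prime_on S"
  shows "prime_on (zar closure_of S)"
  unfolding prime_on_def
proof (intro ballI impI)
  fix g h assume gh: "g \<in> mh_polys" "h \<in> mh_polys"
    and z: "\<forall>P\<in>zar closure_of S. pev P g * pev P h = 0"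
  then have "\<forall>P\<in>S. pev P g * pev P h = 0" using subset_closure[OF S] by blast
  then have "(\<forall>P\<in>S. pev P g = 0) \<or> (\<forall>P\<in>S. pev P h = 0)"
    using assms(2) gh by (intro prime_onD) auto
  then show "(\<forall>P\<in>zar closure_of S. pev P g = 0) \<or> (\<forall>P\<in>zar closure_of S. pev P h = 0)"
    using vanish_on_closure[OF S] gh by blast
qed

lemma representative_coord_nonzero:
  assumes "P \<in> pts" "l < k" "q \<in> P l"
  shows "\<exists>t\<in>monomials_of_degree m D. lookup q t \<noteq> 0"
proof -
  have "P l \<in> proj_forms K m D" using assms by (auto simp: proj_forms_prod_def)
  then obtain p where p: "p \<in> forms K m D" "p \<noteq> 0" "P l = proj_class K p"
    unfolding proj_forms_def by blast
  then obtain c where c: "c \<noteq> 0" "q = poly_const c * p"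
    using assms(3) unfolding proj_class_def by blast
  obtain t where "t \<in> keys p" using p(2) by (metis all_not_in_conv keys_eq_empty)
  then show ?thesis
    using p c by (intro bexI[of _ t]) (auto simp: forms_def lookup_poly_const_mult in_keys_iff)
qed

text \<open>The forms are the separating forms \<open>h i\<close> of the consecutive sets, brought to a common multidegree
  by monomials in coordinates that do not vanish at a point of the smallest set.\<close>

lemma chain_without_relation:
  assumes Z: "\<And>i. i \<le> r \<Longrightarrow> closedin zar (Z i) \<and> irreducible_space (subtopology zar (Z i))"
    and strict: "\<And>i. i < r \<Longrightarrow> Z i \<subset> Z (Suc i)"
  shows "\<exists>E g. (\<forall>j\<le>r. g j \<in> mh (\<lambda>_. E)) \<and> (\<forall>n c a. (\<forall>a. c a \<in> K) \<longrightarrow>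
    (\<forall>P\<in>Z r. pev P (hom_comb (\<lambda>a. poly_const (c a)) r n g) = 0) \<longrightarrow> a \<in> hom_exps r n \<longrightarrow> c a = 0)"
proof -
  have prime: "prime_on (Z i)" and ne: "Z i \<noteq> {}" and pts: "Z i \<subseteq> pts" if "i \<le> r" for i
    using Z[OF that] irreducible_iff closedin_subset[of zar "Z i"]
    by (auto simp: topspace_zariski[OF subfield])
  obtain P0 where P0: "P0 \<in> Z 0" using ne[of 0] by blast
  then have P0pts: "P0 \<in> pts" using pts by blast
  have P0Z: "P0 \<in> Z i" if "i \<le> r" for i
    using that
  proof (induction i)
    case (Suc i)
    then show ?case using strict[of i] by auto
  qed (use P0 in simp)
  have "\<forall>l<k. \<exists>t\<in>monomials_of_degree m D. lookup (SOME q. q \<in> P0 l) t \<noteq> 0"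
    using representative_coord_nonzero[OF P0pts] some_representative[OF P0pts] by blast
  then obtain t where t: "\<And>l. l < k \<Longrightarrow> t l \<in> monomials_of_degree m D"
    "\<And>l. l < k \<Longrightarrow> lookup (SOME q. q \<in> P0 l) (t l) \<noteq> 0"
    by metis
  have "\<exists>h e P. h \<in> mh e \<and> (\<forall>P\<in>Z i. pev P h = 0) \<and> P \<in> Z (Suc i) \<and> pev P h \<noteq> 0" if i: "i < r" for i
  proof -
    obtain P where P: "P \<in> Z (Suc i)" "P \<notin> Z i" using strict[OF i] by blast
    have "closedin zar (Z i)" using Z[of i] i by simp
    then obtain S where S: "S \<subseteq> mh_polys" "\<And>P. P \<in> Z i \<longleftrightarrow> P \<in> pts \<and> (\<forall>g\<in>S. pev P g = 0)"
      using closedin_zarD by blast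
    obtain h where h: "h \<in> S" "pev P h \<noteq> 0" using S P pts[of "Suc i"] i by auto
    obtain e where "h \<in> mh e" using mh_polysE h S by blast
    then show ?thesis using h S P by blast
  qed
  then obtain h e Q where h: "\<And>i. i < r \<Longrightarrow> h i \<in> mh (e i)" "\<And>i P. i < r \<Longrightarrow> P \<in> Z i \<Longrightarrow> pev P (h i) = 0"
    "\<And>i. i < r \<Longrightarrow> Q i \<in> Z (Suc i)" "\<And>i. i < r \<Longrightarrow> pev (Q i) (h i) \<noteq> 0"
    by metis
  \<comment> \<open>any common upper bound of the degrees \<open>e i l\<close>\<close>
  define E where "E = (\<Sum>i<r. \<Sum>l<k. e i l)"
  have E: "e i l \<le> E" if "i < r" "l < k" for i l
  proof -
    have "e i l \<le> (\<Sum>l<k. e i l)" using that by (intro member_le_sum) auto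
    also have "\<dots> \<le> E" unfolding E_def using that by (intro member_le_sum[of i]) auto
    finally show ?thesis .
  qed
  define M where "M = (\<lambda>e'. \<Prod>l<k. poly_var (l, t l) ^ (e' l :: nat) :: (nat \<times> nat monomial) cpoly)"
  have M: "M e' \<in> mh e'" for e'
  proof -
    have "M e' \<in> mh (\<lambda>l'. \<Sum>l<k. e' l * (if l' = l then 1 else 0))"
      unfolding M_def by (intro mh_prod mh_power mh_var t) auto
    also have "mh (\<lambda>l'. \<Sum>l<k. e' l * (if l' = l then 1 else 0)) = mh e'"
      by (rule mh_cong) (simp add: if_distrib[of "\<lambda>y. _ * y"] cong: if_cong)
    finally show ?thesis .
  qed
  have MP0: "pev P0 (M e') \<noteq> 0" for e'
    using t by (simp add: M_def pev_def poly_eval_prod poly_eval_power form_coords_def)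
  define g where "g = (\<lambda>j. case j of 0 \<Rightarrow> M (\<lambda>_. E) | Suc i \<Rightarrow> h i * M (\<lambda>l. E - e i l))"
  have g: "g j \<in> mh (\<lambda>_. E)" if "j \<le> r" for j
  proof (cases j)
    case 0
    then show ?thesis using M by (simp add: g_def)
  next
    case (Suc i)
    then have "h i * M (\<lambda>l. E - e i l) \<in> mh (\<lambda>l. e i l + (E - e i l))"
      using that by (intro mh_mult h M) auto
    also have "\<dots> = mh (\<lambda>_. E)" using E[of i] Suc that by (intro mh_cong) auto
    finally show ?thesis using Suc by (simp add: g_def)
  qed
  have gnz: "\<exists>P\<in>Z (Suc i). pev P (g (Suc i)) \<noteq> 0" if i: "i < r" for i
  proof (rule ccontr)
    assume "\<not> ?thesis"
    then have "(\<forall>P\<in>Z (Suc i). pev P (h i) = 0) \<or> (\<forall>P\<in>Z (Suc i). pev P (M (\<lambda>l. E - e i l)) = 0)"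
      using i by (intro prime_onD[OF prime] mh_subset[OF h(1)] mh_subset[OF M]) (auto simp: g_def pev_mult)
    then show False using h(3,4)[OF i] MP0 P0Z[of "Suc i"] i by auto
  qed
  have pev_hc: "pev P (hom_comb (\<lambda>a. poly_const (c a)) i n g) = hom_comb c i n (\<lambda>j. pev P (g j))" for P c i n
    by (simp add: pev_def poly_eval_hom_comb)
  have "c a = 0" if c: "\<forall>a. c a \<in> K" and
    van: "\<forall>P\<in>Z r. pev P (hom_comb (\<lambda>a. poly_const (c a)) r n g) = 0" and a: "a \<in> hom_exps r n" for n c a
  proof (rule chain_independence[where Z = Z and G = "\<lambda>j P. pev P (g j)" and ?P0.0 = P0 and r = r and i = r
        and m = n and c = c and a = a])
    show "P0 \<in> Z 0" "pev P0 (g 0) \<noteq> 0" using P0 MP0 by (auto simp: g_def)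
    show "\<forall>P\<in>Z r. hom_comb c r n (\<lambda>j. pev P (g j)) = 0" using van by (simp add: pev_hc)
    show "pev P (g (Suc i)) = 0" if "i < r" "P \<in> Z i" for i P
      using h(2)[OF that] by (simp add: g_def pev_mult)
    show "\<forall>P\<in>Z (Suc i). hom_comb c (Suc i) n (\<lambda>j. pev P (g j)) = 0"
      if i: "i < r" and c: "\<forall>a. c a \<in> K" and
        z: "\<forall>P\<in>Z (Suc i). pev P (g (Suc i)) * hom_comb c (Suc i) n (\<lambda>j. pev P (g j)) = 0" for i n c
    proof -
      let ?h = "hom_comb (\<lambda>a. poly_const (c a)) (Suc i) n g"
      have "?h \<in> mh_polys"
        using c i g by (intro mh_subset[OF mh_hom_comb[where e = "\<lambda>_. E"]]) auto
      moreover have "g (Suc i) \<in> mh_polys" using mh_subset[OF g] i by simp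
      ultimately have "(\<forall>P\<in>Z (Suc i). pev P (g (Suc i)) = 0) \<or> (\<forall>P\<in>Z (Suc i). pev P ?h = 0)"
        using z i by (intro prime_onD[OF prime]) (auto simp: pev_hc)
      then show ?thesis using gnz[OF i] by (auto simp: pev_hc)
    qed
  qed (use strict c a in auto)
  with g show ?thesis by (intro exI[of _ E] exI[of _ g]) blast
qed

end

section \<open>Polynomial families of tuples of forms\<close>

context multiproj
begin

definition poly_family :: "'i set \<Rightarrow> (('i \<Rightarrow> complex) \<Rightarrow> nat \<Rightarrow> nat cpoly) \<Rightarrow> bool" where
  "poly_family I F \<longleftrightarrow> (\<forall>x l. range x \<subseteq> K \<longrightarrow> l < k \<longrightarrow> F x l \<in> forms K m D) \<and>
     (\<forall>l t. l < k \<longrightarrow> (\<lambda>x. lookup (F x l) t) \<in> polyfun K I)"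

definition family_dom :: "(('i \<Rightarrow> complex) \<Rightarrow> nat \<Rightarrow> nat cpoly) \<Rightarrow> ('i \<Rightarrow> complex) set" where
  "family_dom F = {x. range x \<subseteq> K \<and> (\<forall>l<k. F x l \<noteq> 0)}"

definition proj_tuple :: "(nat \<Rightarrow> nat cpoly) \<Rightarrow> nat \<Rightarrow> nat cpoly set" where
  "proj_tuple G = (\<lambda>l\<in>{..<k}. proj_class K (G l))"

definition family_image :: "(('i \<Rightarrow> complex) \<Rightarrow> nat \<Rightarrow> nat cpoly) \<Rightarrow> (nat \<Rightarrow> nat cpoly set) set" where
  "family_image F = (\<lambda>x. proj_tuple (F x)) ` family_dom F"

lemma proj_class_refl: "p \<in> proj_class K p"
  unfolding proj_class_def by (rule CollectI, rule exI[of _ 1]) (simp add: poly_const_def)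

lemma proj_tuple_in_pts:
  "(\<And>l. l < k \<Longrightarrow> G l \<in> forms K m D) \<Longrightarrow> (\<And>l. l < k \<Longrightarrow> G l \<noteq> 0) \<Longrightarrow> proj_tuple G \<in> pts"
  by (auto simp: proj_tuple_def proj_forms_prod_def proj_forms_def)

lemma family_image_pts: "poly_family I F \<Longrightarrow> family_image F \<subseteq> pts"
  unfolding family_image_def family_dom_def poly_family_def by (auto intro!: proj_tuple_in_pts)

lemma pev_proj_tuple:
  assumes "\<And>l. l < k \<Longrightarrow> G l \<in> forms K m D" "\<And>l. l < k \<Longrightarrow> G l \<noteq> 0" "g \<in> mh_polys"
  shows "pev (proj_tuple G) g = 0 \<longleftrightarrow> poly_eval (form_coords G) g = 0"
proof (rule pev_eq_0_iff[OF proj_tuple_in_pts[of G] assms(3)])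
  show "\<forall>l<k. G l \<in> proj_tuple G l" using proj_class_refl by (simp add: proj_tuple_def)
qed (use assms in auto)

lemma pev_family:
  assumes "poly_family I F" "x \<in> family_dom F" "g \<in> mh_polys"
  shows "pev (proj_tuple (F x)) g = 0 \<longleftrightarrow> poly_eval (form_coords (F x)) g = 0"
  using assms by (intro pev_proj_tuple) (auto simp: poly_family_def family_dom_def)

lemma polyfun_poly_eval_family:
  assumes F: "poly_family I F" and g: "g \<in> mh_polys"
  shows "(\<lambda>x. poly_eval (form_coords (F x)) g) \<in> polyfun K I"
  unfolding poly_eval_def monomial_eval_def
proof (intro polyfun_sum polyfun.mult polyfun_prod polyfun_power polyfun.const)
  show "lookup g M \<in> K" for M using g by (simp add: multihom_polys_def)
  fix M v assume "M \<in> keys g" "v \<in> keys M"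
  then have "fst v < k" using g unfolding multihom_polys_def by fastforce
  then show "(\<lambda>x. form_coords (F x) v) \<in> polyfun K I"
    using F by (cases v) (simp add: form_coords_def poly_family_def)
qed

text \<open>The domain of definition of the family is open.\<close>

lemma nonzero_coord_polyfun:
  assumes F: "poly_family I F" and x: "x \<in> family_dom F"
  shows "\<exists>f\<in>polyfun K I. f x \<noteq> 0 \<and> (\<forall>z. range z \<subseteq> K \<longrightarrow> f z \<noteq> 0 \<longrightarrow> z \<in> family_dom F)"
proof -
  have "\<forall>l<k. \<exists>t. lookup (F x l) t \<noteq> 0"
    using x unfolding family_dom_def by (metis (mono_tags, lifting) lookup_zero mem_Collect_eq poly_mapping_eqI)
  then obtain t where t: "\<And>l. l < k \<Longrightarrow> lookup (F x l) (t l) \<noteq> 0" by metis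
  let ?f = "\<lambda>z. \<Prod>l<k. lookup (F z l) (t l)"
  have "?f \<in> polyfun K I" using F by (intro polyfun_prod) (auto simp: poly_family_def)
  moreover have "?f x \<noteq> 0" using t by simp
  moreover have "z \<in> family_dom F" if z: "range z \<subseteq> K" "?f z \<noteq> 0" for z
  proof -
    have "F z l \<noteq> 0" if "l < k" for l
    proof -
      have "lookup (F z l) (t l) \<noteq> 0" using z(2) that by auto
      then show ?thesis by auto
    qed
    then show ?thesis using z(1) by (simp add: family_dom_def)
  qed
  ultimately show ?thesis by (intro bexI[of _ ?f]) auto
qed

text \<open>The pullback of a form is a polynomial function of the parameters, and affine space is irreducible.\<close>

lemma prime_on_family_image:
  assumes F: "poly_family I F"
  shows "prime_on (family_image F)"
  unfolding prime_on_def
proof (intro ballI impI, rule ccontr)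
  fix g h assume gh: "g \<in> mh_polys" "h \<in> mh_polys"
    and z: "\<forall>P\<in>family_image F. pev P g * pev P h = 0"
    and "\<not> ((\<forall>P\<in>family_image F. pev P g = 0) \<or> (\<forall>P\<in>family_image F. pev P h = 0))"
  then obtain x y where x: "x \<in> family_dom F" "pev (proj_tuple (F x)) g \<noteq> 0"
    and y: "y \<in> family_dom F" "pev (proj_tuple (F y)) h \<noteq> 0"
    unfolding family_image_def by blast
  let ?g = "\<lambda>x. poly_eval (form_coords (F x)) g" and ?h = "\<lambda>x. poly_eval (form_coords (F x)) h"
  obtain f where f: "f \<in> polyfun K I" "f x \<noteq> 0"
    "\<And>z. range z \<subseteq> K \<Longrightarrow> f z \<noteq> 0 \<Longrightarrow> z \<in> family_dom F"
    using nonzero_coord_polyfun[OF F x(1)] by blast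
  have "(\<lambda>x. f x * ?g x) \<in> polyfun K I" "?h \<in> polyfun K I"
    by (intro polyfun.mult f polyfun_poly_eval_family[OF F] gh)+
  moreover have "f x * ?g x \<noteq> 0" using f(2) x pev_family[OF F x(1) gh(1)] by simp
  moreover have "?h y \<noteq> 0" using y pev_family[OF F y(1) gh(2)] by simp
  ultimately obtain w where w: "range w \<subseteq> K" "f w * ?g w \<noteq> 0" "?h w \<noteq> 0"
    using polyfun_common_nonzero[of "\<lambda>x. f x * ?g x" I ?h x y] x(1) y(1) by (auto simp: family_dom_def)
  then have wd: "w \<in> family_dom F" using f(3) by auto
  then have "pev (proj_tuple (F w)) g \<noteq> 0" "pev (proj_tuple (F w)) h \<noteq> 0"
    using w pev_family[OF F wd] gh by auto
  then show False using z wd by (auto simp: family_image_def)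
qed

lemma family_closure:
  assumes F: "poly_family I F" and "family_dom F \<noteq> {}"
  shows "closedin zar (zar closure_of family_image F)"
    "irreducible_space (subtopology zar (zar closure_of family_image F))"
proof -
  show cl: "closedin zar (zar closure_of family_image F)" by simp
  have "family_image F \<noteq> {}" using assms by (simp add: family_image_def)
  then have "zar closure_of family_image F \<noteq> {}"
    using subset_closure[OF family_image_pts[OF F]] by blast
  then show "irreducible_space (subtopology zar (zar closure_of family_image F))"
    using irreducible_iff[OF cl] prime_on_closure[OF family_image_pts[OF F] prime_on_family_image[OF F]]
    by blast
qed

lemma family_relation:
  assumes F: "poly_family I F" and I: "finite I"
    and g: "\<And>j. j \<le> card I + 1 \<Longrightarrow> g j \<in> mh (\<lambda>_. E)"
  shows "\<exists>n c. (\<forall>a. c a \<in> K) \<and> (\<exists>a\<in>hom_exps (card I + 1) n. c a \<noteq> 0) \<and>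
    (\<forall>P\<in>zar closure_of family_image F. pev P (hom_comb (\<lambda>a. poly_const (c a)) (card I + 1) n g) = 0)"
proof -
  let ?f = "\<lambda>j x. poly_eval (form_coords (F x)) (g j)"
  have "?f j \<in> polyfun K I" if "j \<le> card I + 1" for j
    by (rule polyfun_poly_eval_family[OF F mh_subset[OF g[OF that]]])
  then have "\<exists>n c. (\<forall>a. c a \<in> K) \<and> (\<exists>a\<in>hom_exps (card I + 1) n. c a \<noteq> 0) \<and>
      (\<forall>x. hom_comb c (card I + 1) n (\<lambda>j. ?f j x) = 0)"
    by (intro homogeneous_relation I)
  then obtain n c where c: "\<forall>a. c a \<in> K" "\<exists>a\<in>hom_exps (card I + 1) n. c a \<noteq> 0"
    and rel: "\<forall>x. hom_comb c (card I + 1) n (\<lambda>j. ?f j x) = 0"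
    by (elim exE conjE)
  let ?R = "hom_comb (\<lambda>a. poly_const (c a)) (card I + 1) n g"
  have R: "?R \<in> mh_polys"
    by (rule mh_subset[OF mh_hom_comb[where e = "\<lambda>_. E"]]) (use c g in auto)
  have "\<forall>P\<in>family_image F. pev P ?R = 0"
    using pev_family[OF F _ R] rel by (auto simp: family_image_def poly_eval_hom_comb)
  then show ?thesis
    using vanish_on_closure[OF family_image_pts[OF F] R] c by blast
qed

end

section \<open>The network as a polynomial family\<close>

text \<open>The convolution formula below sums over all decompositions of the exponent. Its range does not depend
  on the factors, so it can be differentiated and is visibly polynomial in the coefficients.\<close>

lemma finite_decompositions: "finite {(a, b). a + b = (t :: 'v monomial)}"
proof (rule finite_imageD)
  let ?D = "{(a, b). a + b = t}"
  let ?f = "\<lambda>(a :: 'v monomial, b :: 'v monomial). restrict (lookup a) (keys t)"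
  have le: "lookup a v \<le> lookup t v" if "a + b = t" for a b v
    using that by (auto simp: lookup_add)
  have "?f ` ?D \<subseteq> Pi\<^sub>E (keys t) (\<lambda>v. {..lookup t v})"
    using le by auto
  then show "finite (?f ` ?D)" by (rule finite_subset) (intro finite_PiE, auto)
  show "inj_on ?f ?D"
  proof (rule inj_onI)
    fix x y assume x: "x \<in> ?D" and y: "y \<in> ?D" and eq: "?f x = ?f y"
    obtain a b where x': "x = (a, b)" "a + b = t" using x by auto
    obtain a' b' where y': "y = (a', b')" "a' + b' = t" using y by auto
    have "lookup a v = lookup a' v" for v
    proof (cases "v \<in> keys t")
      case True
      then show ?thesis using fun_cong[OF eq, of v] x' y' by simp
    next
      case False
      then have "lookup t v = 0" by (simp add: in_keys_iff)
      then show ?thesis using le[OF x'(2), of v] le[OF y'(2), of v] by simp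
    qed
    then have "a = a'" by (rule poly_mapping_eqI)
    then show "x = y" using x' y' by auto
  qed
qed

lemma lookup_times:
  fixes p q :: "'v cpoly"
  shows "lookup (p * q) t =
    (\<Sum>(a, b)\<in>{(a, b). a + b = t}. lookup p a * lookup q b)"
proof -
  let ?S = "keys p \<times> keys q" and ?D = "{(a, b). a + b = t}"
  let ?f = "\<lambda>(a, b). lookup p a * lookup q b"
  have "lookup (p * q) t =
      (\<Sum>a\<in>keys p. \<Sum>b\<in>keys q. if a + b = t then lookup p a * lookup q b else 0)"
    by (subst poly_mult_eq_sum_single) (simp add: lookup_sum lookup_single when_def)
  also have "\<dots> = (\<Sum>x\<in>?S. if x \<in> ?D then ?f x else 0)"
    by (subst sum.cartesian_product) (auto intro!: sum.cong)
  also have "\<dots> = (\<Sum>x\<in>?S \<inter> ?D. ?f x)"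
    by (rule sum.inter_restrict[symmetric]) simp
  also have "\<dots> = (\<Sum>x\<in>?D. ?f x)"
    by (rule sum.mono_neutral_left) (use finite_decompositions in \<open>auto simp: in_keys_iff\<close>)
  finally show ?thesis .
qed

text \<open>Weights as functions of (layer, row, column), the form required by \<open>polyfun\<close>.\<close>

type_synonym params = "nat \<times> nat \<times> nat \<Rightarrow> complex"

primrec neuron :: "(nat \<Rightarrow> nat) \<Rightarrow> (nat \<Rightarrow> nat) \<Rightarrow> params \<Rightarrow> nat \<Rightarrow> nat \<Rightarrow> nat cpoly" where
  "neuron n d x 0 r = poly_var r"
| "neuron n d x (Suc i) r =
     (\<Sum>s<n i. poly_const (x (Suc i, r, s)) * neuron n d x i s) ^ d (Suc i)"

definition preact :: "(nat \<Rightarrow> nat) \<Rightarrow> (nat \<Rightarrow> nat) \<Rightarrow> params \<Rightarrow> nat \<Rightarrow> nat \<Rightarrow> nat cpoly" where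
  "preact n d x i r = (\<Sum>s<n (i - 1). poly_const (x (i, r, s)) * neuron n d x (i - 1) s)"

lemma neuron_Suc: "neuron n d x (Suc i) r = preact n d x (Suc i) r ^ d (Suc i)"
  by (simp add: preact_def)

declare neuron.simps(2) [simp del]

definition weight_index :: "(nat \<Rightarrow> nat) \<Rightarrow> nat \<Rightarrow> (nat \<times> nat \<times> nat) set" where
  "weight_index n L = {(i, r, s). 1 \<le> i \<and> i \<le> L \<and> r < n i \<and> s < n (i - 1)}"

lemma finite_weight_index: "finite (weight_index n L)"
proof -
  have "weight_index n L = (\<lambda>(i, r, s). (i, r, s)) ` (SIGMA i:{1..L}. {..<n i} \<times> {..<n (i - 1)})"
    by (auto simp: weight_index_def)
  then show ?thesis by simp
qed

lemma hidden_eq_neuron: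
  assumes W: "\<And>i. 1 \<le> i \<Longrightarrow> i \<le> L \<Longrightarrow> W i \<in> carrier_mat (n i) (n (i - 1))"
    and x: "\<And>i r s. (i, r, s) \<in> weight_index n L \<Longrightarrow> x (i, r, s) = W i $$ (r, s)"
  shows "i \<le> L \<Longrightarrow> hidden n d W i = vec (n i) (neuron n d x i)"
proof (induction i)
  case (Suc i)
  have Wi: "W (Suc i) \<in> carrier_mat (n (Suc i)) (n i)" using W[of "Suc i"] Suc.prems by simp
  show ?case
  proof (rule eq_vecI)
    fix r assume "r < dim_vec (vec (n (Suc i)) (neuron n d x (Suc i)))"
    then have r: "r < n (Suc i)" by simp
    have "(map_mat poly_const (W (Suc i)) *\<^sub>v hidden n d W i) $ r =
        (\<Sum>s<n i. poly_const (x (Suc i, r, s)) * neuron n d x i s)"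
      using Suc Wi r x[of "Suc i" r] by (auto simp: scalar_prod_def weight_index_def lessThan_atLeast0 intro!: sum.cong)
    then show "hidden n d W (Suc i) $ r = vec (n (Suc i)) (neuron n d x (Suc i)) $ r"
      using Wi r by (simp add: neuron.simps)
  qed (use Wi in simp)
qed (auto intro!: eq_vecI)

lemma network_eq_preact:
  assumes W: "\<And>i. 1 \<le> i \<Longrightarrow> i \<le> L \<Longrightarrow> W i \<in> carrier_mat (n i) (n (i - 1))"
    and x: "\<And>i r s. (i, r, s) \<in> weight_index n L \<Longrightarrow> x (i, r, s) = W i $$ (r, s)"
    and L: "1 \<le> L" and l: "l < n L"
  shows "network L n d W $ l = preact n d x L l"
proof -
  have WL: "W L \<in> carrier_mat (n L) (n (L - 1))" using W L by simp
  have "hidden n d W (L - 1) = vec (n (L - 1)) (neuron n d x (L - 1))"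
    by (rule hidden_eq_neuron[OF W x]) auto
  then show ?thesis
    using WL l L x[of L l] unfolding network_def preact_def
    by (auto simp: scalar_prod_def weight_index_def lessThan_atLeast0 intro!: sum.cong)
qed

definition layer_degree :: "(nat \<Rightarrow> nat) \<Rightarrow> nat \<Rightarrow> nat" where
  "layer_degree d i = (\<Prod>j=1..i - 1. d j)"

lemma layer_degree_Suc: "1 \<le> i \<Longrightarrow> layer_degree d (Suc i) = d i * layer_degree d i"
  by (cases i) (simp_all add: layer_degree_def)

lemma total_degree_eq: "total_degree L d = layer_degree d L"
  by (simp add: total_degree_def layer_degree_def)

context complex_subfield
begin

lemma forms_scale: "c \<in> K \<Longrightarrow> p \<in> forms K m D \<Longrightarrow> poly_const c * p \<in> forms K m D"
  using forms_mult[OF subfield forms_const[OF subfield], of c p m D] by simp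

lemma neuron_forms:
  assumes "range x \<subseteq> K"
  shows "r < n i \<Longrightarrow> neuron n d x i r \<in> forms K (n 0) (layer_degree d (Suc i))"
proof (induction i arbitrary: r)
  case 0
  then show ?case using forms_var[OF subfield] by (simp add: layer_degree_def)
next
  case (Suc i)
  have "(\<Sum>s<n i. poly_const (x (Suc i, r, s)) * neuron n d x i s) \<in> forms K (n 0) (layer_degree d (Suc i))"
    using Suc assms by (intro forms_sum[OF subfield] forms_scale) auto
  from forms_power[OF subfield this, of "d (Suc i)"] show ?case
    by (simp add: neuron.simps layer_degree_Suc)
qed

lemma preact_forms:
  assumes "range x \<subseteq> K" "1 \<le> i"
  shows "preact n d x i r \<in> forms K (n 0) (layer_degree d i)"
  unfolding preact_def
  using assms neuron_forms[OF assms(1), of _ n "i - 1" d] by (intro forms_sum[OF subfield] forms_scale) auto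

definition polyfun_coeffs :: "'i set \<Rightarrow> (('i \<Rightarrow> complex) \<Rightarrow> 'v cpoly) \<Rightarrow> bool" where
  "polyfun_coeffs I Y \<longleftrightarrow> (\<forall>t. (\<lambda>x. lookup (Y x) t) \<in> polyfun K I)"

lemma polyfun_coeffs_sum:
  "(\<And>s. s \<in> S \<Longrightarrow> polyfun_coeffs I (Y s)) \<Longrightarrow> polyfun_coeffs I (\<lambda>x. \<Sum>s\<in>S. Y s x)"
  unfolding polyfun_coeffs_def lookup_sum by (auto intro!: polyfun_sum)

lemma polyfun_coeffs_mult:
  "polyfun_coeffs I Y \<Longrightarrow> polyfun_coeffs I Z \<Longrightarrow> polyfun_coeffs I (\<lambda>x. Y x * Z x)"
  unfolding polyfun_coeffs_def lookup_times by (auto intro!: polyfun_sum polyfun.mult)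

lemma polyfun_coeffs_scale:
  "f \<in> polyfun K I \<Longrightarrow> polyfun_coeffs I Y \<Longrightarrow> polyfun_coeffs I (\<lambda>x. poly_const (f x) * Y x)"
  unfolding polyfun_coeffs_def lookup_poly_const_mult by (auto intro!: polyfun.mult)

lemma polyfun_coeffs_const:
  "(\<And>t. lookup p t \<in> K) \<Longrightarrow> polyfun_coeffs I (\<lambda>x. p)"
  unfolding polyfun_coeffs_def by (blast intro: polyfun.const)

lemma polyfun_coeffs_power:
  assumes "polyfun_coeffs I Y" shows "polyfun_coeffs I (\<lambda>x. Y x ^ e)"
proof (induction e)
  case 0
  show ?case by (simp, rule polyfun_coeffs_const) (simp add: lookup_one when_def)
next
  case (Suc e)
  then show ?case using polyfun_coeffs_mult[OF assms] by simp
qed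

lemma polyfun_coeffs_neuron:
  "i \<le> L \<Longrightarrow> r < n i \<Longrightarrow> polyfun_coeffs (weight_index n L) (\<lambda>x. neuron n d x i r)"
proof (induction i arbitrary: r)
  case 0
  show ?case by (simp, rule polyfun_coeffs_const) (simp add: poly_var_def lookup_single when_def)
next
  case (Suc i)
  then show ?case unfolding neuron.simps
    by (intro polyfun_coeffs_power polyfun_coeffs_sum polyfun_coeffs_scale polyfun.var)
      (auto simp: weight_index_def)
qed

lemma polyfun_coeffs_preact:
  "1 \<le> i \<Longrightarrow> i \<le> L \<Longrightarrow> r < n i \<Longrightarrow> polyfun_coeffs (weight_index n L) (\<lambda>x. preact n d x i r)"
  unfolding preact_def
  by (intro polyfun_coeffs_sum polyfun_coeffs_scale polyfun.var polyfun_coeffs_neuron)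
    (auto simp: weight_index_def)

end

locale network_setup = complex_subfield +
  fixes L :: nat and n d :: "nat \<Rightarrow> nat"
  assumes L: "1 \<le> L"

sublocale network_setup \<subseteq> multiproj K "n 0" "total_degree L d" "n L" ..

context network_setup
begin

abbreviation "weight_set \<equiv> weight_index n L"

definition out :: "params \<Rightarrow> nat \<Rightarrow> nat cpoly" where
  "out x l = preact n d x L l"

lemma poly_family_out: "poly_family weight_set out"
  unfolding poly_family_def
proof (intro conjI allI impI)
  show "out x l \<in> forms K (n 0) (total_degree L d)" if "range x \<subseteq> K" for x l
    unfolding out_def total_degree_eq by (rule preact_forms[OF that L])
  show "(\<lambda>x. lookup (out x l) t) \<in> polyfun K weight_set" if "l < n L" for l t
    using polyfun_coeffs_preact[of L L l n d] L that by (simp add: polyfun_coeffs_def out_def)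
qed

text \<open>The network with the weights in \<open>S\<close> free and all others frozen at \<open>p\<close>.\<close>

definition out_on :: "(nat \<times> nat \<times> nat) set \<Rightarrow> params \<Rightarrow> params \<Rightarrow> nat \<Rightarrow> nat cpoly" where
  "out_on S p x = out (\<lambda>i. if i \<in> S then x i else p i)"

lemma poly_family_out_on:
  assumes p: "range p \<subseteq> K"
  shows "poly_family S (out_on S p)"
  unfolding poly_family_def
proof (intro conjI allI impI)
  fix x :: params and l assume "range x \<subseteq> K" "l < n L"
  moreover from this p have "range (\<lambda>i. if i \<in> S then x i else p i) \<subseteq> K" by auto
  ultimately show "out_on S p x l \<in> forms K (n 0) (total_degree L d)"
    using poly_family_out unfolding poly_family_def out_on_def by blast
next
  fix l t assume l: "l < n L"
  have f: "(\<lambda>x. lookup (out x l) t) \<in> polyfun K weight_set"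
    using poly_family_out l unfolding poly_family_def by blast
  show "(\<lambda>x. lookup (out_on S p x l) t) \<in> polyfun K S"
    unfolding out_on_def
  proof (rule polyfun_subst[OF f])
    fix i
    show "(\<lambda>x. if i \<in> S then x i else p i) \<in> polyfun K S"
      using p by (cases "i \<in> S") (auto intro: polyfun.intros)
  qed
qed

text \<open>Entries outside the index set of the weights do not influence the network, so arbitrary functions
  with values in \<open>K\<close> represent the weight matrices.\<close>

lemma param_image_eq: "param_map K L n d ` param_domain K L n d = family_image out"
proof (intro equalityI subsetI)
  fix P assume "P \<in> param_map K L n d ` param_domain K L n d"
  then obtain W where W: "W \<in> weights K L n" "\<forall>l<n L. network L n d W $ l \<noteq> 0" "P = param_map K L n d W"
    by (auto simp: param_domain_def)
  define x :: params where "x = (\<lambda>(i, r, s). if (i, r, s) \<in> weight_set then W i $$ (r, s) else 0)"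
  have carr: "W i \<in> carrier_mat (n i) (n (i - 1))" "elements_mat (W i) \<subseteq> K" if "1 \<le> i" "i \<le> L" for i
    using W(1) that by (auto simp: weights_def)
  have net: "network L n d W $ l = out x l" if "l < n L" for l
    unfolding out_def by (rule network_eq_preact[OF carr(1) _ L that]) (simp_all add: x_def)
  have "x (i, r, s) \<in> K" for i r s
  proof (cases "(i, r, s) \<in> weight_set")
    case True
    then have i: "1 \<le> i" "i \<le> L" "r < n i" "s < n (i - 1)" by (auto simp: weight_index_def)
    then have "W i $$ (r, s) \<in> elements_mat (W i)"
      using carr(1)[of i] by (intro elements_matI) auto
    then show ?thesis using carr(2)[of i] i True by (auto simp: x_def)
  qed (simp add: x_def)
  then have "x \<in> family_dom out" using W(2) net by (auto simp: family_dom_def)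
  moreover have "P = proj_tuple (out x)"
    unfolding W(3) param_map_def proj_tuple_def by (rule restrict_ext) (simp add: net)
  ultimately show "P \<in> family_image out" by (auto simp: family_image_def)
next
  fix P assume "P \<in> family_image out"
  then obtain x where x: "range x \<subseteq> K" "\<forall>l<n L. out x l \<noteq> 0" "P = proj_tuple (out x)"
    by (auto simp: family_image_def family_dom_def)
  define W where "W = (\<lambda>i. mat (n i) (n (i - 1)) (\<lambda>(r, s). x (i, r, s)))"
  have net: "network L n d W $ l = out x l" if "l < n L" for l
    unfolding out_def using L that by (intro network_eq_preact) (auto simp: W_def weight_index_def)
  have "W \<in> weights K L n"
    using x(1) by (auto simp: weights_def W_def elements_mat_def)
  then have "W \<in> param_domain K L n d" using x(2) net by (simp add: param_domain_def)
  moreover have "P = param_map K L n d W"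
    unfolding x(3) param_map_def proj_tuple_def by (rule restrict_ext) (simp add: net)
  ultimately show "P \<in> param_map K L n d ` param_domain K L n d" by blast
qed

lemma neurovariety_eq: "neurovariety K L n d = zar closure_of family_image out"
  by (simp add: neurovariety_def param_image_eq)

end

section \<open>Tangent vectors of the network\<close>

definition coeff_deriv :: "(complex \<Rightarrow> 'v cpoly) \<Rightarrow> 'v cpoly \<Rightarrow> bool" where
  "coeff_deriv Y Y' \<longleftrightarrow> (\<forall>t. ((\<lambda>\<tau>. lookup (Y \<tau>) t) has_field_derivative lookup Y' t) (at 0))"

lemma coeff_deriv_const: "coeff_deriv (\<lambda>_. p) 0"
  by (simp add: coeff_deriv_def)

lemma coeff_deriv_sum:
  "(\<And>s. s \<in> S \<Longrightarrow> coeff_deriv (Y s) (Y' s)) \<Longrightarrow> coeff_deriv (\<lambda>\<tau>. \<Sum>s\<in>S. Y s \<tau>) (\<Sum>s\<in>S. Y' s)"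
  unfolding coeff_deriv_def lookup_sum by (auto intro!: DERIV_sum)

lemma coeff_deriv_mult:
  assumes "coeff_deriv Y Y'" "coeff_deriv Z Z'"
  shows "coeff_deriv (\<lambda>\<tau>. Y \<tau> * Z \<tau>) (Y' * Z 0 + Y 0 * Z')"
  unfolding coeff_deriv_def
proof
  fix t :: "'a monomial"
  let ?D = "{(a, b). a + b = t}"
  have "((\<lambda>\<tau>. \<Sum>x\<in>?D. lookup (Y \<tau>) (fst x) * lookup (Z \<tau>) (snd x)) has_field_derivative
     (\<Sum>x\<in>?D. lookup (Y 0) (fst x) * lookup Z' (snd x) +
       lookup Y' (fst x) * lookup (Z 0) (snd x))) (at 0)"
    using assms unfolding coeff_deriv_def by (intro DERIV_sum DERIV_mult') auto
  then show "((\<lambda>\<tau>. lookup (Y \<tau> * Z \<tau>) t) has_field_derivative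
      lookup (Y' * Z 0 + Y 0 * Z') t) (at 0)"
    by (simp add: lookup_add lookup_times case_prod_unfold sum.distrib add.commute)
qed

lemma poly_const_1 [simp]: "poly_const 1 = 1"
  by (simp add: poly_const_def)

lemma poly_const_0 [simp]: "poly_const 0 = 0"
  by (simp add: poly_const_def)

lemma poly_const_add: "poly_const (a + b) = poly_const a + poly_const b"
  by (simp add: poly_const_def single_add)

lemma poly_const_mult: "poly_const (a * b) = poly_const a * poly_const b"
  by (simp add: poly_const_def mult_single)

lemma poly_const_of_nat: "poly_const (of_nat e) = of_nat e"
  by (induction e) (simp_all add: poly_const_add)

lemma coeff_deriv_power:
  assumes Y: "coeff_deriv Y Y'"
  shows "coeff_deriv (\<lambda>\<tau>. Y \<tau> ^ e) (poly_const (of_nat e) * Y 0 ^ (e - 1) * Y')"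
proof (induction e)
  case 0
  show ?case using coeff_deriv_const[of 1] by simp
next
  case (Suc e)
  have "Y' * Y 0 ^ e + Y 0 * (poly_const (of_nat e) * Y 0 ^ (e - 1) * Y') =
      poly_const (of_nat (Suc e)) * Y 0 ^ (Suc e - 1) * Y'"
    unfolding poly_const_of_nat by (cases e) (simp_all add: algebra_simps)
  with coeff_deriv_mult[OF Y Suc] show ?case by simp
qed

lemma coeff_deriv_scale:
  assumes "coeff_deriv Y Y'"
  shows "coeff_deriv (\<lambda>\<tau>. poly_const (a + \<tau> * b) * Y \<tau>) (poly_const b * Y 0 + poly_const a * Y')"
  unfolding coeff_deriv_def lookup_poly_const_mult lookup_add
proof
  fix t
  have "((\<lambda>\<tau>. lookup (Y \<tau>) t) has_field_derivative lookup Y' t) (at 0)"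
    using assms by (simp add: coeff_deriv_def)
  then show "((\<lambda>\<tau>. (a + \<tau> * b) * lookup (Y \<tau>) t) has_field_derivative
      b * lookup (Y 0) t + a * lookup Y' t) (at 0)"
    by (auto intro!: derivative_eq_intros)
qed

text \<open>The chain rule for the network: the derivatives at the weights \<open>x\<close> in direction \<open>v\<close>.\<close>

primrec dneuron :: "(nat \<Rightarrow> nat) \<Rightarrow> (nat \<Rightarrow> nat) \<Rightarrow> params \<Rightarrow> params \<Rightarrow> nat \<Rightarrow> nat \<Rightarrow> nat cpoly" where
  "dneuron n d x v 0 r = 0"
| "dneuron n d x v (Suc i) r = poly_const (of_nat (d (Suc i))) * preact n d x (Suc i) r ^ (d (Suc i) - 1) *
     (\<Sum>s<n i. poly_const (v (Suc i, r, s)) * neuron n d x i s + poly_const (x (Suc i, r, s)) * dneuron n d x v i s)"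

declare dneuron.simps(2) [simp del]

definition dpreact :: "(nat \<Rightarrow> nat) \<Rightarrow> (nat \<Rightarrow> nat) \<Rightarrow> params \<Rightarrow> params \<Rightarrow> nat \<Rightarrow> nat \<Rightarrow> nat cpoly" where
  "dpreact n d x v i r = (\<Sum>s<n (i - 1). poly_const (v (i, r, s)) * neuron n d x (i - 1) s
     + poly_const (x (i, r, s)) * dneuron n d x v (i - 1) s)"

lemma dneuron_Suc: "dneuron n d x v (Suc i) r =
    poly_const (of_nat (d (Suc i))) * preact n d x (Suc i) r ^ (d (Suc i) - 1) * dpreact n d x v (Suc i) r"
  by (simp add: dneuron.simps dpreact_def)

lemma coeff_deriv_neuron:
  "coeff_deriv (\<lambda>\<tau>. neuron n d (\<lambda>i. x i + \<tau> * v i) i r) (dneuron n d x v i r)"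
proof (induction i arbitrary: r)
  case 0
  show ?case using coeff_deriv_const by simp
next
  case (Suc i)
  have "coeff_deriv (\<lambda>\<tau>. \<Sum>s<n i. poly_const (x (Suc i, r, s) + \<tau> * v (Suc i, r, s)) *
        neuron n d (\<lambda>i. x i + \<tau> * v i) i s)
     (\<Sum>s<n i. poly_const (v (Suc i, r, s)) * neuron n d (\<lambda>i. x i + 0 * v i) i s
        + poly_const (x (Suc i, r, s)) * dneuron n d x v i s)"
    by (intro coeff_deriv_sum coeff_deriv_scale Suc)
  from coeff_deriv_power[OF this, of "d (Suc i)"] show ?case
    by (simp add: neuron.simps dneuron.simps preact_def)
qed

lemma coeff_deriv_preact:
  "coeff_deriv (\<lambda>\<tau>. preact n d (\<lambda>i. x i + \<tau> * v i) i r) (dpreact n d x v i r)"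
proof -
  have "coeff_deriv (\<lambda>\<tau>. \<Sum>s<n (i - 1). poly_const (x (i, r, s) + \<tau> * v (i, r, s)) *
        neuron n d (\<lambda>i. x i + \<tau> * v i) (i - 1) s)
     (\<Sum>s<n (i - 1). poly_const (v (i, r, s)) * neuron n d (\<lambda>i. x i + 0 * v i) (i - 1) s
        + poly_const (x (i, r, s)) * dneuron n d x v (i - 1) s)"
    by (intro coeff_deriv_sum coeff_deriv_scale coeff_deriv_neuron)
  then show ?thesis by (simp add: preact_def dpreact_def)
qed

lemma dneuron_eq_0:
  "(\<And>j r s. (j, r, s) \<in> weight_index n i \<Longrightarrow> v (j, r, s) = 0) \<Longrightarrow> r < n i \<Longrightarrow> dneuron n d x v i r = 0"
proof (induction i arbitrary: r)
  case (Suc i)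
  have "dneuron n d x v i s = 0" if "s < n i" for s
    using Suc.prems(1) that by (intro Suc.IH) (auto simp: weight_index_def)
  moreover have "v (Suc i, r, s) = 0" if "s < n i" for s
    using Suc.prems that by (auto simp: weight_index_def)
  ultimately show ?case by (simp add: dneuron.simps)
qed simp

context complex_subfield
begin

lemma forms_add: "p \<in> forms K m D \<Longrightarrow> q \<in> forms K m D \<Longrightarrow> p + q \<in> forms K m D"
  unfolding forms_def mem_Collect_eq lookup_add using keys_add[of p q] by blast

lemma dneuron_forms:
  assumes "range x \<subseteq> K" "range v \<subseteq> K" and d: "\<And>j. 1 \<le> j \<Longrightarrow> j \<le> i \<Longrightarrow> 1 \<le> d j"
  shows "r < n i \<Longrightarrow> dneuron n d x v i r \<in> forms K (n 0) (layer_degree d (Suc i))"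
  using d
proof (induction i arbitrary: r)
  case 0
  show ?case by (simp add: forms_def)
next
  case (Suc i)
  let ?s = "\<Sum>s<n i. poly_const (v (Suc i, r, s)) * neuron n d x i s + poly_const (x (Suc i, r, s)) * dneuron n d x v i s"
  have f: "poly_const (v (Suc i, r, s)) * neuron n d x i s \<in> forms K (n 0) (layer_degree d (Suc i))"
    "poly_const (x (Suc i, r, s)) * dneuron n d x v i s \<in> forms K (n 0) (layer_degree d (Suc i))" if "s < n i" for s
    using that Suc assms neuron_forms[OF assms(1), of s n i d] by (auto intro!: forms_scale)
  have "?s \<in> forms K (n 0) (layer_degree d (Suc i))"
    using f by (intro forms_sum[OF subfield] forms_add) auto
  moreover have "preact n d x (Suc i) r ^ (d (Suc i) - 1) \<in> forms K (n 0) ((d (Suc i) - 1) * layer_degree d (Suc i))"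
    by (intro forms_power[OF subfield] preact_forms assms) simp
  ultimately have "poly_const (of_nat (d (Suc i))) * (preact n d x (Suc i) r ^ (d (Suc i) - 1) * ?s)
      \<in> forms K (n 0) ((d (Suc i) - 1) * layer_degree d (Suc i) + layer_degree d (Suc i))"
    by (intro forms_scale forms_mult[OF subfield]) auto
  also have "(d (Suc i) - 1) * layer_degree d (Suc i) + layer_degree d (Suc i) = layer_degree d (Suc (Suc i))"
    using Suc.prems(2)[of "Suc i"] by (cases "d (Suc i)") (auto simp: layer_degree_Suc)
  finally show ?case by (simp add: dneuron.simps mult.assoc)
qed

lemma dpreact_forms:
  assumes "range x \<subseteq> K" "range v \<subseteq> K" "\<And>j. 1 \<le> j \<Longrightarrow> j < i \<Longrightarrow> 1 \<le> d j" "1 \<le> i"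
  shows "dpreact n d x v i r \<in> forms K (n 0) (layer_degree d i)"
  unfolding dpreact_def
proof (intro forms_sum[OF subfield] forms_add forms_scale)
  fix s assume "s \<in> {..<n (i - 1)}"
  then show "neuron n d x (i - 1) s \<in> forms K (n 0) (layer_degree d i)"
    "dneuron n d x v (i - 1) s \<in> forms K (n 0) (layer_degree d i)"
    using neuron_forms[OF assms(1), of s n "i - 1" d] dneuron_forms[OF assms(1,2), of "i - 1" d s n] assms
    by auto
qed (use assms in auto)

text \<open>The powers \<open>z ^ (d - 1)\<close> of the preactivations \<open>z\<close> of layer \<open>i\<close> are linearly independent over the
  forms of degree \<open>deg z\<close>. In particular \<open>q = z\<close> and the differentials of \<open>z\<close> may be inserted.\<close>

definition layer_independent :: "(nat \<Rightarrow> nat) \<Rightarrow> (nat \<Rightarrow> nat) \<Rightarrow> params \<Rightarrow> nat \<Rightarrow> bool" where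
  "layer_independent n d x i \<longleftrightarrow> (\<forall>q. (\<forall>r<n i. q r \<in> forms K (n 0) (layer_degree d i)) \<longrightarrow>
     (\<Sum>r<n i. preact n d x i r ^ (d i - 1) * q r) = 0 \<longrightarrow> (\<forall>r<n i. q r = 0))"

lemma poly_const_mult_eq_0: "poly_const c * p = 0 \<Longrightarrow> c = 0 \<or> p = 0"
proof -
  assume "poly_const c * p = 0"
  then have "c * lookup p t = 0" for t by (metis lookup_poly_const_mult lookup_zero)
  then show ?thesis by (metis lookup_zero mult_eq_0_iff poly_mapping_eqI)
qed

lemma exists_nonzero_form:
  assumes "0 < m" shows "\<exists>p\<in>forms K m D. p \<noteq> 0"
proof (rule bexI[of _ "single (single 0 D) 1"])
  show "single (single 0 D) 1 \<noteq> (0 :: nat cpoly)"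
    by (metis lookup_single_eq lookup_zero one_neq_zero)
  show "single (single 0 D) 1 \<in> forms K m D"
    using assms by (auto simp: forms_def monomials_of_degree_def lookup_single when_def)
qed

lemma layer_independent_nonzero:
  assumes ind: "layer_independent n d x i" and d: "2 \<le> d i" and n: "0 < n 0" and r: "r < n i"
  shows "preact n d x i r \<noteq> 0"
proof
  assume z: "preact n d x i r = 0"
  obtain p where p: "p \<in> forms K (n 0) (layer_degree d i)" "p \<noteq> 0" using exists_nonzero_form[OF n] by blast
  have "(\<Sum>s<n i. preact n d x i s ^ (d i - 1) * (if s = r then p else 0)) =
      (\<Sum>s<n i. if s = r then preact n d x i s ^ (d i - 1) * p else 0)"
    by (rule sum.cong) auto
  also have "\<dots> = 0" using r z d by (simp add: zero_power)
  finally have "(\<Sum>s<n i. preact n d x i s ^ (d i - 1) * (if s = r then p else 0)) = 0" .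
  moreover have "\<forall>s<n i. (if s = r then p else 0) \<in> forms K (n 0) (layer_degree d i)"
    using p by (simp add: forms_def)
  ultimately have "\<forall>s<n i. (if s = r then p else 0) = 0"
    using ind[unfolded layer_independent_def, rule_format, of "\<lambda>s. if s = r then p else 0"] by blast
  then show False using r p by auto
qed

text \<open>If the differential of every preactivation of layer \<open>i + 1\<close> is a multiple of that preactivation,
  independence of layer \<open>i\<close> forces each coefficient
  \<open>(v - c x) z + d x dz\<close> of \<open>z ^ (d - 1)\<close> to be zero. As \<open>x \<noteq> 0\<close>, the differentials \<open>dz\<close> of layer \<open>i\<close>
  are multiples of \<open>z\<close>, and the induction hypothesis makes \<open>v\<close> vanish up to layer \<open>i\<close>. Then \<open>dz = 0\<close>, so
  \<open>v = c x\<close> in layer \<open>i + 1\<close>; the first column, where \<open>v = 0\<close>, shows \<open>c = 0\<close>.\<close>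

lemma tangent_injective:
  assumes xK: "range x \<subseteq> K" and vK: "range v \<subseteq> K"
    and x: "\<And>j r s. (j, r, s) \<in> weight_index n L \<Longrightarrow> x (j, r, s) \<noteq> 0"
    and v0: "\<And>j r. v (j, r, 0) = 0"
    and ind: "\<And>j. 1 \<le> j \<Longrightarrow> j < L \<Longrightarrow> layer_independent n d x j"
    and d: "\<And>j. 1 \<le> j \<Longrightarrow> j < L \<Longrightarrow> 2 \<le> d j" and n: "\<And>j. j \<le> L \<Longrightarrow> 0 < n j"
  shows "1 \<le> i \<Longrightarrow> i \<le> L \<Longrightarrow> \<forall>r<n i. \<exists>c\<in>K. dpreact n d x v i r = poly_const c * preact n d x i r \<Longrightarrow>
    (j, r, s) \<in> weight_index n i \<Longrightarrow> v (j, r, s) = 0"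
proof (induction i arbitrary: j r s rule: nat_induct_at_least)
  case base
  have j: "j = 1" "r < n 1" "s < n 0" using base by (auto simp: weight_index_def)
  obtain c where "dpreact n d x v 1 r = poly_const c * preact n d x 1 r" using base j by auto
  then have sums: "(\<Sum>s<n 0. poly_const (v (1, r, s)) * poly_var s) =
      (\<Sum>s<n 0. poly_const (c * x (1, r, s)) * poly_var s)"
    by (simp add: dpreact_def preact_def sum_distrib_left poly_const_mult mult.assoc)
  have coeff: "lookup (\<Sum>s<n 0. poly_const (f s) * poly_var s) (single s 1) = f s"
    if "s < n 0" for f s
  proof -
    have "single s' (1::nat) = single s 1 \<longleftrightarrow> s' = s" for s'
      by (metis lookup_single_eq lookup_single_not_eq one_neq_zero)
    then have "lookup (\<Sum>s<n 0. poly_const (f s) * poly_var s) (single s 1) =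
        (\<Sum>s'<n 0. if s' = s then f s' else 0)"
      unfolding lookup_sum lookup_poly_const_mult poly_var_def lookup_single when_def
      by (intro sum.cong) auto
    then show ?thesis using that by simp
  qed
  have eq: "v (1, r, s) = c * x (1, r, s)" if "s < n 0" for s
    using coeff[OF that, of "\<lambda>s. v (1, r, s)"] coeff[OF that, of "\<lambda>s. c * x (1, r, s)"]
    unfolding sums by simp
  have "x (1, r, 0) \<noteq> 0" using x[of 1 r 0] n[of 0] j base by (auto simp: weight_index_def)
  then have "c = 0" using eq[of 0] v0 n[of 0] by auto
  then show ?case using eq j by simp
next
  case (Suc i)
  then have i: "1 \<le> i" "i < L" by auto
  note di = d[OF i]
  let ?z = "preact n d x i" and ?dz = "dpreact n d x v i"
  have main: "\<exists>c\<in>K. \<forall>s<n i. poly_const (v (Suc i, r, s) - c * x (Suc i, r, s)) * ?z s +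
      poly_const (x (Suc i, r, s) * of_nat (d i)) * ?dz s = 0" if r: "r < n (Suc i)" for r
  proof -
    obtain c where c: "c \<in> K" "dpreact n d x v (Suc i) r = poly_const c * preact n d x (Suc i) r"
      using Suc.prems(2) r by auto
    define q where "q = (\<lambda>s. poly_const (v (Suc i, r, s) - c * x (Suc i, r, s)) * ?z s +
      poly_const (x (Suc i, r, s) * of_nat (d i)) * ?dz s)"
    have pow: "?z s ^ d i = ?z s ^ (d i - 1) * ?z s" for s
      using di power_minus_mult[of "d i" "?z s"] by simp
    have ne: "neuron n d x i s = ?z s ^ d i"
      "dneuron n d x v i s = poly_const (of_nat (d i)) * ?z s ^ (d i - 1) * ?dz s" for s
      using i neuron_Suc[of n d x "i - 1" s] dneuron_Suc[of n d x v "i - 1" s] by auto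
    have diff: "poly_const (a - b) = poly_const a - poly_const b" for a b :: complex
      by (simp add: poly_const_def single_diff)
    have "(\<Sum>s<n i. ?z s ^ (d i - 1) * q s) = dpreact n d x v (Suc i) r - poly_const c * preact n d x (Suc i) r"
      unfolding dpreact_def preact_def[of n d x "Suc i"] sum_distrib_left sum_subtractf[symmetric]
      by (rule sum.cong) (simp_all add: q_def ne pow diff poly_const_mult algebra_simps)
    then have "(\<Sum>s<n i. ?z s ^ (d i - 1) * q s) = 0" using c by simp
    moreover have "q s \<in> forms K (n 0) (layer_degree d i)" for s
      unfolding q_def
    proof (intro forms_add forms_scale preact_forms dpreact_forms xK vK i)
      show "1 \<le> d j" if "1 \<le> j" "j < i" for j using d[of j] that i by linarith
    qed (use xK vK c in auto)
    ultimately have "\<forall>s<n i. q s = 0" using ind[OF i] unfolding layer_independent_def by blast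
    then show ?thesis using c unfolding q_def by blast
  qed
  have n_pos: "0 < n (Suc i)" "0 < n i" "0 < n 0" using n[of "Suc i"] n[of i] n[of 0] i by auto
  obtain c0 where c0: "c0 \<in> K" "\<And>s. s < n i \<Longrightarrow> poly_const (v (Suc i, 0, s) - c0 * x (Suc i, 0, s)) * ?z s +
      poly_const (x (Suc i, 0, s) * of_nat (d i)) * ?dz s = 0"
    using main[OF n_pos(1)] by blast
  have "\<exists>c\<in>K. ?dz s = poly_const c * ?z s" if s: "s < n i" for s
  proof
    let ?a = "v (Suc i, 0, s) - c0 * x (Suc i, 0, s)" and ?b = "x (Suc i, 0, s) * of_nat (d i)"
    have "x (Suc i, 0, s) \<noteq> 0" using x[of "Suc i" 0 s] s i n_pos by (auto simp: weight_index_def)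
    then have b: "?b \<noteq> 0" using di by simp
    show "- ?a / ?b \<in> K" using xK vK c0 by auto
    show "?dz s = poly_const (- ?a / ?b) * ?z s"
    proof (rule poly_mapping_eqI)
      fix t
      have "?a * lookup (?z s) t + ?b * lookup (?dz s) t = 0"
        using arg_cong[OF c0(2)[OF s], of "\<lambda>p. lookup p t"]
        by (simp only: lookup_add lookup_poly_const_mult lookup_zero)
      then show "lookup (?dz s) t = lookup (poly_const (- ?a / ?b) * ?z s) t"
        unfolding lookup_poly_const_mult using b by (simp add: field_simps add_eq_0_iff)
    qed
  qed
  then have v_low: "v (j, r, s) = 0" if "(j, r, s) \<in> weight_index n i" for j r s
    using Suc.IH[of j r s] that i by auto
  have dz0: "?dz s = 0" if "s < n i" for s
  proof -
    have "v (i, s, t) = 0" "dneuron n d x v (i - 1) t = 0" if "t < n (i - 1)" for t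
      using that \<open>s < n i\<close> i v_low by (auto intro!: dneuron_eq_0 simp: weight_index_def)
    then show ?thesis by (simp add: dpreact_def)
  qed
  show ?case
  proof (cases "j \<le> i")
    case True
    then show ?thesis using v_low Suc.prems(3) by (auto simp: weight_index_def)
  next
    case False
    then have "j = Suc i" using Suc.prems(3) by (auto simp: weight_index_def)
    then have j: "j = Suc i" "r < n (Suc i)" "s < n i" using Suc.prems(3) by (auto simp: weight_index_def)
    obtain c where "\<forall>s<n i. poly_const (v (Suc i, r, s) - c * x (Suc i, r, s)) * ?z s +
      poly_const (x (Suc i, r, s) * of_nat (d i)) * ?dz s = 0" using main[OF j(2)] by blast
    then have eq: "v (Suc i, r, s) = c * x (Suc i, r, s)" if "s < n i" for s
      using that dz0[OF that] layer_independent_nonzero[where r = s, OF ind[OF i] di n_pos(3) that]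
        poly_const_mult_eq_0[of "v (Suc i, r, s) - c * x (Suc i, r, s)" "?z s"] by auto
    have "x (Suc i, r, 0) \<noteq> 0" using x[of "Suc i" r 0] i j n_pos by (auto simp: weight_index_def)
    then have "c = 0" using eq[OF n_pos(2)] v0 by simp
    then show ?thesis using eq j by simp
  qed
qed

end

section \<open>Confluent Vandermonde systems\<close>

text \<open>A power-sum system holds with the powers replaced by any polynomial of bounded degree; Vandermonde
  systems are then solved by inserting polynomials with prescribed zeros.\<close>

lemma sum_poly_eq_0:
  fixes b \<alpha> :: "nat \<Rightarrow> complex"
  assumes "\<And>s. s \<le> p \<Longrightarrow> (\<Sum>j<N. b j ^ s * \<alpha> j) = 0" and "degree P \<le> p"
  shows "(\<Sum>j<N. poly P (b j) * \<alpha> j) = 0"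
proof -
  have "poly P x = (\<Sum>s\<le>p. poly.coeff P s * x ^ s)" for x
    using arg_cong[OF poly_as_sum_of_monoms'[OF assms(2)], of "\<lambda>P. poly P x"]
    by (simp add: poly_sum poly_monom)
  then have "(\<Sum>j<N. poly P (b j) * \<alpha> j) = (\<Sum>j<N. \<Sum>s\<le>p. poly.coeff P s * (b j ^ s * \<alpha> j))"
    by (simp add: sum_distrib_right mult.assoc)
  also have "\<dots> = (\<Sum>s\<le>p. poly.coeff P s * (\<Sum>j<N. b j ^ s * \<alpha> j))"
    by (subst sum.swap) (simp add: sum_distrib_left)
  also have "\<dots> = 0" using assms(1) by simp
  finally show ?thesis .
qed

lemma vandermonde:
  fixes b \<alpha> :: "nat \<Rightarrow> complex"
  assumes b: "inj_on b {..<N}" and eq: "\<And>s. s < N \<Longrightarrow> (\<Sum>j<N. b j ^ s * \<alpha> j) = 0" and j: "j < N"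
  shows "\<alpha> j = 0"
proof -
  define P where "P = (\<Prod>i\<in>{..<N} - {j}. [:- b i, 1:])"
  have "degree P \<le> (\<Sum>i\<in>{..<N} - {j}. degree [:- b i, 1:])"
    unfolding P_def by (rule degree_prod_sum_le[unfolded comp_def]) simp
  also have "\<dots> = N - 1" using j by simp
  finally have "degree P \<le> N - 1" .
  then have "(\<Sum>i<N. poly P (b i) * \<alpha> i) = 0" using eq j by (intro sum_poly_eq_0[of "N - 1"]) auto
  moreover have "(\<Sum>i<N. poly P (b i) * \<alpha> i) = (\<Sum>i<N. if i = j then poly P (b j) * \<alpha> j else 0)"
    by (rule sum.cong) (auto simp: P_def poly_prod)
  ultimately have "poly P (b j) * \<alpha> j = 0" using j by simp
  moreover have "poly P (b j) \<noteq> 0"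
    using b j by (auto simp: P_def poly_prod inj_on_def)
  ultimately show ?thesis by simp
qed

text \<open>The equations say that \<open>\<alpha> i * (\<delta> P - T P')(b i) + \<beta> i * P'(b i)\<close> sums to zero for all polynomials \<open>P\<close>
  of degree at most \<open>\<delta>\<close>. With \<open>Q\<close> the product of the \<open>T - b i\<close> for \<open>i \<noteq> j\<close>, the choices
  \<open>P = (T - b j) Q\<^sup>2\<close> and \<open>P = Q\<^sup>2\<close>, of degrees \<open>2 N - 1\<close> and \<open>2 N - 2\<close>, isolate the index \<open>j\<close>.\<close>

lemma confluent_vandermonde:
  fixes b \<alpha> \<beta> :: "nat \<Rightarrow> complex"
  assumes b: "inj_on b {..<N}" and \<delta>: "2 * N - 1 \<le> \<delta>"
    and eq: "\<And>s. s \<le> \<delta> \<Longrightarrow> (\<Sum>j<N. of_nat (\<delta> - s) * b j ^ s * \<alpha> j + of_nat s * b j ^ (s - 1) * \<beta> j) = 0"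
    and j: "j < N"
  shows "\<alpha> j = 0 \<and> \<beta> j = 0"
proof -
  have key: "(\<Sum>i<N. (of_nat \<delta> * poly P (b i) - b i * poly (pderiv P) (b i)) * \<alpha> i + poly (pderiv P) (b i) * \<beta> i) = 0"
    if "degree P \<le> \<delta>" for P
  proof -
    let ?c = "poly.coeff P"
    have P: "poly P x = (\<Sum>s\<le>\<delta>. ?c s * x ^ s)" for x
      using arg_cong[OF poly_as_sum_of_monoms'[OF that], of "\<lambda>P. poly P x"]
      by (simp add: poly_sum poly_monom)
    have P': "poly (pderiv P) x = (\<Sum>s\<le>\<delta>. ?c s * (of_nat s * x ^ (s - 1)))" for x
      using arg_cong[OF poly_as_sum_of_monoms'[OF that], of "\<lambda>P. poly (pderiv P) x"]
      by (simp add: poly_sum poly_monom higher_pderiv_sum[of 1, simplified] pderiv_monom mult_ac)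
    have xs: "x * (of_nat s * x ^ (s - 1)) = of_nat s * x ^ s" for x :: complex and s
      by (cases s) auto
    have "(of_nat \<delta> * poly P x - x * poly (pderiv P) x) * a + poly (pderiv P) x * a' =
        (\<Sum>s\<le>\<delta>. ?c s * (of_nat (\<delta> - s) * x ^ s * a + of_nat s * x ^ (s - 1) * a'))" for x a a'
    proof -
      have "x * poly (pderiv P) x = (\<Sum>s\<le>\<delta>. ?c s * (x * (of_nat s * x ^ (s - 1))))"
        unfolding P' sum_distrib_left by (simp add: mult_ac)
      then have "of_nat \<delta> * poly P x - x * poly (pderiv P) x = (\<Sum>s\<le>\<delta>. ?c s * (of_nat \<delta> * x ^ s - of_nat s * x ^ s))"
        unfolding P xs by (simp add: sum_distrib_left sum_subtractf[symmetric] algebra_simps)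
      also have "\<dots> = (\<Sum>s\<le>\<delta>. ?c s * (of_nat (\<delta> - s) * x ^ s))"
        by (rule sum.cong) (auto simp: of_nat_diff algebra_simps)
      finally have E: "of_nat \<delta> * poly P x - x * poly (pderiv P) x = \<dots>" .
      show ?thesis
        unfolding E unfolding P' by (simp only: sum_distrib_right sum.distrib[symmetric] distrib_left mult.assoc)
    qed
    then have "(\<Sum>i<N. (of_nat \<delta> * poly P (b i) - b i * poly (pderiv P) (b i)) * \<alpha> i + poly (pderiv P) (b i) * \<beta> i) =
        (\<Sum>s\<le>\<delta>. ?c s * (\<Sum>i<N. of_nat (\<delta> - s) * b i ^ s * \<alpha> i + of_nat s * b i ^ (s - 1) * \<beta> i))"
      by (simp add: sum_distrib_left sum.swap[of _ "{..<N}" "{..\<delta>}"])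
    also have "\<dots> = 0" using eq by simp
    finally show ?thesis .
  qed
  define Q where "Q = (\<Prod>i\<in>{..<N} - {j}. [:- b i, 1:])"
  define R where "R = [:- b j, 1:]"
  have "degree Q \<le> (\<Sum>i\<in>{..<N} - {j}. degree [:- b i, 1:])"
    unfolding Q_def by (rule degree_prod_sum_le[unfolded comp_def]) simp
  also have "\<dots> = N - 1" using j by simp
  finally have degQ: "degree Q \<le> N - 1" .
  have degQ2: "degree (Q * Q) \<le> 2 * N - 2" using degree_mult_le[of Q Q] degQ by simp
  have degQ2R: "degree (R * (Q * Q)) \<le> 2 * N - 1"
    using degree_mult_le[of R "Q * Q"] degQ2 j by (simp add: R_def)
  have Q0: "poly Q (b i) = 0" if "i < N" "i \<noteq> j" for i using that by (auto simp: Q_def poly_prod)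
  have Qj: "poly Q (b j) \<noteq> 0" using b j by (auto simp: Q_def poly_prod inj_on_def)
  have R: "poly R x = x - b j" "pderiv R = 1" for x
    by (simp_all add: R_def pderiv_pCons)
  have "(\<Sum>i<N. if i = j then poly (Q * Q) (b j) * (\<beta> j - b j * \<alpha> j) else 0) =
      (\<Sum>i<N. (of_nat \<delta> * poly (R * (Q * Q)) (b i) - b i * poly (pderiv (R * (Q * Q))) (b i)) * \<alpha> i
        + poly (pderiv (R * (Q * Q))) (b i) * \<beta> i)"
    by (rule sum.cong) (auto simp: Q0 R pderiv_mult algebra_simps)
  also have "\<dots> = 0" using degQ2R \<delta> by (intro key) simp
  finally have "poly (Q * Q) (b j) * (\<beta> j - b j * \<alpha> j) = 0" using j by simp
  then have 1: "\<beta> j = b j * \<alpha> j" using j Qj by simp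
  have "(\<Sum>i<N. if i = j then (of_nat \<delta> * poly (Q * Q) (b j) - b j * poly (pderiv (Q * Q)) (b j)) * \<alpha> j
      + poly (pderiv (Q * Q)) (b j) * \<beta> j else 0) =
      (\<Sum>i<N. (of_nat \<delta> * poly (Q * Q) (b i) - b i * poly (pderiv (Q * Q)) (b i)) * \<alpha> i
        + poly (pderiv (Q * Q)) (b i) * \<beta> i)"
    by (rule sum.cong) (auto simp: Q0 pderiv_mult)
  also have "\<dots> = 0" using degQ2 \<delta> by (intro key) simp
  finally have "(of_nat \<delta> * poly (Q * Q) (b j) - b j * poly (pderiv (Q * Q)) (b j)) * \<alpha> j
      + poly (pderiv (Q * Q)) (b j) * \<beta> j = 0" using j by simp
  then have "of_nat \<delta> * poly (Q * Q) (b j) * \<alpha> j = 0" unfolding 1 by (simp only: algebra_simps) simp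
  moreover have "of_nat \<delta> \<noteq> (0 :: complex)" using \<delta> j by simp
  ultimately have "\<alpha> j = 0" using Qj by simp
  with 1 show ?thesis by simp
qed

section \<open>Powers of binomial forms\<close>

lemma lookup_single_times:
  fixes q :: "'v cpoly"
  shows "lookup (single a c * q) (a + u) = c * lookup q u"
proof -
  have "lookup (single a c * q) (a + u) =
      (\<Sum>x\<in>{(x, y). x + y = a + u}. if x = (a, u) then c * lookup q u else 0)"
    unfolding lookup_times by (rule sum.cong) (auto simp: lookup_single when_def split: if_splits)
  then show ?thesis using finite_decompositions[of "a + u"] by simp
qed

lemma lookup_single_times_eq_0:
  fixes q :: "'v cpoly"
  assumes "\<And>u. t \<noteq> a + u"
  shows "lookup (single a c * q) t = 0"
  unfolding lookup_times by (rule sum.neutral) (use assms in \<open>auto simp: lookup_single when_def\<close>)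

lemma poly_var_power: "poly_var v ^ e = single (single v e) 1"
proof (induction e)
  case 0
  show ?case by simp
next
  case (Suc e)
  then show ?case by (simp add: poly_var_def mult_single single_add[symmetric])
qed

text \<open>The monomial \<open>x ^ a * y ^ b\<close> in the first two variables \<open>x\<close> and \<open>y\<close>.\<close>

definition bin_monomial :: "nat \<Rightarrow> nat \<Rightarrow> nat monomial" where
  "bin_monomial a b = single 0 a + single 1 b"

lemma lookup_bin_monomial:
  "lookup (bin_monomial a b) 0 = a" "lookup (bin_monomial a b) 1 = b"
  "lookup (bin_monomial a b) (Suc 0) = b"
  by (simp_all add: bin_monomial_def lookup_add lookup_single)

lemma bin_monomial_add: "bin_monomial a b + bin_monomial a' b' = bin_monomial (a + a') (b + b')"
  by (simp add: bin_monomial_def single_add ac_simps)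

lemma binomial_form_power:
  "(poly_var 0 ^ e + poly_const b * poly_var 1 ^ e) ^ p =
     (\<Sum>s\<le>p. single (bin_monomial (e * (p - s)) (e * s)) (of_nat (p choose s) * b ^ s))"
proof -
  have c: "poly_const b ^ s = poly_const (b ^ s)" for s
    by (induction s) (simp_all add: poly_const_mult)
  have X: "(poly_var v ^ e) ^ s = single (single v (e * s)) 1" for v :: nat and s
    by (subst power_mult[symmetric]) (rule poly_var_power)
  have "of_nat (p choose s) * (poly_const b * poly_var 1 ^ e) ^ s * (poly_var 0 ^ e) ^ (p - s) =
      single (bin_monomial (e * (p - s)) (e * s)) (of_nat (p choose s) * b ^ s)" for s
    unfolding power_mult_distrib c X poly_const_of_nat[symmetric]
    by (simp add: poly_const_def mult_single bin_monomial_def add.commute del: single_of_nat)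
  then show ?thesis
    by (subst add.commute) (simp add: binomial_ring)
qed

lemma lookup_binomial_form_power_times:
  "lookup ((poly_var 0 ^ e + poly_const b * poly_var 1 ^ e) ^ p * q) t =
     (\<Sum>s\<le>p. of_nat (p choose s) * b ^ s *
        lookup (single (bin_monomial (e * (p - s)) (e * s)) 1 * q) t)"
proof -
  have "single \<mu> c * q = poly_const c * (single \<mu> 1 * q)" for \<mu> c
    by (simp add: poly_const_def mult_single mult.assoc[symmetric])
  then show ?thesis
    unfolding binomial_form_power sum_distrib_right lookup_sum
    by (metis (no_types, lifting) lookup_poly_const_mult)
qed

lemma choose_mult_pred: "Suc p * (p choose s) = (Suc p - s) * (Suc p choose s)"
  using binomial_absorb_comp[of "Suc p" s] by simp

context complex_subfield
begin

lemma forms_monomial_cases: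
  assumes q: "q \<in> forms K m e" and u: "lookup q u \<noteq> 0"
  shows "u = bin_monomial e 0 \<or> u = bin_monomial 0 e \<or>
    (lookup u 0 < e \<and> lookup u 1 < e)"
proof -
  have sum: "(\<Sum>i\<in>keys u. lookup u i) = e"
    using q u by (auto simp: forms_def monomials_of_degree_def in_keys_iff)
  have "u = single i e" if "e \<le> lookup u i" for i
  proof (rule poly_mapping_eqI)
    fix j
    let ?l = "lookup u"
    have "sum ?l {i, j} \<le> sum ?l (insert i (insert j (keys u)))"
      by (intro sum_mono2) auto
    also have "\<dots> = sum ?l (keys u)"
      by (rule sum.mono_neutral_right) (auto simp: in_keys_iff)
    finally have "sum ?l {i, j} \<le> e" using sum by simp
    then show "?l j = lookup (single i e) j"
      using that by (cases "i = j") (auto simp: lookup_single)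
  qed
  from this[of 0] this[of 1] show ?thesis
    by (fastforce simp: bin_monomial_def not_le)
qed

text \<open>With \<open>X = x ^ e\<close> and \<open>Y = y ^ e\<close>, the polynomial ring is free over the polynomials in \<open>X\<close> and \<open>Y\<close>, with
  basis the monomials \<open>u\<close> of degrees less than \<open>e\<close> in \<open>x\<close> and in \<open>y\<close>. A form of degree \<open>e\<close> is
  \<open>\<alpha> X + \<beta> Y\<close> plus a combination of such \<open>u\<close>, so the relation splits: each \<open>u\<close> gives an ordinary
  Vandermonde system (\<open>mixed\<close>), and \<open>X\<close> and \<open>Y\<close> together give the confluent one (\<open>pure\<close>).\<close>

lemma powers_of_binomial_forms_independent:
  assumes b: "inj_on b {..<N}" and \<delta>: "2 * N - 1 \<le> \<delta>" and e: "1 \<le> e"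
    and q: "\<And>j. j < N \<Longrightarrow> q j \<in> forms K m e"
    and rel: "(\<Sum>j<N. (poly_var 0 ^ e + poly_const (b j) * poly_var 1 ^ e) ^ (\<delta> - 1) * q j) = 0"
    and j: "j < N"
  shows "q j = 0"
proof -
  define p where "p = \<delta> - 1"
  have p: "\<delta> = Suc p" "N \<le> Suc p" using \<delta> j by (auto simp: p_def)
  let ?\<mu> = "\<lambda>s. bin_monomial (e * (p - s)) (e * s)"
  let ?l = "\<lambda>i. lookup (q i)"
  have coeff: "(\<Sum>i<N. \<Sum>s\<le>p. of_nat (p choose s) * b i ^ s *
      lookup (single (?\<mu> s) 1 * q i) t) = 0" for t
    using arg_cong[OF rel, of "\<lambda>f. lookup f t"]
    unfolding lookup_sum lookup_binomial_form_power_times p_def[symmetric] by simp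
  have mixed: "?l i u = 0" if u: "lookup u 0 < e" "lookup u 1 < e" and i: "i < N" for u i
  proof (rule vandermonde[OF b _ i])
    fix s0 assume "s0 < N"
    then have s0: "s0 \<le> p" using p by simp
    have zero: "lookup (single (?\<mu> s) 1 * q i) (?\<mu> s0 + u) = 0"
      if s: "s \<le> p" "s \<noteq> s0" for s i
    proof (rule lookup_single_times_eq_0)
      fix w
      show "?\<mu> s0 + u \<noteq> ?\<mu> s + w"
      proof
        assume eq: "?\<mu> s0 + u = ?\<mu> s + w"
        have eq0: "e * (p - s0) + lookup u 0 = e * (p - s) + lookup w 0"
          using arg_cong[OF eq, of "\<lambda>t. lookup t 0"] by (simp add: lookup_add lookup_bin_monomial)
        have eq1: "e * s0 + lookup u 1 = e * s + lookup w 1"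
          using arg_cong[OF eq, of "\<lambda>t. lookup t 1"] by (simp add: lookup_add lookup_bin_monomial)
        show False
        proof (cases "s < s0")
          case True
          then have "e * Suc (p - s0) \<le> e * (p - s)" using s s0 by (intro mult_le_mono2) simp
          then show False using eq0 u(1) by simp
        next
          case False
          then have "e * Suc s0 \<le> e * s" using s by (intro mult_le_mono2) simp
          then show False using eq1 u(2) by simp
        qed
      qed
    qed
    have "(\<Sum>s\<le>p. of_nat (p choose s) * b i ^ s * lookup (single (?\<mu> s) 1 * q i) (?\<mu> s0 + u)) =
        (\<Sum>s\<le>p. if s = s0 then of_nat (p choose s0) * (b i ^ s0 * ?l i u) else 0)" for i
      by (rule sum.cong) (auto simp: zero lookup_single_times)
    then have "of_nat (p choose s0) * (\<Sum>i<N. b i ^ s0 * ?l i u) = 0"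
      using coeff[of "?\<mu> s0 + u"] s0 by (simp add: sum_distrib_left)
    then show "(\<Sum>i<N. b i ^ s0 * ?l i u) = 0" using s0 by simp
  qed
  have pure: "?l i (bin_monomial e 0) = 0 \<and> ?l i (bin_monomial 0 e) = 0" if i: "i < N" for i
  proof (rule confluent_vandermonde[OF b \<delta> _ i])
    fix s0 assume s0: "s0 \<le> \<delta>"
    let ?t = "bin_monomial (e * (\<delta> - s0)) (e * s0)"
    have first: "?t = ?\<mu> s0 + bin_monomial e 0" if "s0 \<le> p"
      using that p by (simp add: bin_monomial_add Suc_diff_le add.commute)
    have second: "?t = ?\<mu> (s0 - 1) + bin_monomial 0 e" if "1 \<le> s0"
      using that p s0 by (cases s0) (simp_all add: bin_monomial_add add.commute)
    have zero: "lookup (single (?\<mu> s) 1 * q i) ?t = 0"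
      if s: "s \<le> p" "s \<noteq> s0" "Suc s \<noteq> s0" for s i
    proof (rule lookup_single_times_eq_0)
      fix w
      show "?t \<noteq> ?\<mu> s + w"
      proof
        assume eq: "?t = ?\<mu> s + w"
        have eq0: "e * (\<delta> - s0) = e * (p - s) + lookup w 0"
          using arg_cong[OF eq, of "\<lambda>t. lookup t 0"] by (simp add: lookup_add lookup_bin_monomial)
        have eq1: "e * s0 = e * s + lookup w 1"
          using arg_cong[OF eq, of "\<lambda>t. lookup t 1"] by (simp add: lookup_add lookup_bin_monomial)
        show False
        proof (cases "s < s0")
          case True
          then have "Suc (\<delta> - s0) \<le> p - s" using s s0 p by simp
          then have "e * Suc (\<delta> - s0) \<le> e * (p - s)" by (intro mult_le_mono2)
          then show False using eq0 e by simp
        next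
          case False
          then have "e * Suc s0 \<le> e * s" using s by (intro mult_le_mono2) simp
          then show False using eq1 e by simp
        qed
      qed
    qed
    have coeff_t: "of_nat \<delta> * (\<Sum>s\<le>p. of_nat (p choose s) * b i ^ s * lookup (single (?\<mu> s) 1 * q i) ?t) =
        of_nat (\<delta> choose s0) * (of_nat (\<delta> - s0) * b i ^ s0 * ?l i (bin_monomial e 0)
          + of_nat s0 * b i ^ (s0 - 1) * ?l i (bin_monomial 0 e))" for i
    proof -
      let ?T = "\<lambda>s. of_nat (p choose s) * b i ^ s * lookup (single (?\<mu> s) 1 * q i) ?t"
      have "(\<Sum>s\<le>p. ?T s) = (\<Sum>s\<le>p. (if s = s0 then ?T s0 else 0) + (if Suc s = s0 then ?T (s0 - 1) else 0))"
        by (rule sum.cong) (auto simp: zero)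
      also have "\<dots> = (if s0 \<le> p then ?T s0 else 0) + (if 1 \<le> s0 then ?T (s0 - 1) else 0)"
      proof -
        have "(\<Sum>s\<le>p. if Suc s = s0 then ?T (s0 - 1) else 0) = (if 1 \<le> s0 then ?T (s0 - 1) else 0)"
          using s0 p by (cases s0) auto
        then show ?thesis by (simp add: sum.distrib)
      qed
      also have "of_nat \<delta> * \<dots> = of_nat (\<delta> choose s0) * (of_nat (\<delta> - s0) * b i ^ s0 * ?l i (bin_monomial e 0))
          + of_nat (\<delta> choose s0) * (of_nat s0 * b i ^ (s0 - 1) * ?l i (bin_monomial 0 e))"
      proof -
        have 1: "of_nat \<delta> * (if s0 \<le> p then ?T s0 else 0) =
            of_nat (\<delta> choose s0) * (of_nat (\<delta> - s0) * b i ^ s0 * ?l i (bin_monomial e 0))"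
        proof (cases "s0 \<le> p")
          case True
          have c: "of_nat \<delta> * of_nat (p choose s0) = (of_nat (\<delta> - s0) * of_nat (\<delta> choose s0) :: complex)"
            using choose_mult_pred[of p s0] unfolding p(1) of_nat_mult[symmetric] by simp
          have "?T s0 = of_nat (p choose s0) * (b i ^ s0 * ?l i (bin_monomial e 0))"
            unfolding first[OF True] lookup_single_times by simp
          then have "of_nat \<delta> * ?T s0 = (of_nat \<delta> * of_nat (p choose s0)) * (b i ^ s0 * ?l i (bin_monomial e 0))"
            by (simp only: mult.assoc)
          then show ?thesis using True unfolding c by (simp add: mult_ac)
        next
          case False
          then show ?thesis using p by simp
        qed
        have 2: "of_nat \<delta> * (if 1 \<le> s0 then ?T (s0 - 1) else 0) =
            of_nat (\<delta> choose s0) * (of_nat s0 * b i ^ (s0 - 1) * ?l i (bin_monomial 0 e))"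
        proof (cases "1 \<le> s0")
          case True
          then obtain s' where s': "s0 = Suc s'" by (cases s0) auto
          have c: "of_nat \<delta> * of_nat (p choose (s0 - 1)) = (of_nat s0 * of_nat (\<delta> choose s0) :: complex)"
            using Suc_times_binomial_eq[of p s'] unfolding p(1) of_nat_mult[symmetric] s' by (simp add: mult.commute)
          have "?T (s0 - 1) = of_nat (p choose (s0 - 1)) * (b i ^ (s0 - 1) * ?l i (bin_monomial 0 e))"
            unfolding second[OF True] lookup_single_times by simp
          then have "of_nat \<delta> * ?T (s0 - 1) =
              (of_nat \<delta> * of_nat (p choose (s0 - 1))) * (b i ^ (s0 - 1) * ?l i (bin_monomial 0 e))"
            by (simp only: mult.assoc)
          then show ?thesis using True unfolding c by (simp add: mult_ac)
        next
          case False
          then show ?thesis by simp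
        qed
        show ?thesis unfolding distrib_left 1 2 ..
      qed
      finally show ?thesis by (simp only: distrib_left)
    qed
    have "of_nat (\<delta> choose s0) * (\<Sum>i<N. of_nat (\<delta> - s0) * b i ^ s0 * ?l i (bin_monomial e 0)
          + of_nat s0 * b i ^ (s0 - 1) * ?l i (bin_monomial 0 e)) =
        (\<Sum>i<N. of_nat \<delta> * (\<Sum>s\<le>p. of_nat (p choose s) * b i ^ s * lookup (single (?\<mu> s) 1 * q i) ?t))"
      unfolding coeff_t by (rule sum_distrib_left)
    also have "\<dots> = 0" unfolding sum_distrib_left[symmetric] coeff by simp
    finally show "(\<Sum>i<N. of_nat (\<delta> - s0) * b i ^ s0 * ?l i (bin_monomial e 0)
          + of_nat s0 * b i ^ (s0 - 1) * ?l i (bin_monomial 0 e)) = 0"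
      using s0 by simp
  qed
  have "?l j u = 0" for u
    using forms_monomial_cases[OF q[OF j], of u] mixed[of u j] pure[OF j] j by blast
  then show ?thesis by (intro poly_mapping_eqI) simp
qed

end

section \<open>Generic weights\<close>

lemma finite_monomials_of_degree: "finite (monomials_of_degree m D)"
proof (rule finite_imageD)
  let ?f = "\<lambda>t :: nat monomial. restrict (lookup t) {..<m}"
  have le: "lookup t i \<le> D" if "t \<in> monomials_of_degree m D" for t i
  proof (cases "i \<in> keys t")
    case True
    then have "lookup t i \<le> (\<Sum>i\<in>keys t. lookup t i)"
      by (intro member_le_sum) auto
    then show ?thesis using that by (simp add: monomials_of_degree_def)
  qed (simp add: in_keys_iff)
  then have "?f ` monomials_of_degree m D \<subseteq> Pi\<^sub>E {..<m} (\<lambda>_. {..D})"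
    by (intro image_subsetI) (simp only: restrict_PiE_iff atMost_iff, blast)
  then show "finite (?f ` monomials_of_degree m D)" by (rule finite_subset) (intro finite_PiE, auto)
  show "inj_on ?f (monomials_of_degree m D)"
  proof (rule inj_onI, rule poly_mapping_eqI)
    fix t u i
    assume tu: "t \<in> monomials_of_degree m D" "u \<in> monomials_of_degree m D" and eq: "?f t = ?f u"
    show "lookup t i = lookup u i"
    proof (cases "i < m")
      case True
      then show ?thesis using fun_cong[OF eq, of i] by simp
    next
      case False
      then have "i \<notin> keys t" "i \<notin> keys u"
        using tu by (auto simp: monomials_of_degree_def)
      then show ?thesis by (simp add: in_keys_iff)
    qed
  qed
qed

context network_setup
begin

text \<open>The matrix of the linear map in the definition of \<open>layer_independent\<close>, with respect to monomials.\<close>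

definition layer_matrix :: "params \<Rightarrow> nat \<Rightarrow> nat monomial \<Rightarrow> nat \<times> nat monomial \<Rightarrow> complex" where
  "layer_matrix x i t = (\<lambda>(r, u). lookup (preact n d x i r ^ (d i - 1) * single u 1) t)"

abbreviation "layer_cols i \<equiv> {..<n i} \<times> monomials_of_degree (n 0) (layer_degree d i)"

lemma layer_matrix_sum:
  "(\<Sum>c\<in>layer_cols i. layer_matrix x i t c * v c) =
     lookup (\<Sum>r<n i. preact n d x i r ^ (d i - 1) *
       (\<Sum>u\<in>monomials_of_degree (n 0) (layer_degree d i). single u (v (r, u)))) t"
proof -
  have eq: "p * single u c = poly_const c * (p * single u 1)" for p :: "nat cpoly" and u c
  proof -
    have "single u c = poly_const c * single u 1"
      by (simp add: poly_const_def mult_single)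
    then show ?thesis by (simp add: mult_ac)
  qed
  have scale: "lookup (p * single u c) t =
      lookup (p * single u 1) t * c" for p :: "nat cpoly" and u c
    unfolding eq[of p u c] lookup_poly_const_mult by (rule mult.commute)
  show ?thesis
    unfolding lookup_sum sum_distrib_left sum.cartesian_product'
    by (intro sum.cong refl) (simp only: layer_matrix_def prod.case scale[symmetric])
qed

lemma layer_independent_iff: "layer_independent n d x i \<longleftrightarrow> trivial_kernel UNIV (layer_cols i) (layer_matrix x i)"
proof
  assume ind: "layer_independent n d x i"
  show "trivial_kernel UNIV (layer_cols i) (layer_matrix x i)"
    unfolding trivial_kernel_def
  proof (intro allI impI)
    fix v :: "nat \<times> nat monomial \<Rightarrow> complex"
    assume v: "\<forall>c. v c \<in> K" "\<forall>t\<in>UNIV. (\<Sum>c\<in>layer_cols i. layer_matrix x i t c * v c) = 0"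
    let ?B = "monomials_of_degree (n 0) (layer_degree d i)"
    define q where "q = (\<lambda>r. \<Sum>u\<in>?B. single u (v (r, u)))"
    have "(\<Sum>r<n i. preact n d x i r ^ (d i - 1) * q r) = 0"
      using v(2) unfolding layer_matrix_sum q_def by (intro poly_mapping_eqI) simp
    moreover have "q r \<in> forms K (n 0) (layer_degree d i)" for r
      unfolding q_def using v(1) by (intro forms_sum[OF subfield]) (auto simp: forms_def lookup_single when_def)
    ultimately have q0: "\<forall>r<n i. q r = 0" using ind unfolding layer_independent_def by blast
    show "\<forall>c\<in>layer_cols i. v c = 0"
    proof
      fix c assume "c \<in> layer_cols i"
      then obtain r u where c: "c = (r, u)" "r < n i" "u \<in> ?B" by auto
      have "lookup (q r) u = v (r, u)"
        using c finite_monomials_of_degree by (simp add: q_def lookup_sum lookup_single when_def)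
      then show "v c = 0" using q0 c by simp
    qed
  qed
next
  assume ker: "trivial_kernel UNIV (layer_cols i) (layer_matrix x i)"
  show "layer_independent n d x i"
    unfolding layer_independent_def
  proof (intro allI impI)
    fix q r
    assume q: "\<forall>r<n i. q r \<in> forms K (n 0) (layer_degree d i)"
      and rel: "(\<Sum>r<n i. preact n d x i r ^ (d i - 1) * q r) = 0" and r: "r < n i"
    let ?B = "monomials_of_degree (n 0) (layer_degree d i)"
    define v where "v = (\<lambda>(r, u). if r < n i then lookup (q r) u else 0)"
    have q_eq: "q r = (\<Sum>u\<in>?B. single u (v (r, u)))" if "r < n i" for r
    proof (rule poly_mapping_eqI)
      fix t
      have "t \<notin> ?B \<Longrightarrow> lookup (q r) t = 0"
        using q that by (auto simp: forms_def in_keys_iff subset_iff)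
      then show "lookup (q r) t = lookup (\<Sum>u\<in>?B. single u (v (r, u))) t"
        using that finite_monomials_of_degree by (auto simp: v_def lookup_sum lookup_single when_def)
    qed
    have "v c \<in> K" for c using q by (cases c) (auto simp: v_def forms_def)
    moreover have "(\<Sum>c\<in>layer_cols i. layer_matrix x i t c * v c) = 0" for t
      unfolding layer_matrix_sum using rel q_eq by simp
    ultimately have "v c = 0" if "c \<in> layer_cols i" for c
      using trivial_kernelD[OF ker, of v c] that by blast
    then have "q r = (\<Sum>u\<in>?B. single u 0)"
      unfolding q_eq[OF r] using r by (intro sum.cong) auto
    then show "q r = 0" by simp
  qed
qed

lemma layer_independent_open:
  assumes i: "1 \<le> i" "i \<le> L" and x0: "range x0 \<subseteq> K" "layer_independent n d x0 i"
  shows "\<exists>h\<in>polyfun K weight_set. h x0 \<noteq> 0 \<and>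
    (\<forall>x. range x \<subseteq> K \<longrightarrow> h x \<noteq> 0 \<longrightarrow> layer_independent n d x i)"
  unfolding layer_independent_iff
proof (rule trivial_kernel_open)
  show "finite (layer_cols i)" using finite_monomials_of_degree by simp
  fix t c assume "c \<in> layer_cols i"
  then obtain r u where c: "c = (r, u)" "r < n i" by auto
  have "polyfun_coeffs weight_set (\<lambda>x. preact n d x i r ^ (d i - 1) * single u 1)"
    using c i by (intro polyfun_coeffs_mult polyfun_coeffs_power polyfun_coeffs_preact polyfun_coeffs_const)
      (auto simp: lookup_single when_def)
  then show "(\<lambda>x. layer_matrix x i t c) \<in> polyfun K weight_set"
    by (simp add: layer_matrix_def c polyfun_coeffs_def)
qed (use x0 layer_independent_iff in auto)

text \<open>Below layer \<open>i\<close> the first two neurons pass powers of the first two variables on unchanged, so layer \<open>i\<close>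
  can combine \<open>x ^ e\<close> and \<open>y ^ e\<close> freely.\<close>

lemma layer_independent_special:
  assumes i: "1 \<le> i" and n: "\<And>j. j < i \<Longrightarrow> 2 \<le> n j" and d: "2 * n i - 1 \<le> d i" "\<And>j. 1 \<le> j \<Longrightarrow> j < i \<Longrightarrow> 1 \<le> d j"
  shows "\<exists>x. range x \<subseteq> K \<and> layer_independent n d x i"
proof -
  \<comment> \<open>identity matrices below layer \<open>i\<close>, rows \<open>(1, r, 0, \<dots>, 0)\<close> in layer \<open>i\<close>\<close>
  define x :: params where "x = (\<lambda>(j, r, s). if j < i then if r = s then 1 else 0
    else if s = 0 then 1 else if s = 1 then of_nat r else 0)"
  have low: "neuron n d x j r = poly_var r ^ layer_degree d (Suc j)" if "j < i" "r < 2" for j r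
    using that
  proof (induction j)
    case 0
    then show ?case by (simp add: layer_degree_def)
  next
    case (Suc j)
    have "r < n j" using n[of j] Suc.prems by simp
    moreover have "(\<Sum>s<n j. poly_const (x (Suc j, r, s)) * neuron n d x j s) =
        (\<Sum>s<n j. if s = r then neuron n d x j r else 0)"
      using Suc.prems by (intro sum.cong) (auto simp: x_def)
    ultimately have "neuron n d x (Suc j) r = neuron n d x j r ^ d (Suc j)"
      by (simp add: neuron.simps)
    then show ?case using Suc by (simp add: layer_degree_Suc power_mult[symmetric] mult.commute)
  qed
  let ?e = "layer_degree d i"
  have pre: "preact n d x i r = poly_var 0 ^ ?e + poly_const (of_nat r) * poly_var 1 ^ ?e" for r
  proof -
    have n2: "2 \<le> n (i - 1)" using n[of "i - 1"] i by simp
    have "preact n d x i r = (\<Sum>s<n (i - 1). (if s = 0 then neuron n d x (i - 1) 0 else 0) +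
        (if s = 1 then poly_const (of_nat r) * neuron n d x (i - 1) 1 else 0))"
      unfolding preact_def by (intro sum.cong) (auto simp: x_def)
    also have "\<dots> = neuron n d x (i - 1) 0 + poly_const (of_nat r) * neuron n d x (i - 1) 1"
      using n2 by (simp add: sum.distrib)
    finally show ?thesis using low[of "i - 1" 0] low[of "i - 1" 1] i by simp
  qed
  have e: "1 \<le> ?e"
    unfolding layer_degree_def using d(2) by (intro prod_ge_1) auto
  have "layer_independent n d x i"
    unfolding layer_independent_def pre
  proof (intro allI impI)
    fix q r
    assume q: "\<forall>r<n i. q r \<in> forms K (n 0) ?e"
      and rel: "(\<Sum>r<n i. (poly_var 0 ^ ?e + poly_const (of_nat r) * poly_var 1 ^ ?e) ^ (d i - 1) * q r) = 0"
      and r: "r < n i"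
    show "q r = 0"
      by (rule powers_of_binomial_forms_independent[OF _ d(1) e _ rel r, of "n 0"])
        (use q in \<open>auto simp: inj_on_def\<close>)
  qed
  moreover have "range x \<subseteq> K" by (auto simp: x_def)
  ultimately show ?thesis by blast
qed

text \<open>Finitely many nonempty open conditions on the weights hold simultaneously at some \<open>K\<close>-point.\<close>

lemma generic_weights:
  assumes n: "\<And>j. j < L \<Longrightarrow> 2 \<le> n j" and d: "\<And>j. 1 \<le> j \<Longrightarrow> j < L \<Longrightarrow> 2 * n j - 1 \<le> d j"
  shows "\<exists>p. range p \<subseteq> K \<and> (\<forall>w\<in>weight_set. p w \<noteq> 0) \<and> (\<forall>i. 1 \<le> i \<longrightarrow> i < L \<longrightarrow> layer_independent n d p i)"
proof -
  have "\<forall>i\<in>{1..<L}. \<exists>h. h \<in> polyfun K weight_set \<and> (\<exists>x. range x \<subseteq> K \<and> h x \<noteq> 0) \<and>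
      (\<forall>x. range x \<subseteq> K \<longrightarrow> h x \<noteq> 0 \<longrightarrow> layer_independent n d x i)"
  proof
    fix i assume i: "i \<in> {1..<L}"
    have "1 \<le> d j" if "1 \<le> j" "j < i" for j using d[of j] n[of j] that i by simp
    then obtain x where "range x \<subseteq> K" "layer_independent n d x i"
      using layer_independent_special[of i] n d i by (meson atLeastLessThan_iff less_trans)
    then show "\<exists>h. h \<in> polyfun K weight_set \<and> (\<exists>x. range x \<subseteq> K \<and> h x \<noteq> 0) \<and>
        (\<forall>x. range x \<subseteq> K \<longrightarrow> h x \<noteq> 0 \<longrightarrow> layer_independent n d x i)"
      using layer_independent_open[of i x] i by auto
  qed
  from bchoice[OF this] obtain h where hh: "\<forall>i\<in>{1..<L}. h i \<in> polyfun K weight_set \<and>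
      (\<exists>x. range x \<subseteq> K \<and> h i x \<noteq> 0) \<and>
      (\<forall>x. range x \<subseteq> K \<longrightarrow> h i x \<noteq> 0 \<longrightarrow> layer_independent n d x i)" ..
  have h: "\<And>i. i \<in> {1..<L} \<Longrightarrow> h i \<in> polyfun K weight_set"
    "\<And>i. i \<in> {1..<L} \<Longrightarrow> \<exists>x. range x \<subseteq> K \<and> h i x \<noteq> 0"
    "\<And>i x. i \<in> {1..<L} \<Longrightarrow> range x \<subseteq> K \<Longrightarrow> h i x \<noteq> 0 \<Longrightarrow> layer_independent n d x i"
    using hh by simp_all
  let ?S = "h ` {1..<L} \<union> (\<lambda>w x. x w) ` weight_set"
  have "\<exists>z. range z \<subseteq> K \<and> (\<forall>f\<in>?S. f z \<noteq> 0)"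
  proof (rule polyfun_common_nonzero_finite[of ?S "\<lambda>f. f"])
    show "finite ?S" using finite_weight_index by simp
    show "f \<in> polyfun K weight_set" if "f \<in> ?S" for f
    proof (cases "f \<in> h ` {1..<L}")
      case True
      then show ?thesis using h(1) by auto
    next
      case False
      then have "f \<in> (\<lambda>w x. x w) ` weight_set" using that by (meson UnE)
      then show ?thesis using polyfun.var[of _ weight_set] by (elim imageE) simp
    qed
    show "\<exists>x. range x \<subseteq> K \<and> f x \<noteq> 0" if "f \<in> ?S" for f
    proof (cases "f \<in> h ` {1..<L}")
      case True
      then show ?thesis using h(2) by auto
    next
      case False
      then show ?thesis using that by (intro exI[of _ "\<lambda>_. 1"]) auto
    qed
  qed
  then obtain z where z: "range z \<subseteq> K" "\<forall>f\<in>?S. f z \<noteq> 0" by (elim exE conjE)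
  have "z w \<noteq> 0" if "w \<in> weight_set" for w
    using bspec[OF z(2), of "\<lambda>x. x w"] that by simp
  moreover have "layer_independent n d z i" if "1 \<le> i" "i < L" for i
    using bspec[OF z(2), of "h i"] h(3)[of i z] z(1) that by simp
  ultimately show ?thesis using z(1) by blast
qed

end

section \<open>The upper bound\<close>

context network_setup
begin

text \<open>The weights that remain after the first column of every weight matrix is normalized.\<close>

definition free_weights :: "(nat \<times> nat \<times> nat) set" where
  "free_weights = {(i, r, s). (i, r, s) \<in> weight_set \<and> 1 \<le> s}"

lemma finite_free_weights: "finite free_weights"
  by (rule finite_subset[OF _ finite_weight_index[of n L]]) (auto simp: free_weights_def)

lemma card_free_weights: "card free_weights = (\<Sum>i=1..L. n i * (n (i - 1) - 1))"
proof -
  have "free_weights = (SIGMA i:{1..L}. {..<n i} \<times> {1..<n (i - 1)})"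
    by (auto simp: free_weights_def weight_index_def)
  then show ?thesis by (simp add: card_SigmaI card_cartesian_product)
qed

text \<open>The factors by which the neurons change when the first columns are normalized to \<open>1\<close>.\<close>

primrec neuron_scale :: "params \<Rightarrow> nat \<Rightarrow> nat \<Rightarrow> complex" where
  "neuron_scale x 0 r = 1"
| "neuron_scale x (Suc i) r = (x (Suc i, r, 0) * neuron_scale x i 0) ^ d (Suc i)"

lemma poly_const_power: "poly_const c ^ e = poly_const (c ^ e)"
  by (induction e) (simp_all add: poly_const_mult)

text \<open>The factor of a neuron can be moved into the column of the next matrix that belongs to it. In the last
  layer it rescales an output, which does not change the point of the projective space.\<close>

lemma normalized_weights:
  assumes x: "range x \<subseteq> K" and nz: "\<And>i r. 1 \<le> i \<Longrightarrow> i \<le> L \<Longrightarrow> r < n i \<Longrightarrow> x (i, r, 0) \<noteq> 0"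
    and n: "\<And>j. j < L \<Longrightarrow> 1 \<le> n j"
  shows "\<exists>y c. range y \<subseteq> K \<and> (\<forall>l<n L. c l \<in> K - {0} \<and> out x l = poly_const (c l) * out_on free_weights (\<lambda>_. 1) y l)"
proof -
  let ?\<sigma> = "neuron_scale x"
  define \<pi> where "\<pi> = (\<lambda>i r. x (i, r, 0) * ?\<sigma> (i - 1) 0)"
  define y :: params where "y = (\<lambda>(i, r, s). x (i, r, s) * ?\<sigma> (i - 1) s / \<pi> i r)"
  define y' :: params where "y' = (\<lambda>i. if i \<in> free_weights then y i else 1)"
  have \<sigma>K: "?\<sigma> i r \<in> K" for i r using x by (induction i arbitrary: r) auto
  have \<sigma>0: "?\<sigma> i r \<noteq> 0" if "i \<le> L" "r < n i" for i r
    using that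
  proof (induction i arbitrary: r)
    case (Suc i)
    have "0 < n i" using n[of i] Suc.prems by simp
    then have "?\<sigma> i 0 \<noteq> 0" using Suc by simp
    then show ?case using nz[of "Suc i" r] Suc.prems by simp
  qed simp
  have \<pi>0: "\<pi> i r \<noteq> 0" if "1 \<le> i" "i \<le> L" "r < n i" for i r
  proof -
    have "i - 1 < L" using that by linarith
    then have "?\<sigma> (i - 1) 0 \<noteq> 0" using \<sigma>0[of "i - 1" 0] n[of "i - 1"] by simp
    then show ?thesis using that nz by (simp add: \<pi>_def)
  qed
  have y': "\<pi> i r * y' (i, r, s) = x (i, r, s) * ?\<sigma> (i - 1) s" if "(i, r, s) \<in> weight_set" for i r s
    using that \<pi>0[of i r] by (cases "s = 0") (auto simp: y'_def y_def \<pi>_def free_weights_def weight_index_def)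
  have pre_step: "preact n d x i r = poly_const (\<pi> i r) * preact n d y' i r"
    if i: "1 \<le> i" "i \<le> L" "r < n i"
      and neu: "\<And>s. s < n (i - 1) \<Longrightarrow> neuron n d x (i - 1) s = poly_const (?\<sigma> (i - 1) s) * neuron n d y' (i - 1) s" for i r
    unfolding preact_def sum_distrib_left
  proof (rule sum.cong)
    fix s assume s: "s \<in> {..<n (i - 1)}"
    then have "(i, r, s) \<in> weight_set" using i by (simp add: weight_index_def)
    have "poly_const (x (i, r, s)) * neuron n d x (i - 1) s =
        poly_const (x (i, r, s) * ?\<sigma> (i - 1) s) * neuron n d y' (i - 1) s"
      using neu[of s] s by (simp add: poly_const_mult mult.assoc)
    also have "\<dots> = poly_const (\<pi> i r) * (poly_const (y' (i, r, s)) * neuron n d y' (i - 1) s)"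
      unfolding y'[OF \<open>(i, r, s) \<in> weight_set\<close>, symmetric] by (simp only: poly_const_mult mult.assoc)
    finally show "poly_const (x (i, r, s)) * neuron n d x (i - 1) s =
        poly_const (\<pi> i r) * (poly_const (y' (i, r, s)) * neuron n d y' (i - 1) s)" .
  qed simp
  have neu: "neuron n d x i r = poly_const (?\<sigma> i r) * neuron n d y' i r" if "i \<le> L" "r < n i" for i r
    using that
  proof (induction i arbitrary: r)
    case (Suc i)
    have "preact n d x (Suc i) r = poly_const (\<pi> (Suc i) r) * preact n d y' (Suc i) r"
      using Suc by (intro pre_step) auto
    then show ?case
      by (simp add: neuron_Suc power_mult_distrib poly_const_power \<pi>_def)
  qed simp
  have "out x l = poly_const (\<pi> L l) * out_on free_weights (\<lambda>_. 1) y l" if "l < n L" for l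
    unfolding out_on_def out_def y'_def[symmetric] using L that neu by (intro pre_step) auto
  moreover have "\<pi> L l \<in> K - {0}" if "l < n L" for l
    using \<pi>0[of L l] L that x \<sigma>K by (auto simp: \<pi>_def)
  moreover have "range y \<subseteq> K" using x \<sigma>K by (auto simp: y_def \<pi>_def image_subset_iff)
  ultimately show ?thesis by (intro exI[of _ y] exI[of _ "\<pi> L"]) auto
qed

text \<open>Weights with nonzero first columns are dense, and they can be normalized.\<close>

lemma vanish_on_normalized:
  assumes n: "\<And>j. j < L \<Longrightarrow> 1 \<le> n j" and R: "R \<in> mh_polys"
    and van: "\<forall>P\<in>family_image (out_on free_weights (\<lambda>_. 1)). pev P R = 0"
  shows "\<forall>P\<in>family_image out. pev P R = 0"
proof (rule ccontr)
  assume "\<not> ?thesis"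
  then obtain x where x: "x \<in> family_dom out" "pev (proj_tuple (out x)) R \<noteq> 0"
    by (auto simp: family_image_def)
  let ?R = "\<lambda>x. poly_eval (form_coords (out x)) R"
  obtain f where f: "f \<in> polyfun K weight_set" "f x \<noteq> 0"
    "\<And>z. range z \<subseteq> K \<Longrightarrow> f z \<noteq> 0 \<Longrightarrow> z \<in> family_dom out"
    using nonzero_coord_polyfun[OF poly_family_out x(1)] by blast
  let ?S = "{(i, r). 1 \<le> i \<and> i \<le> L \<and> r < n i}"
  have finS: "finite ?S"
  proof -
    have "?S = (SIGMA i:{1..L}. {..<n i})" by auto
    then show ?thesis by simp
  qed
  let ?g = "\<lambda>x :: params. \<Prod>(i, r)\<in>?S. x (i, r, 0)"
  have "0 < n (i - 1)" if "1 \<le> i" "i \<le> L" for i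
  proof -
    have "i - 1 < L" using that by linarith
    then show ?thesis using n[of "i - 1"] by simp
  qed
  then have "?g \<in> polyfun K weight_set"
    by (intro polyfun_prod) (auto simp: weight_index_def intro: polyfun.var)
  moreover have "(\<lambda>x. f x * ?R x) \<in> polyfun K weight_set"
    by (intro polyfun.mult f polyfun_poly_eval_family[OF poly_family_out R])
  moreover have "f x * ?R x \<noteq> 0" using f(2) x pev_family[OF poly_family_out x(1) R] by simp
  moreover have "?g (\<lambda>_. 1) \<noteq> 0" by simp
  ultimately obtain z where z: "range z \<subseteq> K" "f z * ?R z \<noteq> 0" "?g z \<noteq> 0"
    using polyfun_common_nonzero[of "\<lambda>x. f x * ?R x" weight_set ?g x "\<lambda>_. 1"] x(1)
    by (auto simp: family_dom_def)
  have zd: "z \<in> family_dom out" using f(3) z by auto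
  have zn: "z (i, r, 0) \<noteq> 0" if "1 \<le> i" "i \<le> L" "r < n i" for i r
    using z(3) finS that by auto
  have "\<exists>y c. range y \<subseteq> K \<and> (\<forall>l<n L. c l \<in> K - {0} \<and> out z l = poly_const (c l) * out_on free_weights (\<lambda>_. 1) y l)"
    by (rule normalized_weights[OF z(1)]) (rule zn n; assumption)+
  then obtain y c where y: "range y \<subseteq> K"
    and yc: "\<forall>l<n L. c l \<in> K - {0} \<and> out z l = poly_const (c l) * out_on free_weights (\<lambda>_. 1) y l"
    by (elim exE conjE)
  have c: "c l \<in> K - {0}" "out z l = poly_const (c l) * out_on free_weights (\<lambda>_. 1) y l" if "l < n L" for l
    using yc that by blast+
  let ?F = "out_on free_weights (\<lambda>_. 1)"
  have F: "poly_family free_weights ?F" by (rule poly_family_out_on) auto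
  have yd: "y \<in> family_dom ?F"
    using y zd c unfolding family_dom_def by fastforce
  then have pts: "proj_tuple (?F y) \<in> pts" and "pev (proj_tuple (?F y)) R = 0"
    using van family_image_pts[OF F] by (auto simp: family_image_def)
  moreover have "\<forall>l<n L. out z l \<in> proj_tuple (?F y) l"
    using c by (auto simp: proj_tuple_def proj_class_def)
  ultimately have "?R z = 0" using pev_eq_0_iff[OF pts R, of "out z"] by simp
  then show False using z by simp
qed

lemma chain_length_le:
  assumes n: "\<And>j. j < L \<Longrightarrow> 1 \<le> n j"
    and Z: "\<And>i. i \<le> r \<Longrightarrow> closedin zar (Z i) \<and> irreducible_space (subtopology zar (Z i))"
    and strict: "\<And>i. i < r \<Longrightarrow> Z i \<subset> Z (Suc i)"
    and sub: "\<And>i. i \<le> r \<Longrightarrow> Z i \<subseteq> zar closure_of family_image out"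
  shows "r \<le> card free_weights"
proof (rule ccontr)
  let ?D = "card free_weights + 1"
  let ?F = "out_on free_weights (\<lambda>_. 1)"
  assume "\<not> ?thesis"
  then have le: "?D \<le> r" by simp
  have F: "poly_family free_weights ?F" by (rule poly_family_out_on) auto
  obtain E g where g: "\<And>j. j \<le> ?D \<Longrightarrow> g j \<in> mh (\<lambda>_. E)"
    and ind: "\<forall>N c a. (\<forall>a. c a \<in> K) \<longrightarrow>
    (\<forall>P\<in>Z ?D. pev P (hom_comb (\<lambda>a. poly_const (c a)) ?D N g) = 0) \<longrightarrow> a \<in> hom_exps ?D N \<longrightarrow> c a = 0"
    using chain_without_relation[of ?D Z] Z strict le by auto
  have ex: "\<exists>N c. (\<forall>a. c a \<in> K) \<and> (\<exists>a\<in>hom_exps ?D N. c a \<noteq> 0) \<and>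
      (\<forall>P\<in>zar closure_of family_image ?F. pev P (hom_comb (\<lambda>a. poly_const (c a)) ?D N g) = 0)"
    by (rule family_relation[OF F finite_free_weights]) (rule g)
  obtain N c where c: "\<forall>a. c a \<in> K" "\<exists>a\<in>hom_exps ?D N. c a \<noteq> 0"
    and rel: "\<forall>P\<in>zar closure_of family_image ?F. pev P (hom_comb (\<lambda>a. poly_const (c a)) ?D N g) = 0"
    using ex by (elim exE conjE)
  let ?R = "hom_comb (\<lambda>a. poly_const (c a)) ?D N g"
  have R: "?R \<in> mh_polys"
    by (rule mh_subset[OF mh_hom_comb[where e = "\<lambda>_. E"]]) (use c g in auto)
  have "\<forall>P\<in>family_image ?F. pev P ?R = 0"
    using rel subset_closure[OF family_image_pts[OF F]] by blast
  with n R have "\<forall>P\<in>family_image out. pev P ?R = 0" by (rule vanish_on_normalized)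
  then have "\<forall>P\<in>Z ?D. pev P ?R = 0"
    using vanish_on_closure[OF family_image_pts[OF poly_family_out] R] sub[OF le] by blast
  then show False using ind c by blast
qed

end

section \<open>The lower bound\<close>

text \<open>Weights \<open>p\<close> at which the differential is injective; they exist by \<open>generic_weights\<close>.\<close>

locale generic_network = network_setup +
  fixes p :: params
  assumes L2: "2 \<le> L"
    and width: "\<And>j. j \<le> L \<Longrightarrow> 1 \<le> n j"
    and act: "\<And>j. 1 \<le> j \<Longrightarrow> j < L \<Longrightarrow> 2 \<le> d j"
    and pK: "range p \<subseteq> K"
    and p_nonzero: "\<And>w. w \<in> weight_set \<Longrightarrow> p w \<noteq> 0"
    and p_independent: "\<And>i. 1 \<le> i \<Longrightarrow> i < L \<Longrightarrow> layer_independent n d p i"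
begin

text \<open>An output is a combination of \<open>z ^ d = z ^ (d - 1) * z\<close> with nonzero coefficients.\<close>

lemma out_p_nonzero:
  assumes l: "l < n L" shows "out p l \<noteq> 0"
proof
  assume z: "out p l = 0"
  let ?i = "L - 1"
  have i: "1 \<le> ?i" "?i < L" using L2 by auto
  let ?q = "\<lambda>s. poly_const (p (L, l, s)) * preact n d p ?i s"
  have "neuron n d p ?i s = preact n d p ?i s ^ (d ?i - 1) * preact n d p ?i s" for s
  proof -
    have "Suc (?i - 1) = ?i" using L2 by simp
    then have "neuron n d p ?i s = preact n d p ?i s ^ d ?i"
      using neuron_Suc[of n d p "?i - 1" s] by metis
    then show ?thesis using act[OF i] power_minus_mult[of "d ?i" "preact n d p ?i s"] by simp
  qed
  then have "(\<Sum>s<n ?i. preact n d p ?i s ^ (d ?i - 1) * ?q s) = out p l"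
    unfolding out_def preact_def[of n d p L] by (intro sum.cong) (auto simp: mult_ac)
  moreover have "\<forall>s<n ?i. ?q s \<in> forms K (n 0) (layer_degree d ?i)"
    using pK i by (auto intro!: forms_scale preact_forms)
  ultimately have "\<forall>s<n ?i. ?q s = 0"
    using z p_independent[OF i, unfolded layer_independent_def, rule_format, of ?q] by simp
  moreover have n0: "0 < n ?i" "0 < n 0" using width[of ?i] width[of 0] i by auto
  ultimately have "?q 0 = 0" by simp
  then have "p (L, l, 0) = 0 \<or> preact n d p ?i 0 = 0" by (rule poly_const_mult_eq_0)
  moreover have "preact n d p ?i 0 \<noteq> 0"
    using layer_independent_nonzero[OF p_independent[OF i] act[OF i] n0(2) n0(1)] .
  moreover have "p (L, l, 0) \<noteq> 0"
    using p_nonzero[of "(L, l, 0)"] L l n0 by (simp add: weight_index_def)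
  ultimately show False by simp
qed

text \<open>A coordinate that serves as denominator in an affine chart around the point of \<open>p\<close>.\<close>

definition base_monomial :: "nat \<Rightarrow> nat monomial" where
  "base_monomial l = (SOME t. lookup (out p l) t \<noteq> 0)"

lemma base_monomial:
  assumes l: "l < n L"
  shows "lookup (out p l) (base_monomial l) \<noteq> 0"
    "base_monomial l \<in> monomials_of_degree (n 0) (total_degree L d)"
proof -
  have "\<exists>t. lookup (out p l) t \<noteq> 0"
    using out_p_nonzero[OF l] by (metis lookup_zero poly_mapping_eqI)
  then show nz: "lookup (out p l) (base_monomial l) \<noteq> 0"
    unfolding base_monomial_def by (rule someI_ex)
  have "out p l \<in> forms K (n 0) (total_degree L d)"
    using poly_family_out pK l unfolding poly_family_def by blast
  then show "base_monomial l \<in> monomials_of_degree (n 0) (total_degree L d)"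
    using nz by (auto simp: forms_def in_keys_iff subset_iff)
qed

definition base_form :: "(nat \<times> nat monomial) cpoly" where
  "base_form = (\<Prod>l<n L. poly_var (l, base_monomial l))"

text \<open>For each output the differential of the quotient of the coordinates \<open>t\<close> and \<open>base_monomial l\<close> at \<open>p\<close> is,
  up to a nonzero factor, that of a two by two minor. The product with the other denominators gives all these
  forms, and \<open>base_form\<close>, the same multidegree \<open>(1, \<dots>, 1)\<close>.\<close>

definition minor_form :: "nat \<times> nat monomial \<Rightarrow> (nat \<times> nat monomial) cpoly" where
  "minor_form = (\<lambda>(l, t).
     (poly_const (lookup (out p l) (base_monomial l)) * poly_var (l, t)
      + poly_const (- lookup (out p l) t) * poly_var (l, base_monomial l))
     * (\<Prod>l'\<in>{..<n L} - {l}. poly_var (l', base_monomial l')))"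

abbreviation "coords \<equiv> {..<n L} \<times> monomials_of_degree (n 0) (total_degree L d)"

lemma out_coeff_in: "l < n L \<Longrightarrow> lookup (out p l) t \<in> K"
  using poly_family_out pK unfolding poly_family_def forms_def by blast

lemma base_form_mh: "base_form \<in> mh (\<lambda>_. 1)"
proof -
  have "base_form \<in> mh (\<lambda>l'. \<Sum>l<n L. if l' = l then 1 else 0)"
    unfolding base_form_def by (intro mh_prod mh_var base_monomial) auto
  also have "\<dots> = mh (\<lambda>_. 1)" by (rule mh_cong) simp
  finally show ?thesis .
qed

lemma minor_form_mh:
  assumes "w \<in> coords" shows "minor_form w \<in> mh (\<lambda>_. 1)"
proof -
  obtain l t where w: "w = (l, t)" "l < n L" "t \<in> monomials_of_degree (n 0) (total_degree L d)"
    using assms by auto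
  have "minor_form w \<in> mh (\<lambda>l'. (if l' = l then 1 else 0) + (\<Sum>l''\<in>{..<n L} - {l}. if l' = l'' then 1 else 0))"
    unfolding minor_form_def w(1) prod.case
    using w by (intro mh_mult mh_add mh_scale mh_prod mh_var base_monomial out_coeff_in uminus_in) auto
  also have "\<dots> = mh (\<lambda>_. 1)" by (rule mh_cong) auto
  finally show ?thesis .
qed

lemma eval_base_form: "poly_eval (form_coords G) base_form = (\<Prod>l<n L. lookup (G l) (base_monomial l))"
  by (simp add: base_form_def poly_eval_prod form_coords_def)

lemma eval_minor_form: "poly_eval (form_coords G) (minor_form (l, t)) =
    (lookup (out p l) (base_monomial l) * lookup (G l) t
      - lookup (out p l) t * lookup (G l) (base_monomial l))
    * (\<Prod>l'\<in>{..<n L} - {l}. lookup (G l') (base_monomial l'))"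
  by (simp add: minor_form_def poly_eval_mult poly_eval_add poly_eval_prod form_coords_def)

definition minor_gradient :: "nat \<times> nat monomial \<Rightarrow> nat \<times> nat \<times> nat \<Rightarrow> complex" where
  "minor_gradient w = (SOME g. (\<forall>i. g i \<in> K) \<and> (\<forall>v. ((\<lambda>\<tau>. poly_eval (form_coords (out (\<lambda>i. p i + \<tau> * v i))) (minor_form w))
      has_field_derivative (\<Sum>i\<in>weight_set. g i * v i)) (at 0)))"

lemma minor_gradient:
  assumes "w \<in> coords"
  shows "minor_gradient w i \<in> K"
    "((\<lambda>\<tau>. poly_eval (form_coords (out (\<lambda>i. p i + \<tau> * v i))) (minor_form w))
      has_field_derivative (\<Sum>i\<in>weight_set. minor_gradient w i * v i)) (at 0)"
proof -
  have "\<exists>g. (\<forall>i. g i \<in> K) \<and> (\<forall>v. ((\<lambda>\<tau>. poly_eval (form_coords (out (\<lambda>i. p i + \<tau> * v i))) (minor_form w))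
      has_field_derivative (\<Sum>i\<in>weight_set. g i * v i)) (at 0))"
    by (rule polyfun_gradient[OF polyfun_poly_eval_family[OF poly_family_out mh_subset[OF minor_form_mh[OF assms]]]
          finite_weight_index pK])
  from someI_ex[OF this] show "minor_gradient w i \<in> K"
    "((\<lambda>\<tau>. poly_eval (form_coords (out (\<lambda>i. p i + \<tau> * v i))) (minor_form w))
      has_field_derivative (\<Sum>i\<in>weight_set. minor_gradient w i * v i)) (at 0)"
    unfolding minor_gradient_def by blast+
qed

text \<open>If the minors of output \<open>l\<close> have derivative zero, the derivative of the output is a multiple of the
  output, so \<open>tangent_injective\<close> applies.\<close>

lemma jacobian_injective:
  "trivial_kernel coords free_weights minor_gradient"
  unfolding trivial_kernel_def
proof (intro allI impI)
  fix v0 assume v0: "\<forall>i. v0 i \<in> K" "\<forall>w\<in>coords. (\<Sum>i\<in>free_weights. minor_gradient w i * v0 i) = 0"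
  define v where "v = (\<lambda>i. if i \<in> free_weights then v0 i else 0)"
  have vK: "range v \<subseteq> K" using v0 by (auto simp: v_def)
  have d0: "dpreact n d p v L l \<in> forms K (n 0) (total_degree L d)" for l
  proof -
    have "1 \<le> d j" if "1 \<le> j" "j < L" for j using act[OF that] by simp
    then show ?thesis unfolding total_degree_eq by (intro dpreact_forms pK vK L) auto
  qed
  have out_deriv: "((\<lambda>\<tau>. lookup (out (\<lambda>i. p i + \<tau> * v i) l) t)
      has_field_derivative lookup (dpreact n d p v L l) t) (at 0)" for l t
    using coeff_deriv_preact[of n d p v L l] unfolding coeff_deriv_def out_def by blast
  have "\<exists>c\<in>K. dpreact n d p v L l = poly_const c * preact n d p L l" if l: "l < n L" for l
  proof
    let ?a = "lookup (out p l) (base_monomial l)"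
    let ?dF = "lookup (dpreact n d p v L l)"
    let ?c = "?dF (base_monomial l) / ?a"
    have a: "?a \<noteq> 0" using base_monomial[OF l] by simp
    show "?c \<in> K" using d0[of l] out_coeff_in[OF l] by (auto simp: forms_def)
    show "dpreact n d p v L l = poly_const ?c * preact n d p L l"
    proof (rule poly_mapping_eqI)
      fix t
      show "?dF t = lookup (poly_const ?c * preact n d p L l) t"
      proof (cases "t \<in> monomials_of_degree (n 0) (total_degree L d)")
        case False
        have "out p l \<in> forms K (n 0) (total_degree L d)"
          using poly_family_out pK l unfolding poly_family_def by blast
        then have "lookup (out p l) t = 0" "?dF t = 0"
          using d0[of l] False by (auto simp: forms_def in_keys_iff subset_iff)
        then show ?thesis by (simp add: lookup_poly_const_mult out_def)
      next
        case True
        then have w: "(l, t) \<in> coords" using l by simp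
        let ?pr = "\<lambda>G. \<Prod>l'\<in>{..<n L} - {l}. lookup (G l') (base_monomial l')"
        let ?o = "\<lambda>\<tau>. out (\<lambda>i. p i + \<tau> * v i)"
        have "(\<lambda>x. ?pr (out x)) \<in> polyfun K weight_set"
          using poly_family_out by (intro polyfun_prod) (auto simp: poly_family_def)
        then obtain g where "((\<lambda>\<tau>. ?pr (?o \<tau>)) has_field_derivative (\<Sum>i\<in>weight_set. g i * v i)) (at 0)"
          using polyfun_gradient[OF _ finite_weight_index pK] by blast
        then obtain e where e: "((\<lambda>\<tau>. ?pr (?o \<tau>)) has_field_derivative e) (at 0)" by blast
        have "((\<lambda>\<tau>. (?a * lookup (?o \<tau> l) t
            - lookup (out p l) t * lookup (?o \<tau> l) (base_monomial l)) * ?pr (?o \<tau>))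
          has_field_derivative (?a * ?dF t - lookup (out p l) t * ?dF (base_monomial l)) * ?pr (out p)) (at 0)"
          by (rule derivative_eq_intros out_deriv e refl)+ simp
        then have "((\<lambda>\<tau>. poly_eval (form_coords (?o \<tau>)) (minor_form (l, t)))
          has_field_derivative (?a * ?dF t - lookup (out p l) t * ?dF (base_monomial l)) * ?pr (out p)) (at 0)"
          unfolding eval_minor_form .
        from DERIV_unique[OF this minor_gradient(2)[OF w]]
        have "(?a * ?dF t - lookup (out p l) t * ?dF (base_monomial l)) * ?pr (out p) =
            (\<Sum>i\<in>weight_set. minor_gradient (l, t) i * v i)" .
        also have "\<dots> = (\<Sum>i\<in>free_weights. minor_gradient (l, t) i * v0 i)"
          by (rule sum.mono_neutral_cong_right) (auto simp: v_def free_weights_def finite_weight_index)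
        also have "\<dots> = 0" using v0(2) w by blast
        finally have "?a * ?dF t = lookup (out p l) t * ?dF (base_monomial l)"
          using base_monomial(1) by auto
        then have "?dF t = ?c * lookup (out p l) t" using a by (simp add: field_simps)
        then show ?thesis by (simp add: lookup_poly_const_mult out_def)
      qed
    qed
  qed
  then have "v (j, r, s) = 0" if "(j, r, s) \<in> weight_set" for j r s
  proof (intro tangent_injective[OF pK vK p_nonzero _ p_independent act _ L order_refl _ that])
    show "v (j, r, 0) = 0" for j r by (simp add: v_def free_weights_def)
    show "0 < n j" if "j \<le> L" for j using width[OF that] by simp
  qed auto
  note v_zero = this
  show "\<forall>i\<in>free_weights. v0 i = 0"
  proof
    fix i assume i: "i \<in> free_weights"
    obtain j r s where "i = (j, r, s)" by (cases i)
    then have "v i = 0" using v_zero[of j r s] i by (simp add: free_weights_def)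
    then show "v0 i = 0" using i by (simp add: v_def)
  qed
qed

text \<open>A left inverse of the Jacobian matrix combines the minors to forms whose derivatives are the
  coordinates of the direction.\<close>

lemma dual_forms:
  "\<exists>H. (\<forall>i. H i \<in> mh (\<lambda>_. 1)) \<and> (\<forall>i. poly_eval (form_coords (out p)) (H i) = 0) \<and>
     (\<forall>i\<in>free_weights. \<forall>v. (\<forall>w. w \<notin> free_weights \<longrightarrow> v w = 0) \<longrightarrow>
        ((\<lambda>\<tau>. poly_eval (form_coords (out (\<lambda>i. p i + \<tau> * v i))) (H i)) has_field_derivative v i) (at 0))"
proof -
  have fin: "finite coords" using finite_monomials_of_degree by simp
  define A where "A = (\<lambda>w i. if w \<in> coords then minor_gradient w i else 0)"
  have "trivial_kernel coords free_weights A"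
    using jacobian_injective unfolding trivial_kernel_def A_def by simp
  moreover have "A w i \<in> K" for w i using minor_gradient(1) by (simp add: A_def)
  ultimately obtain B where B: "\<forall>i w. B i w \<in> K"
    "\<forall>i\<in>free_weights. \<forall>j\<in>free_weights. (\<Sum>w\<in>coords. B i w * A w j) = (if i = j then 1 else 0)"
    using left_inverse_of_trivial_kernel[of free_weights coords A] finite_free_weights fin by blast
  define H where "H = (\<lambda>i. \<Sum>w\<in>coords. poly_const (B i w) * minor_form w)"
  have "H i \<in> mh (\<lambda>_. 1)" for i
    unfolding H_def by (intro mh_sum mh_scale minor_form_mh B(1)[rule_format])
  moreover have "poly_eval (form_coords (out p)) (H i) = 0" for i
    unfolding H_def poly_eval_sum poly_eval_mult
    by (rule sum.neutral) (auto simp: eval_minor_form)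
  moreover have "((\<lambda>\<tau>. poly_eval (form_coords (out (\<lambda>i. p i + \<tau> * v i))) (H i)) has_field_derivative v i) (at 0)"
    if i: "i \<in> free_weights" and v: "\<forall>w. w \<notin> free_weights \<longrightarrow> v w = 0" for i v
  proof -
    have "((\<lambda>\<tau>. \<Sum>w\<in>coords. B i w * poly_eval (form_coords (out (\<lambda>i. p i + \<tau> * v i))) (minor_form w))
      has_field_derivative (\<Sum>w\<in>coords. B i w * (\<Sum>j\<in>weight_set. minor_gradient w j * v j))) (at 0)"
      by (intro DERIV_sum DERIV_cmult minor_gradient(2))
    also have "(\<Sum>w\<in>coords. B i w * (\<Sum>j\<in>weight_set. minor_gradient w j * v j)) =
        (\<Sum>w\<in>coords. \<Sum>j\<in>free_weights. (B i w * A w j) * v j)"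
    proof (rule sum.cong)
      fix w assume w: "w \<in> coords"
      have "(\<Sum>j\<in>weight_set. minor_gradient w j * v j) = (\<Sum>j\<in>free_weights. A w j * v j)"
        by (rule sum.mono_neutral_cong_right) (use v w in \<open>auto simp: A_def free_weights_def finite_weight_index\<close>)
      then show "B i w * (\<Sum>j\<in>weight_set. minor_gradient w j * v j) = (\<Sum>j\<in>free_weights. (B i w * A w j) * v j)"
        by (simp add: sum_distrib_left mult.assoc)
    qed simp
    also have "\<dots> = (\<Sum>j\<in>free_weights. (\<Sum>w\<in>coords. B i w * A w j) * v j)"
      by (subst sum.swap) (simp only: sum_distrib_right)
    also have "\<dots> = (\<Sum>j\<in>free_weights. if i = j then v j else 0)"
      by (rule sum.cong) (use B(2) i in auto)
    also have "\<dots> = v i" using i finite_free_weights by simp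
    finally show ?thesis by (simp add: H_def poly_eval_sum poly_eval_mult)
  qed
  ultimately show ?thesis by (intro exI[of _ H]) blast
qed

lemma p_in_family_dom: "p \<in> family_dom (out_on S p)"
  using pK out_p_nonzero by (simp add: family_dom_def out_on_def)

text \<open>Otherwise a relation between \<open>j + 2\<close> forms, which exists for \<open>j\<close> parameters, would hold for the \<open>j + 1\<close>
  directions \<open>e 0, \<dots>, e j\<close>, contradicting \<open>first_order_independence\<close> for \<open>base_form\<close> and the dual
  forms of these directions.\<close>

lemma closure_strict_mono:
  assumes enum: "inj_on e {..<Suc j}" "e ` {..<Suc j} \<subseteq> free_weights"
  shows "zar closure_of family_image (out_on (e ` {..<j}) p) \<noteq>
    zar closure_of family_image (out_on (e ` {..<Suc j}) p)"
proof
  let ?F = "out_on (e ` {..<j}) p" and ?F' = "out_on (e ` {..<Suc j}) p"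
  assume eq: "zar closure_of family_image ?F = zar closure_of family_image ?F'"
  obtain H where H: "\<And>i. H i \<in> mh (\<lambda>_. 1)" "\<And>i. poly_eval (form_coords (out p)) (H i) = 0"
    and dH: "\<forall>i\<in>free_weights. \<forall>v. (\<forall>w. w \<notin> free_weights \<longrightarrow> v w = 0) \<longrightarrow>
        ((\<lambda>\<tau>. poly_eval (form_coords (out (\<lambda>i. p i + \<tau> * v i))) (H i)) has_field_derivative v i) (at 0)"
    using dual_forms by blast
  define g where "g = (\<lambda>i. case i of 0 \<Rightarrow> base_form | Suc a \<Rightarrow> H (e a))"
  have g: "g i \<in> mh (\<lambda>_. 1)" for i
    using H base_form_mh by (auto simp: g_def split: nat.split)
  have card: "card (e ` {..<j}) = j"
    using card_image[OF inj_on_subset[OF enum(1), of "{..<j}"]] by auto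
  have F: "poly_family (e ` {..<j}) ?F" and F': "poly_family (e ` {..<Suc j}) ?F'"
    by (rule poly_family_out_on[OF pK])+
  have ex: "\<exists>N c. (\<forall>a. c a \<in> K) \<and> (\<exists>a\<in>hom_exps (j + 1) N. c a \<noteq> 0) \<and>
      (\<forall>P\<in>zar closure_of family_image ?F. pev P (hom_comb (\<lambda>a. poly_const (c a)) (j + 1) N g) = 0)"
    using family_relation[OF F, of g 1, unfolded card] g by simp
  obtain N c where c: "\<forall>a. c a \<in> K" "\<exists>a\<in>hom_exps (j + 1) N. c a \<noteq> 0"
    and rel: "\<forall>P\<in>zar closure_of family_image ?F. pev P (hom_comb (\<lambda>a. poly_const (c a)) (j + 1) N g) = 0"
    using ex by (elim exE conjE)
  let ?R = "hom_comb (\<lambda>a. poly_const (c a)) (j + 1) N g"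
  have R: "?R \<in> mh_polys"
    by (rule mh_subset[OF mh_hom_comb[where e = "\<lambda>_. 1"]]) (use c g in auto)
  have van: "\<forall>P\<in>family_image ?F'. pev P ?R = 0"
    using rel subset_closure[OF family_image_pts[OF F']] unfolding eq by blast
  let ?b = "poly_eval (form_coords (out p)) base_form"
  have b: "?b \<noteq> 0" using base_monomial(1) by (simp add: eval_base_form)
  have "c a = 0" if a: "a \<in> hom_exps (j + 1) N" for a
  proof (rule first_order_independence[OF c(1) b _ a])
    fix v :: "nat \<Rightarrow> complex" assume v: "range v \<subseteq> K"
    define w where "w = (\<lambda>i. if i \<in> e ` {..<Suc j} then v (Suc (the_inv_into {..<Suc j} e i)) else 0)"
    have we: "w (e a) = v (Suc a)" if "a < Suc j" for a
      using that the_inv_into_f_f[OF enum(1), of a] by (simp add: w_def)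
    have w0: "\<forall>i. i \<notin> free_weights \<longrightarrow> w i = 0" using enum(2) by (auto simp: w_def)
    have wK: "range w \<subseteq> K" using v by (auto simp: w_def)
    let ?o = "\<lambda>\<tau>. out (\<lambda>i. p i + \<tau> * w i)"
    have "\<forall>i. \<exists>P. \<forall>\<tau>. poly_eval (form_coords (?o \<tau>)) (g i) = poly P \<tau>"
      using polyfun_on_line[OF polyfun_poly_eval_family[OF poly_family_out mh_subset[OF g]]] by blast
    then obtain P where P: "\<And>i \<tau>. poly_eval (form_coords (?o \<tau>)) (g i) = poly (P i) \<tau>" by metis
    have P0: "poly (P i) 0 = poly_eval (form_coords (out p)) (g i)" for i
      using P[of 0 i] by simp
    have "poly (P 0) 0 = ?b" unfolding P0 by (simp add: g_def)
    moreover have "poly (P i) 0 = 0 \<and> poly.coeff (P i) 1 = v i" if i: "i \<in> {1..j + 1}" for i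
    proof -
      obtain a where a: "i = Suc a" "a < Suc j" using i by (cases i) auto
      have "((\<lambda>\<tau>. poly_eval (form_coords (?o \<tau>)) (H (e a))) has_field_derivative w (e a)) (at 0)"
        using dH w0 enum(2) a by blast
      moreover have "(\<lambda>\<tau>. poly_eval (form_coords (?o \<tau>)) (H (e a))) = poly (P i)"
        using P[of _ i] by (auto simp: g_def a)
      ultimately have "(poly (P i) has_field_derivative w (e a)) (at 0)" by simp
      then have "poly (pderiv (P i)) 0 = w (e a)" using DERIV_unique poly_DERIV by blast
      then have "poly.coeff (P i) 1 = v i" using we a by (simp add: poly_0_coeff_0 coeff_pderiv)
      then show ?thesis unfolding P0 using H(2) by (simp add: g_def a)
    qed
    moreover have "hom_comb (\<lambda>a. [:c a:]) (j + 1) N P = 0"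
    proof -
      obtain f where f: "f \<in> polyfun K weight_set" "f p \<noteq> 0"
        "\<And>z. range z \<subseteq> K \<Longrightarrow> f z \<noteq> 0 \<Longrightarrow> z \<in> family_dom out"
        using nonzero_coord_polyfun[OF poly_family_out, of p] pK out_p_nonzero by (auto simp: family_dom_def)
      obtain Q where Q: "\<And>\<tau>. f (\<lambda>i. p i + \<tau> * w i) = poly Q \<tau>"
        using polyfun_on_line[OF f(1), of p w] by blast
      have "Q \<noteq> 0" using Q[of 0] f(2) by auto
      have hc: "poly (hom_comb (\<lambda>a. [:c a:]) (j + 1) N P) \<tau> = poly_eval (form_coords (?o \<tau>)) ?R" for \<tau>
        unfolding poly_eval_hom_comb P by (simp add: hom_comb_def poly_sum poly_prod)
      have "poly (Q * hom_comb (\<lambda>a. [:c a:]) (j + 1) N P) \<tau> = 0" if \<tau>: "\<tau> \<in> K" for \<tau>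
      proof (cases "poly Q \<tau> = 0")
        case False
        let ?y = "\<lambda>i. p i + \<tau> * w i"
        have yK: "range ?y \<subseteq> K" using pK wK \<tau> by (auto simp: image_subset_iff)
        then have "?y \<in> family_dom out" using f(3) False Q by simp
        moreover have oy: "?F' ?y = out ?y"
          unfolding out_on_def by (rule arg_cong[of _ _ out]) (auto simp: w_def)
        ultimately have yd: "?y \<in> family_dom ?F'" by (simp add: family_dom_def)
        then have "pev (proj_tuple (?F' ?y)) ?R = 0" using van by (auto simp: family_image_def)
        then show ?thesis using pev_family[OF F' yd R] hc oy by simp
      qed simp
      then have "Q * hom_comb (\<lambda>a. [:c a:]) (j + 1) N P = 0" using poly_nonzero_in_subfield by blast
      then show ?thesis using \<open>Q \<noteq> 0\<close> by simp
    qed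
    ultimately show "\<exists>P. poly (P 0) 0 = ?b \<and>
        (\<forall>i\<in>{1..j + 1}. poly (P i) 0 = 0 \<and> poly.coeff (P i) 1 = v i) \<and>
        hom_comb (\<lambda>a. [:c a:]) (j + 1) N P = 0"
      by blast
  qed
  then show False using c(2) by blast
qed

lemma family_image_out_on_mono:
  assumes "S \<subseteq> S'" shows "family_image (out_on S p) \<subseteq> family_image (out_on S' p)"
proof
  fix P assume "P \<in> family_image (out_on S p)"
  then obtain x where x: "x \<in> family_dom (out_on S p)" "P = proj_tuple (out_on S p x)"
    by (auto simp: family_image_def)
  define y where "y = (\<lambda>i. if i \<in> S then x i else p i)"
  have eq: "out_on S' p y = out_on S p x"
    unfolding out_on_def by (rule arg_cong[of _ _ out], rule ext) (use assms in \<open>auto simp: y_def\<close>)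
  have "range y \<subseteq> K" using x(1) pK by (auto simp: y_def family_dom_def)
  then have "y \<in> family_dom (out_on S' p)" using x(1) eq by (simp add: family_dom_def)
  then have "proj_tuple (out_on S' p y) \<in> family_image (out_on S' p)"
    unfolding family_image_def by (rule imageI)
  then show "P \<in> family_image (out_on S' p)" using x(2) eq by simp
qed

lemma family_image_out_on_subset: "family_image (out_on S p) \<subseteq> family_image out"
proof
  fix P assume "P \<in> family_image (out_on S p)"
  then obtain x where x: "x \<in> family_dom (out_on S p)" "P = proj_tuple (out_on S p x)"
    by (auto simp: family_image_def)
  define y where "y = (\<lambda>i. if i \<in> S then x i else p i)"
  have y: "y \<in> family_dom out" "out y = out_on S p x"
    using x(1) pK by (auto simp: y_def family_dom_def out_on_def)
  have "proj_tuple (out y) \<in> family_image out"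
    unfolding family_image_def by (rule imageI) (rule y)
  then show "P \<in> family_image out" using x(2) y(2) by simp
qed

lemma long_chain:
  "\<exists>Z. (\<forall>i\<le>card free_weights. closedin zar (Z i) \<and> irreducible_space (subtopology zar (Z i)) \<and>
       Z i \<subseteq> zar closure_of family_image out) \<and>
     (\<forall>i<card free_weights. Z i \<subset> Z (Suc i))"
proof -
  obtain e where e: "bij_betw e {..<card free_weights} free_weights"
    using ex_bij_betw_nat_finite[OF finite_free_weights] by (auto simp: atLeast0LessThan)
  define Z where "Z = (\<lambda>i. zar closure_of family_image (out_on (e ` {..<i}) p))"
  have "closedin zar (Z i) \<and> irreducible_space (subtopology zar (Z i)) \<and>
       Z i \<subseteq> zar closure_of family_image out" for i
    unfolding Z_def using family_closure[OF poly_family_out_on[OF pK]] p_in_family_dom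
    by (auto intro!: closure_of_mono family_image_out_on_subset)
  moreover have "Z i \<subset> Z (Suc i)" if i: "i < card free_weights" for i
  proof -
    have "{..<Suc i} \<subseteq> {..<card free_weights}" using i by auto
    then have "inj_on e {..<Suc i}" "e ` {..<Suc i} \<subseteq> free_weights"
      using e unfolding bij_betw_def by (auto intro: inj_on_subset)
    then have "Z i \<noteq> Z (Suc i)" unfolding Z_def by (rule closure_strict_mono)
    moreover have "Z i \<subseteq> Z (Suc i)"
      unfolding Z_def by (intro closure_of_mono family_image_out_on_mono image_mono) auto
    ultimately show ?thesis by blast
  qed
  ultimately show ?thesis by blast
qed

end

text \<open>Irreducible closed subsets of a closed subspace are irreducible closed sets of the whole space.\<close>

lemma (in multiproj) krull_dim_eqI:
  assumes V: "closedin zar V"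
    and upper: "\<And>r Z. (\<And>i. i \<le> r \<Longrightarrow> closedin zar (Z i) \<and> irreducible_space (subtopology zar (Z i)) \<and> Z i \<subseteq> V) \<Longrightarrow>
      (\<And>i. i < r \<Longrightarrow> Z i \<subset> Z (Suc i)) \<Longrightarrow> r \<le> s"
    and lower: "\<exists>Z. (\<forall>i\<le>s. closedin zar (Z i) \<and> irreducible_space (subtopology zar (Z i)) \<and> Z i \<subseteq> V) \<and>
      (\<forall>i<s. Z i \<subset> Z (Suc i))"
  shows "krull_dim (subtopology zar V) = enat s"
proof -
  have iff: "closedin (subtopology zar V) A \<and> irreducible_space (subtopology (subtopology zar V) A) \<longleftrightarrow>
      closedin zar A \<and> irreducible_space (subtopology zar A) \<and> A \<subseteq> V" for A
  proof -
    have "V \<inter> A = A" if "A \<subseteq> V" using that by blast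
    then show ?thesis using closedin_sub_iff[OF V] by (auto simp: subtopology_subtopology)
  qed
  show ?thesis
    unfolding krull_dim_def iff
  proof (rule antisym)
    show "Sup {enat r | r. \<exists>Z. (\<forall>i\<le>r. closedin zar (Z i) \<and> irreducible_space (subtopology zar (Z i)) \<and> Z i \<subseteq> V) \<and>
        (\<forall>i<r. Z i \<subset> Z (Suc i))} \<le> enat s"
    proof (rule Sup_least, elim CollectE exE conjE)
      fix x r and Z :: "nat \<Rightarrow> (nat \<Rightarrow> nat cpoly set) set"
      assume x: "x = enat r" and "\<forall>i\<le>r. closedin zar (Z i) \<and> irreducible_space (subtopology zar (Z i)) \<and> Z i \<subseteq> V"
        "\<forall>i<r. Z i \<subset> Z (Suc i)"
      then have "r \<le> s" by (intro upper[of r Z]) blast+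
      then show "x \<le> enat s" by (simp add: x)
    qed
    show "enat s \<le> Sup {enat r | r. \<exists>Z. (\<forall>i\<le>r. closedin zar (Z i) \<and> irreducible_space (subtopology zar (Z i)) \<and> Z i \<subseteq> V) \<and>
        (\<forall>i<r. Z i \<subset> Z (Suc i))}"
      using lower by (intro Sup_upper) blast
  qed
qed

theorem theoremA:
  fixes K :: "complex set" and L :: nat and n d :: "nat \<Rightarrow> nat"
  assumes "subfield K (ring_of_type_algebra :: complex ring)"
    and "L \<ge> 2"
    and "n L \<ge> 1"
    and "\<And>i. i \<le> L - 1 \<Longrightarrow> n i \<ge> 2"
    and "\<And>i. 1 \<le> i \<Longrightarrow> i \<le> L - 1 \<Longrightarrow> d i \<ge> 2 * n i - 1"
  shows "\<not> defective K L n d \<and>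
         neurovariety_dim K L n d = enat (\<Sum>i=1..L. n i * (n (i - 1) - 1))"
proof -
  interpret network_setup K L n d
    by (intro network_setup.intro complex_subfield.intro network_setup_axioms.intro assms(1)) (use assms(2) in simp)
  have n2: "2 \<le> n j" if "j < L" for j using assms(4)[of j] that by simp
  have n1: "1 \<le> n j" if "j \<le> L" for j using n2[of j] assms(3) that by (cases "j = L") auto
  have d: "2 * n j - 1 \<le> d j" if "1 \<le> j" "j < L" for j using assms(5)[of j] that by simp
  have d2: "2 \<le> d j" if "1 \<le> j" "j < L" for j using d[OF that] n2[of j] that by simp
  obtain p where p: "range p \<subseteq> K" "\<And>w. w \<in> weight_set \<Longrightarrow> p w \<noteq> 0"
    "\<And>i. 1 \<le> i \<Longrightarrow> i < L \<Longrightarrow> layer_independent n d p i"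
    using generic_weights[OF n2 d] by blast
  interpret generic_network K L n d p
    by (intro generic_network.intro generic_network_axioms.intro network_setup_axioms)
      (use assms(2) n1 d2 p in auto)
  have dim: "neurovariety_dim K L n d = enat (\<Sum>i=1..L. n i * (n (i - 1) - 1))"
    unfolding neurovariety_dim_def neurovariety_eq card_free_weights[symmetric]
  proof (rule krull_dim_eqI)
    show "closedin zar (zar closure_of family_image out)" by simp
    show "r \<le> card free_weights"
      if "\<And>i. i \<le> r \<Longrightarrow> closedin zar (Z i) \<and> irreducible_space (subtopology zar (Z i)) \<and>
          Z i \<subseteq> zar closure_of family_image out"
        "\<And>i. i < r \<Longrightarrow> Z i \<subset> Z (Suc i)" for r Z
      by (rule chain_length_le[of r Z]) (use that n1 in auto)
  qed (rule long_chain)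
  moreover have "expected_dim L n d \<le> (\<Sum>i=1..L. n i * (n (i - 1) - 1))"
    unfolding expected_dim_def Let_def by auto
  ultimately show ?thesis by (simp add: defective_def)
qed

end
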